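(* Among all integers $p_1,p_2\ge 3$ with $\frac1{p_1}+\frac1{p_2}<\frac12$, the maximum of the optimal simply transitive geodesic ball packing density $\delta^{opt}(\Gamma_{(2,p_1,p_2)})$ is realized with the parameters $(2,p_1,p_2)=(2,5,4)$ and $(2,4,5)$, and the maximal density is $\delta^{opt}=0.53975\dots$.
   Context: $\mathbf{H}^2\times\mathbf{R}$ denotes the Riemannian product of the hyperbolic plane of curvature $-1$ and the real line, with geodesic distance $d$ and Riemannian volume $\mathrm{vol}$. A geodesic ball $B(\rho)$ of radius $\rho$ has volume $\mathrm{vol}(B(\rho))=2\pi\int_0^\rho\int_{-\pi/2}^{\pi/2}\tau\sinh(\tau\cos v)\,dv\,d\tau$. Groups. For integers $p_1,p_2\ge 3$ with $\frac1{p_1}+\frac1{p_2}<\frac12$, let $ABC\subset\mathbf{H}^2$ be a triangle with angles $\frac{\pi}{2},\frac{\pi}{p_1},\frac{\pi}{p_2}$ at $A,B,C$. Let $\Gamma_0$ be the discrete group of isometries of $\mathbf{H}^2$ generated by the rotation $\mathbf{g}_0$ by $\pi$ about $A$ and the rotation $\mathbf{g}_1$ by $2\pi/p_1$ about $B$, with senses chosen so that $\mathbf{g}_2=\mathbf{g}_0\mathbf{g}_1$ is a rotation by $2\pi/p_2$ about $C$. For a real number $r>0$ (the free lattice parameter) the space group $\Gamma=\Gamma_{(2,p_1,p_2)}$ is $\Gamma_0\times r\mathbf{Z}$, acting on $\mathbf{H}^2\times\mathbf{R}$ by $\Gamma_0$ on the first factor and by the translations $t\mapsto t+kr$, $k\in\mathbf{Z}$,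 on the second. Packings. For $K\in\mathbf{H}^2\times\mathbf{R}$ with trivial stabilizer in $\Gamma$, put $\rho(K)=\min_{\mathbf{g}\in\Gamma\setminus\{1\}}\frac12 d(K,K^{\mathbf{g}})$, let $\mathcal{D}(K)=\{X: d(K,X)\le d(K^{\mathbf{g}},X)\ \forall\,\mathbf{g}\in\Gamma\}$ be the Dirichlet--Voronoi cell, and let $\delta(K)=\mathrm{vol}(B(\rho(K)))/\mathrm{vol}(\mathcal{D}(K))$ be the density of the packing formed by the $\Gamma$-images of the ball of radius $\rho(K)$ centred at $K$ (a simply transitive ball packing). The optimal density is $\delta^{opt}(\Gamma_{(2,p_1,p_2)})=\max\delta(K)$, the maximum being taken over all $K$ with trivial stabilizer and all lattice parameters $r>0$. A value written $0.53975\dots$ means a real number whose decimal expansion begins with the displayed digits. *)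

theory Defs
  imports "HOL-Complex_Analysis.Complex_Analysis" "HOL-Algebra.Bij" "HOL-Algebra.Generated_Groups"
begin

text \<open>
  The hyperbolic plane of curvature -1 is taken in the Poincare disk model: the open unit disk
  with the metric \<open>4 |dz|\<^sup>2 / (1 - |z|\<^sup>2)\<^sup>2\<close>.
\<close>

definition H2 :: "complex set" where
  "H2 = ball 0 1"

definition h2_dist :: "complex \<Rightarrow> complex \<Rightarrow> real" where
  "h2_dist z w = arcosh (1 + 2 * (cmod (z - w))\<^sup>2 / ((1 - (cmod z)\<^sup>2) * (1 - (cmod w)\<^sup>2)))"

text \<open>
  \<open>Moebius_function 0 P\<close> is an isometry of the disk taking \<open>P\<close> to the centre. It is conformal, and
  the geodesics through the centre are the Euclidean diameters, so angles at \<open>P\<close> and rotations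
  about \<open>P\<close> can be read off at the centre.
\<close>

definition h2_angle :: "complex \<Rightarrow> complex \<Rightarrow> complex \<Rightarrow> real" where
  \<comment> \<open>the angle at \<open>P\<close> between the geodesic rays to \<open>Q\<close> and to \<open>R\<close>\<close>
  "h2_angle Q P R = \<bar>Arg (Moebius_function 0 P R / Moebius_function 0 P Q)\<bar>"

text \<open>
  Isometries are restricted to the space on which they act, so that they are elements of
  \<^const>\<open>BijGroup\<close> of that space, and equality of isometries is equality of functions.
\<close>

definition h2_rotation :: "complex \<Rightarrow> real \<Rightarrow> complex \<Rightarrow> complex" where
  "h2_rotation P \<theta> = (\<lambda>z\<in>H2. Moebius_function 0 (- P) (cis \<theta> * Moebius_function 0 P z))"

definition h2_triangle :: "complex \<Rightarrow> complex \<Rightarrow> complex \<Rightarrow> real \<Rightarrow> real \<Rightarrow> real \<Rightarrow> bool" where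
  "h2_triangle A B C \<alpha> \<beta> \<gamma> \<longleftrightarrow>
     A \<in> H2 \<and> B \<in> H2 \<and> C \<in> H2 \<and> A \<noteq> B \<and> B \<noteq> C \<and> C \<noteq> A \<and>
     h2_angle B A C = \<alpha> \<and> h2_angle A B C = \<beta> \<and> h2_angle A C B = \<gamma>"

definition admissible :: "nat \<Rightarrow> nat \<Rightarrow> bool" where
  "admissible p1 p2 \<longleftrightarrow> 3 \<le> p1 \<and> 3 \<le> p2 \<and> 1 / real p1 + 1 / real p2 < 1 / 2"

text \<open>
  \<open>G\<close> is a group \<open>\<Gamma>\<^sub>0\<close> belonging to \<open>(2, p1, p2)\<close>. The signs \<open>s\<close> and \<open>s'\<close> are the senses of the
  rotations about \<open>B\<close> and \<open>C\<close>; the triangle may have either orientation.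
\<close>

definition triangle_rotation_group :: "nat \<Rightarrow> nat \<Rightarrow> (complex \<Rightarrow> complex) set \<Rightarrow> bool" where
  "triangle_rotation_group p1 p2 G \<longleftrightarrow>
     (\<exists>A B C. h2_triangle A B C (pi / 2) (pi / real p1) (pi / real p2) \<and>
       (\<exists>s\<in>{1, -1}. \<exists>s'\<in>{1, -1}. \<exists>g0 g1.
          g0 = h2_rotation A pi \<and>
          g1 = h2_rotation B (s * (2 * pi / real p1)) \<and>
          g0 \<otimes>\<^bsub>BijGroup H2\<^esub> g1 = h2_rotation C (s' * (2 * pi / real p2)) \<and>
          G = generate (BijGroup H2) {g0, g1}))"


definition H2R :: "(complex \<times> real) set" where
  "H2R = H2 \<times> UNIV"

definition h2r_dist :: "complex \<times> real \<Rightarrow> complex \<times> real \<Rightarrow> real" where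
  "h2r_dist X Y = sqrt ((h2_dist (fst X) (fst Y))\<^sup>2 + (snd X - snd Y)\<^sup>2)"

text \<open>
  The Riemannian volume: the density is the area density \<open>4 / (1 - |z|\<^sup>2)\<^sup>2\<close> of the disk model.
\<close>

definition h2r_vol :: "(complex \<times> real) measure" where
  "h2r_vol = density lborel
     (\<lambda>X. ennreal (4 / (1 - (cmod (fst X))\<^sup>2)\<^sup>2) * indicator H2R X)"

definition geodesic_ball :: "complex \<times> real \<Rightarrow> real \<Rightarrow> (complex \<times> real) set" where
  "geodesic_ball K \<rho> = {X \<in> H2R. h2r_dist K X \<le> \<rho>}"


definition space_group ::
    "(complex \<Rightarrow> complex) set \<Rightarrow> real \<Rightarrow> (complex \<times> real \<Rightarrow> complex \<times> real) set" where
  "space_group G r =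
     {\<lambda>X\<in>H2R. (g (fst X), snd X + of_int k * r) | g (k :: int). g \<in> G}"

definition trivial_stabilizer ::
    "(complex \<times> real \<Rightarrow> complex \<times> real) set \<Rightarrow> complex \<times> real \<Rightarrow> bool" where
  "trivial_stabilizer \<Gamma> K \<longleftrightarrow> (\<forall>g\<in>\<Gamma>. g K = K \<longrightarrow> g = \<one>\<^bsub>BijGroup H2R\<^esub>)"

text \<open>
  The orbits of the groups considered here are discrete, so the infimum is attained.
\<close>

definition packing_radius ::
    "(complex \<times> real \<Rightarrow> complex \<times> real) set \<Rightarrow> complex \<times> real \<Rightarrow> real" where
  "packing_radius \<Gamma> K = (INF g \<in> \<Gamma> - {\<one>\<^bsub>BijGroup H2R\<^esub>}. h2r_dist K (g K) / 2)"

definition dirichlet_voronoi_cell ::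
    "(complex \<times> real \<Rightarrow> complex \<times> real) set \<Rightarrow> complex \<times> real \<Rightarrow> (complex \<times> real) set" where
  "dirichlet_voronoi_cell \<Gamma> K = {X \<in> H2R. \<forall>g\<in>\<Gamma>. h2r_dist K X \<le> h2r_dist (g K) X}"

definition packing_density ::
    "(complex \<times> real \<Rightarrow> complex \<times> real) set \<Rightarrow> complex \<times> real \<Rightarrow> real" where
  "packing_density \<Gamma> K =
     measure h2r_vol (geodesic_ball K (packing_radius \<Gamma> K)) /
     measure h2r_vol (dirichlet_voronoi_cell \<Gamma> K)"

definition packing_densities :: "(complex \<Rightarrow> complex) set \<Rightarrow> real set" where
  "packing_densities G =
     {packing_density (space_group G r) K | r K.
        r > 0 \<and> K \<in> H2R \<and> trivial_stabilizer (space_group G r) K}"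

text \<open>
  This is the maximum only if the set of densities has one; otherwise the value is unspecified.
\<close>

definition optimal_density :: "(complex \<Rightarrow> complex) set \<Rightarrow> real" where
  "optimal_density G = (GREATEST \<delta>. \<delta> \<in> packing_densities G)"

end

theory Submission
  imports Defs
begin

text \<open>
  In the hyperboloid model the group \<open>\<Gamma>\<^sub>0\<close> is the even part of the Coxeter group generated by the
  reflections in the sides of the triangle. By Tits' theorem every root of that group is positive
  or negative, and this has three consequences: the images of the chamber tile the plane, so every
  Dirichlet cell has area twice that of the triangle, \<open>\<pi> (1 - 2/p\<^sub>1 - 2/p\<^sub>2)\<close>; for a point of the closed
  chamber the nearest translate is already reached by a product of two of the three reflections;
  and hence the smallest displacement of a point is an explicit function of its distances to the
  walls. The ball volume is \<open>2 \<pi> \<rho>\<close> times an increasing function of \<open>\<rho>\<close>, so the best lattice parameter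
  is \<open>r = 2 \<rho>\<close>, and the density is governed by the largest displacement in the chamber.

  This maximum is bounded from above by the Cauchy-Schwarz inequality, by comparison with the point
  at which the three rotations have equal displacement. For every pair other than \<open>{4, 5}\<close> a crude
  form of the bound gives density at most \<open>0.53975\<close>; for \<open>{4, 5}\<close> a sharp form and one explicit
  point enclose the density.
\<close>

section \<open>Reflection groups preserving a bilinear form\<close>

text \<open>Word length is measured in the linear group itself, so no abstract presentation enters.
  For displacements weak inequalities suffice, which admits points on the walls: a chamber point of
  positive displacement has trivial stabilizer. With \<open>r = 2 * \<rho>\<close> the density is
  \<open>ball_profile (radius S) / defect\<close>, where S is the displacement and the defect is 1 -
  2/p1 - 2/p2. Infinitely many pairs remain, and they are treated uniformly in the defect a: the
  squared radius is guessed as q a, a Taylor polynomial of sinh^2 turns the guess into a candidate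
  S, and it is enough that no displacement exceeds S. The density bound is then about 2 q / 3 + 2
  q^2 a / 45. If both parameters are at least 4, the defect is at least 1/6 except for {4, 5}, where
  it is 1/10. Pairs containing 3 go down to 1/21, which needs another constant, but there one cosine
  is exactly 1/2. The value for {4, 5} lies so close above 0.53975 that its displacement is enclosed
  to within 10^-6.\<close>

locale coxeter_form =
  fixes B :: "'v::real_vector \<Rightarrow> 'v \<Rightarrow> real" and u :: "'i::finite \<Rightarrow> 'v" and m :: "'i \<Rightarrow> 'i \<Rightarrow> nat"
  assumes B_add: "B (x + y) z = B x z + B y z"
    and B_scale: "B (c *\<^sub>R x) z = c * B x z"
    and B_sym: "B x y = B y x"
    and unit: "B (u i) (u i) = 1"
    and gram: "i \<noteq> j \<Longrightarrow> B (u i) (u j) = - cos (pi / real (m i j))"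
    and m_sym: "m i j = m j i"
    and m_ge_2: "i \<noteq> j \<Longrightarrow> 2 \<le> m i j"
begin

lemma B_add2: "B z (x + y) = B z x + B z y"
  by (metis B_add B_sym)

lemma B_scale2: "B z (c *\<^sub>R x) = c * B z x"
  by (metis B_scale B_sym)

lemma B_minus: "B (- x) z = - B x z"
  using B_scale[of "-1" x z] by simp

lemma B_diff: "B (x - y) z = B x z - B y z"
  using B_add[of x "-y" z] by (simp add: B_minus)

lemma B_diff2: "B z (x - y) = B z x - B z y"
  by (metis B_diff B_sym)

lemma B_zero: "B 0 z = 0"
  using B_scale[of 0 0 z] by simp

lemma B_sum: "B (\<Sum>i\<in>I. f i) z = (\<Sum>i\<in>I. B (f i) z)"
  by (induction I rule: infinite_finite_induct) (auto simp: B_zero B_add)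

lemmas B_simps = B_add B_add2 B_scale B_scale2 B_diff B_diff2

definition refl :: "'i \<Rightarrow> 'v \<Rightarrow> 'v" where
  "refl i v = v - (2 * B v (u i)) *\<^sub>R u i"

abbreviation act :: "'i list \<Rightarrow> 'v \<Rightarrow> 'v" where
  "act \<equiv> foldr refl"

lemma refl_add: "refl i (v + w) = refl i v + refl i w"
  by (simp add: refl_def B_add algebra_simps)

lemma refl_scale: "refl i (c *\<^sub>R v) = c *\<^sub>R refl i v"
  by (simp add: refl_def B_scale algebra_simps)

lemma B_refl: "B (refl i v) (refl i w) = B v w"
  by (simp add: refl_def B_simps unit B_sym[of w] algebra_simps)

lemma refl_refl [simp]: "refl i (refl i v) = v"
  by (simp add: refl_def B_simps unit algebra_simps flip: scaleR_add_left)

lemma refl_self: "refl i (u i) = - u i"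
  by (simp add: refl_def unit scaleR_2)

lemma refl_other: "i \<noteq> j \<Longrightarrow> refl j (u i) = u i + (2 * cos (pi / real (m i j))) *\<^sub>R u j"
  by (simp add: refl_def gram)

lemma act_add: "act w (v + v') = act w v + act w v'"
  by (induction w) (auto simp: refl_add)

lemma act_scale: "act w (c *\<^sub>R v) = c *\<^sub>R act w v"
  by (induction w) (auto simp: refl_scale)

lemma act_minus: "act w (- v) = - act w v"
  using act_scale[of w "-1" v] by simp

lemma act_diff: "act w (v - v') = act w v - act w v'"
  using act_add[of w v "-v'"] by (simp add: act_minus)

lemma B_act: "B (act w v) (act w v') = B v v'"
  by (induction w) (auto simp: B_refl)

lemma act_rev [simp]: "act (rev w) (act w v) = v"
  by (induction w arbitrary: v) auto

lemma act_rev' [simp]: "act w (act (rev w) v) = v"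
  using act_rev[of "rev w" v] by simp

lemma act_fixed: "B n (u i) = 0 \<Longrightarrow> B n (u j) = 0 \<Longrightarrow> set w \<subseteq> {i, j} \<Longrightarrow> act w n = n"
  by (induction w) (auto simp: refl_def)

text \<open>The alternating word of length \<open>n\<close> in \<open>i\<close> and \<open>j\<close> that ends with \<open>j\<close>.\<close>

primrec alt :: "'i \<Rightarrow> 'i \<Rightarrow> nat \<Rightarrow> 'i list" where
  "alt i j 0 = []"
| "alt i j (Suc n) = alt j i n @ [j]"

lemma length_alt [simp]: "length (alt i j n) = n"
  by (induction n arbitrary: i j) auto

lemma set_alt: "set (alt i j n) \<subseteq> {i, j}"
proof (induction n arbitrary: i j)
  case (Suc n)
  show ?case using Suc[of j i] by auto
qed simp

lemma alt_split: "\<exists>zs. alt i j (n + k) = zs @ alt i j k \<and> length zs = n"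
proof (induction k arbitrary: i j)
  case (Suc k)
  then obtain zs where "alt j i (n + k) = zs @ alt j i k" "length zs = n" by blast
  then show ?case by auto
qed simp

lemma sin_pi_m_pos: "i \<noteq> j \<Longrightarrow> 0 < sin (pi / real (m i j))"
  using m_ge_2[of i j] by (intro sin_gt_zero) (auto simp: field_simps)

text \<open>In the span of \<open>u i\<close> and \<open>u j\<close> the roots of the dihedral group
  have the sines of consecutive multiples of \<theta> as coefficients. Applying the last letter of
  the word to the root gives the three-term recurrence of these sines, hence the strong induction;
  the factor \<open>sin \<theta>\<close> clears the denominator.\<close>

lemma act_alt_root:
  assumes "i \<noteq> j"
  defines "\<theta> \<equiv> pi / real (m i j)"
  shows "sin \<theta> *\<^sub>R act (alt i j n) (u i) =
    sin (real (n + 1) * \<theta>) *\<^sub>R u (if even n then i else j) + sin (real n * \<theta>) *\<^sub>R u (if even n then j else i)"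
  using assms(1) unfolding \<theta>_def
proof (induction n arbitrary: i j rule: less_induct)
  case (less n)
  define \<theta> where "\<theta> = pi / real (m i j)"
  have \<theta>': "pi / real (m j i) = \<theta>" by (simp add: \<theta>_def m_sym[of j i])
  consider "n = 0" | "n = 1" | k where "n = Suc (Suc k)"
    by (metis One_nat_def not0_implies_Suc)
  then show ?case
  proof cases
    case 1 then show ?thesis by simp
  next
    case 2
    have "sin (real (n + 1) * \<theta>) = 2 * sin \<theta> * cos \<theta>"
      using sin_double[of \<theta>] by (simp add: 2)
    then show ?thesis
      using less.prems unfolding \<theta>_def[symmetric]
      by (simp add: 2 refl_other scaleR_add_right flip: \<theta>_def)
  next
    case 3
    have R1: "sin \<theta> *\<^sub>R act (alt j i (Suc k)) (u j) =
       sin (real (Suc k + 1) * \<theta>) *\<^sub>R u (if even (Suc k) then j else i) + sin (real (Suc k) * \<theta>) *\<^sub>R u (if even (Suc k) then i else j)"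
      using less.IH[of "Suc k" j i] less.prems 3 \<theta>' by (auto simp: \<theta>_def)
    have R0: "sin \<theta> *\<^sub>R act (alt i j k) (u i) =
       sin (real (k + 1) * \<theta>) *\<^sub>R u (if even k then i else j) + sin (real k * \<theta>) *\<^sub>R u (if even k then j else i)"
      using less.IH[of k i j] less.prems 3 by (auto simp: \<theta>_def)
    have "act (alt i j n) (u i) = act (alt j i (Suc k)) (u i + (2 * cos \<theta>) *\<^sub>R u j)"
      using less.prems by (simp add: 3 refl_other \<theta>_def)
    also have "\<dots> = act (alt j i (Suc k)) (u i) + (2 * cos \<theta>) *\<^sub>R act (alt j i (Suc k)) (u j)"
      by (simp only: act_add act_scale)
    also have "act (alt j i (Suc k)) (u i) = - act (alt i j k) (u i)"
      by (simp add: refl_self act_minus)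
    finally have "sin \<theta> *\<^sub>R act (alt i j n) (u i) =
       - (sin \<theta> *\<^sub>R act (alt i j k) (u i)) + (2 * cos \<theta>) *\<^sub>R (sin \<theta> *\<^sub>R act (alt j i (Suc k)) (u j))"
      by (simp only: scaleR_add_right scaleR_minus_right scaleR_scaleR mult.commute)
    also have "\<dots> = (2 * cos \<theta> * sin (real (Suc k + 1) * \<theta>) - sin (real (k + 1) * \<theta>)) *\<^sub>R u (if even k then i else j)
        + (2 * cos \<theta> * sin (real (Suc k) * \<theta>) - sin (real k * \<theta>)) *\<^sub>R u (if even k then j else i)"
      unfolding R1 R0 by (auto simp: algebra_simps)
    also have "2 * cos \<theta> * sin (real (Suc k + 1) * \<theta>) - sin (real (k + 1) * \<theta>) = sin (real (n + 1) * \<theta>)"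
    proof -
      have e: "real (n + 1) * \<theta> = real (Suc k + 1) * \<theta> + \<theta>" "real (k + 1) * \<theta> = real (Suc k + 1) * \<theta> - \<theta>"
        by (auto simp: 3 algebra_simps)
      show ?thesis unfolding e sin_add sin_diff by simp
    qed
    also have "2 * cos \<theta> * sin (real (Suc k) * \<theta>) - sin (real k * \<theta>) = sin (real n * \<theta>)"
    proof -
      have e: "real n * \<theta> = real (Suc k) * \<theta> + \<theta>" "real k * \<theta> = real (Suc k) * \<theta> - \<theta>"
        by (auto simp: 3 algebra_simps)
      show ?thesis unfolding e sin_add sin_diff by simp
    qed
    finally show ?thesis by (simp add: 3 \<theta>_def)
  qed
qed

text \<open>The form may be indefinite, but on the span of \<open>u i\<close> and \<open>u j\<close>
  its Gram determinant is the square of \<open>sin (pi / m i j)\<close> and not zero, so the space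
  splits orthogonally.\<close>

lemma orthogonal_complement:
  assumes "i \<noteq> j"
  obtains x y n where "v = x *\<^sub>R u i + y *\<^sub>R u j + n" "B n (u i) = 0" "B n (u j) = 0"
proof -
  define c where "c = B (u i) (u j)"
  have c: "1 - c\<^sup>2 \<noteq> 0"
  proof -
    have "1 - c\<^sup>2 = (sin (pi / real (m i j)))\<^sup>2"
      by (simp add: c_def gram assms sin_squared_eq)
    with sin_pi_m_pos[OF assms] show ?thesis by simp
  qed
  define p where "p = B v (u i)"
  define q where "q = B v (u j)"
  define x where "x = (p - c * q) / (1 - c\<^sup>2)"
  define y where "y = (q - c * p) / (1 - c\<^sup>2)"
  have "x + y * c = p" "x * c + y = q"
  proof -
    have "x + y * c = (p * (1 - c\<^sup>2)) / (1 - c\<^sup>2)" "x * c + y = (q * (1 - c\<^sup>2)) / (1 - c\<^sup>2)"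
      by (simp_all add: x_def y_def power2_eq_square algebra_simps flip: add_divide_distrib)
    then show "x + y * c = p" "x * c + y = q" using c by simp_all
  qed
  then have "B (v - x *\<^sub>R u i - y *\<^sub>R u j) (u i) = 0" "B (v - x *\<^sub>R u i - y *\<^sub>R u j) (u j) = 0"
    by (simp_all add: B_simps unit B_sym[of "u j" "u i"] flip: c_def p_def q_def)
  then show ?thesis
    using that[of x y "v - x *\<^sub>R u i - y *\<^sub>R u j"] by auto
qed

text \<open>This word is the longest element of the dihedral group: at n \<theta> = pi the sines of
  \<open>act_alt_root\<close> leave only the negative of a simple root.\<close>

lemma act_alt_m:
  assumes "i \<noteq> j"
  defines "n \<equiv> m i j"
  shows "act (alt i j n) (u i) = - u (if even n then i else j)"
    and "act (alt i j n) (u j) = - u (if even n then j else i)"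
proof -
  define \<theta> where "\<theta> = pi / real n"
  have pos: "sin \<theta> > 0" using sin_pi_m_pos[OF assms(1)] by (simp add: \<theta>_def n_def)
  obtain k where n: "n = Suc k" "k \<ge> 1" using m_ge_2[OF assms(1)] by (cases n) (auto simp: n_def)
  have \<theta>: "real n * \<theta> = pi" by (simp add: \<theta>_def n)
  have \<theta>2: "real (n + 1) * \<theta> = pi + \<theta>" "real k * \<theta> = pi - \<theta>"
    using \<theta> by (simp_all add: n algebra_simps)
  have "sin \<theta> *\<^sub>R act (alt i j n) (u i) = sin \<theta> *\<^sub>R (- u (if even n then i else j))"
    using act_alt_root[OF assms(1), of n] unfolding \<theta>2 \<theta> n_def[symmetric] \<theta>_def[symmetric] by simp
  then show "act (alt i j n) (u i) = - u (if even n then i else j)"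
    using pos by (simp only: scaleR_cancel_left) simp
  have "sin \<theta> *\<^sub>R act (alt j i k) (u j) = sin \<theta> *\<^sub>R u (if even n then j else i)"
    using act_alt_root[OF assms(1)[symmetric], of k] \<theta>
    unfolding m_sym[of j i] n_def[symmetric] \<theta>_def[symmetric] \<theta>2 by (auto simp: n)
  then have "act (alt j i k) (u j) = u (if even n then j else i)"
    using pos by (simp only: scaleR_cancel_left) simp
  then show "act (alt i j n) (u j) = - u (if even n then j else i)"
    by (simp add: n refl_self act_minus)
qed

text \<open>Both words fix the orthogonal complement of the two roots, and on the roots they agree
  by \<open>act_alt_m\<close>.\<close>

lemma braid:
  assumes "i \<noteq> j"
  shows "act (alt i j (m i j)) = act (alt j i (m i j))"
proof
  fix v
  obtain x y n where v: "v = x *\<^sub>R u i + y *\<^sub>R u j + n" and n: "B n (u i) = 0" "B n (u j) = 0"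
    using orthogonal_complement[OF assms, of v] by metis
  have "act (alt i j (m i j)) n = n" "act (alt j i (m i j)) n = n"
    using act_fixed[OF n] act_fixed[OF n(2,1)] set_alt by blast+
  moreover have "act (alt i j (m i j)) (u i) = act (alt j i (m i j)) (u i)" "act (alt i j (m i j)) (u j) = act (alt j i (m i j)) (u j)"
    using act_alt_m[OF assms] act_alt_m[OF assms[symmetric]] by (simp_all add: m_sym[of j i])
  ultimately show "act (alt i j (m i j)) v = act (alt j i (m i j)) v"
    by (simp add: v act_add act_scale)
qed

section \<open>Reduced words and positive roots\<close>

definition reduced :: "'i list \<Rightarrow> bool" where
  "reduced w \<longleftrightarrow> (\<forall>w'. act w' = act w \<longrightarrow> length w \<le> length w')"

definition pos :: "'v \<Rightarrow> bool" where
  "pos v \<longleftrightarrow> (\<exists>a. (\<forall>i. 0 \<le> a i) \<and> v = (\<Sum>i\<in>UNIV. a i *\<^sub>R u i))"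

lemma pos_add: "pos v \<Longrightarrow> pos w \<Longrightarrow> pos (v + w)"
  unfolding pos_def
proof (elim exE conjE)
  fix a b assume "\<forall>i. 0 \<le> a i" "v = (\<Sum>i\<in>UNIV. a i *\<^sub>R u i)" "\<forall>i. 0 \<le> b i" "w = (\<Sum>i\<in>UNIV. b i *\<^sub>R u i)"
  then show "\<exists>a. (\<forall>i. 0 \<le> a i) \<and> v + w = (\<Sum>i\<in>UNIV. a i *\<^sub>R u i)"
    by (intro exI[of _ "\<lambda>i. a i + b i"]) (auto simp: scaleR_add_left sum.distrib)
qed

lemma pos_scale: "0 \<le> c \<Longrightarrow> pos v \<Longrightarrow> pos (c *\<^sub>R v)"
  unfolding pos_def
proof (elim exE conjE)
  fix a assume "0 \<le> c" "\<forall>i. 0 \<le> a i" "v = (\<Sum>i\<in>UNIV. a i *\<^sub>R u i)"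
  then show "\<exists>a. (\<forall>i. 0 \<le> a i) \<and> c *\<^sub>R v = (\<Sum>i\<in>UNIV. a i *\<^sub>R u i)"
    by (intro exI[of _ "\<lambda>i. c * a i"]) (auto simp: scaleR_sum_right)
qed

lemma pos_u: "pos (u i)"
  unfolding pos_def
  by (intro exI[of _ "\<lambda>j. if j = i then 1 else 0"]) (auto simp: if_distrib[of "\<lambda>c. c *\<^sub>R _"] cong: if_cong)

lemma pos_0: "pos 0"
  using pos_scale[of 0 "u undefined"] pos_u by simp

lemma reduced_length: "reduced w \<Longrightarrow> act w' = act w \<Longrightarrow> length w \<le> length w'"
  by (auto simp: reduced_def)

lemma reduced_no_repeat: "\<not> reduced (p @ [a, a] @ q)"
proof
  assume "reduced (p @ [a, a] @ q)"
  moreover have "act (p @ q) = act (p @ [a, a] @ q)" by (simp add: fun_eq_iff)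
  ultimately show False using reduced_length by fastforce
qed

text \<open>In Tits' argument this determines the dihedral suffix by its length alone.\<close>

lemma alt_unique:
  assumes "set ys \<subseteq> {s, t}" "\<And>p a q. ys \<noteq> p @ [a, a] @ q" "\<And>zs. ys \<noteq> zs @ [s]"
  shows "ys = alt s t (length ys)"
  using assms
proof (induction ys arbitrary: s t rule: rev_induct)
  case (snoc x zs)
  have x: "x = t" using snoc.prems(1,3) by auto
  have "zs = alt t s (length zs)"
  proof (rule snoc.IH)
    show "set zs \<subseteq> {t, s}" using snoc.prems(1) by auto
    show "zs \<noteq> p @ [a, a] @ q" for p a q
      using snoc.prems(2)[of p a "q @ [x]"] by auto
    show "zs \<noteq> zs' @ [t]" for zs'
      using snoc.prems(2)[of zs' t "[]"] x by auto
  qed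
  then show ?case using x by simp
qed simp

lemma reduced_prefix: "reduced (xs @ ys) \<Longrightarrow> reduced xs"
  unfolding reduced_def
proof (intro allI impI)
  fix w' assume *: "\<forall>w'. act w' = act (xs @ ys) \<longrightarrow> length (xs @ ys) \<le> length w'" and "act w' = act xs"
  then have "act (w' @ ys) = act (xs @ ys)" by (simp add: fun_eq_iff)
  with * show "length xs \<le> length w'" by fastforce
qed

lemma exists_reduced: "\<exists>w'. act w' = act w \<and> reduced w'"
proof -
  obtain w' where "act w' = act w" "\<And>w''. act w'' = act w \<Longrightarrow> length w' \<le> length w''"
    using ex_has_least_nat[of "\<lambda>w'. act w' = act w" w length] by auto
  then show ?thesis by (auto simp: reduced_def)
qed

text \<open>Tits' argument: split off the longest suffix in the dihedral group of \<open>s\<close> and the last letter.\<close>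

lemma pos_root_aux:
  assumes "reduced w" "\<And>w'. act w' = act (w @ [s]) \<Longrightarrow> length w \<le> length w'"
  shows "pos (act w (u s))"
  using assms
proof (induction "length w" arbitrary: w s rule: less_induct)
  case less
  show ?case
  proof (cases w rule: rev_cases)
    case Nil
    then show ?thesis by (simp add: pos_u)
  next
    case (snoc w0 t)
    have ts: "s \<noteq> t"
    proof
      assume "s = t"
      then have "act w0 = act (w @ [s])" by (simp add: snoc fun_eq_iff)
      from less.prems(2)[OF this] show False by (simp add: snoc)
    qed
    define Q where "Q = (\<lambda>(xs, ys). act (xs @ ys) = act w \<and> length xs + length ys = length w \<and> set ys \<subseteq> {s, t})"
    have "Q (w0, [t])" by (simp add: Q_def snoc)
    then obtain z where z: "Q z" "\<And>z'. Q z' \<Longrightarrow> length (fst z) \<le> length (fst z')"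
      using ex_has_least_nat[of Q "(w0, [t])" "\<lambda>z. length (fst z)"] by metis
    obtain xs ys where zz: "z = (xs, ys)" by (cases z)
    have q: "act (xs @ ys) = act w" "length xs + length ys = length w" "set ys \<subseteq> {s, t}"
      using z(1) by (auto simp: Q_def zz)
    have qmin: "length xs \<le> length xs'" if "act (xs' @ ys') = act w" "length xs' + length ys' = length w" "set ys' \<subseteq> {s, t}" for xs' ys'
      using z(2)[of "(xs', ys')"] that by (auto simp: Q_def zz)
    \<comment> \<open>The split into \<open>w0\<close> and \<open>[t]\<close> competes, so
      \<open>xs\<close> is shorter than w and the induction hypothesis applies to it.\<close>
    have len: "length xs < length w"
      using qmin[of w0 "[t]"] by (simp add: snoc)
    have red: "reduced (xs @ ys)"
      using less.prems(1) q unfolding reduced_def by simp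
    \<comment> \<open>If \<open>xs @ [r]\<close> acted like a word shorter than \<open>xs\<close>,
      the letter r could be moved into the suffix, contradicting the choice of
      \<open>xs\<close>.\<close>
    have posr: "pos (act xs (u r))" if r: "r \<in> {s, t}" for r
    proof (rule less.hyps[OF len])
      show "reduced xs" by (rule reduced_prefix[OF red])
      fix w' assume w': "act w' = act (xs @ [r])"
      show "length xs \<le> length w'"
      proof (rule ccontr)
        assume "\<not> length xs \<le> length w'"
        then have lt: "length w' < length xs" by simp
        have e: "act (w' @ (r # ys)) = act w"
          using q(1) w' by (simp add: fun_eq_iff)
        from reduced_length[OF less.prems(1) this] lt q(2)
        have "length w' + length (r # ys) = length w" by simp
        from qmin[OF e this] q(3) r lt show False by simp
      qed
    qed
    define k where "k = length ys"
    have ys: "ys = alt s t k"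
      unfolding k_def
    proof (rule alt_unique[OF q(3)])
      show "ys \<noteq> p @ [a, a] @ q" for p a q
        using reduced_no_repeat[of "xs @ p" a q] red by auto
      show "ys \<noteq> zs @ [s]" for zs
      proof
        assume "ys = zs @ [s]"
        then have "act (xs @ zs) = act (w @ [s])"
          using q(1) by (simp add: fun_eq_iff) (metis refl_refl)
        from less.prems(2)[OF this] q(2) \<open>ys = zs @ [s]\<close> show False by simp
      qed
    qed
    define n where "n = m s t"
    have n2: "n \<ge> 2" using m_ge_2[OF ts] by (simp add: n_def)
    \<comment> \<open>A suffix of full length n could be rewritten by the braid relation so as to
      end with s, and then \<open>w @ [s]\<close> would act like a word shorter than w.\<close>
    have kn: "k < n"
    proof (rule ccontr)
      assume "\<not> k < n"
      then obtain d where "k = d + n" by (metis add.commute le_Suc_ex not_less)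
      then obtain zs where zs: "ys = zs @ alt s t n" "length zs = d"
        using alt_split[of s t d n] ys by auto
      obtain n' where n': "n = Suc n'" using n2 by (cases n) auto
      have "act (alt s t n) = act (alt t s n)" using braid[OF ts] by (simp add: n_def)
      then have "act (xs @ zs @ alt s t n') = act (w @ [s])"
        using q(1) zs(1) by (simp add: fun_eq_iff n') (metis refl_refl)
      from less.prems(2)[OF this] q(2) zs show False by (simp add: n')
    qed
    define \<theta> where "\<theta> = pi / real n"
    have s0: "sin \<theta> > 0" using sin_pi_m_pos[OF ts] by (simp add: \<theta>_def n_def)
    have ge: "0 \<le> sin (real l * \<theta>)" if "l \<le> n" for l
    proof (rule sin_ge_zero)
      show "0 \<le> real l * \<theta>" by (simp add: \<theta>_def)
      have "real l * \<theta> \<le> real n * \<theta>" using that s0 n2 by (intro mult_right_mono) (auto simp: \<theta>_def)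
      also have "\<dots> = pi" using n2 by (simp add: \<theta>_def)
      finally show "real l * \<theta> \<le> pi" .
    qed
    have "sin \<theta> *\<^sub>R act w (u s) = act xs (sin \<theta> *\<^sub>R act ys (u s))"
      using q(1) by (simp add: act_scale fun_eq_iff)
    also have "\<dots> = sin (real (k + 1) * \<theta>) *\<^sub>R act xs (u (if even k then s else t)) + sin (real k * \<theta>) *\<^sub>R act xs (u (if even k then t else s))"
      unfolding ys using act_alt_root[OF ts, of k] by (simp add: \<theta>_def n_def act_add act_scale)
    also have "pos \<dots>"
      by (intro pos_add pos_scale ge posr) (use kn in auto)
    finally show ?thesis
      using pos_scale[of "1 / sin \<theta>" "sin \<theta> *\<^sub>R act w (u s)"] s0 by simp
  qed
qed

theorem pos_root:
  assumes "reduced (w @ [s])"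
  shows "pos (act w (u s))"
proof (rule pos_root_aux)
  show "reduced w" using assms by (rule reduced_prefix)
  show "length w \<le> length w'" if "act w' = act (w @ [s])" for w'
    using reduced_length[OF assms that] by simp
qed

lemma B_pos: "pos v \<Longrightarrow> (\<And>i. B X (u i) \<le> 0) \<Longrightarrow> B X v \<le> 0"
  by (auto simp: pos_def B_sym[of X] B_sum B_scale intro!: sum_nonpos mult_nonneg_nonpos)

text \<open>The \<open>u i\<close> are outer normals, so the chamber is where all products are
  nonpositive. Appending a letter to a reduced word then adds a nonnegative multiple of a positive
  root.\<close>

lemma pos_act_diff:
  assumes "reduced (xs @ ys)" "\<And>i. B K (u i) \<le> 0"
  shows "pos (act (xs @ ys) K - act xs K)"
  using assms(1)
proof (induction ys rule: rev_induct)
  case (snoc j ys)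
  have eq: "act (xs @ ys @ [j]) K - act xs K =
      (act (xs @ ys) K - act xs K) + (- 2 * B K (u j)) *\<^sub>R act (xs @ ys) (u j)"
    by (simp add: refl_def act_diff act_scale)
  have "pos (act (xs @ ys) (u j))"
    using snoc.prems by (intro pos_root) simp
  moreover have "pos (act (xs @ ys) K - act xs K)"
    using snoc.prems reduced_prefix[of "xs @ ys" "[j]"] by (intro snoc.IH) simp
  ultimately show ?case
    unfolding eq using assms(2)[of j] by (intro pos_add pos_scale) auto
qed (simp add: pos_0)

text \<open>On the hyperboloid a smaller product means a larger distance: extending a reduced word
  never brings the image of K nearer to a chamber point. Applied to prefixes of length two it bounds
  all displacements at once.\<close>

lemma B_act_le_prefix:
  assumes "reduced (xs @ ys)" "\<And>i. B K (u i) \<le> 0" "\<And>i. B X (u i) \<le> 0"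
  shows "B X (act (xs @ ys) K) \<le> B X (act xs K)"
  using B_pos[OF pos_act_diff[OF assms(1,2)] assms(3)] by (simp add: B_diff2)

lemma B_act_le:
  assumes "\<And>i. B K (u i) \<le> 0" "\<And>i. B X (u i) \<le> 0"
  shows "B X (act w K) \<le> B X K"
proof -
  obtain w' where "act w' = act w" "reduced w'" using exists_reduced by blast
  with B_act_le_prefix[of "[]" w' K X] assms show ?thesis by simp
qed

lemma B_act_two:
  assumes "i \<noteq> j"
  shows "B K (act [i, j] K) = B K K - 2 * ((B K (u i))\<^sup>2 + (B K (u j))\<^sup>2 + 2 * B K (u i) * B K (u j) * cos (pi / real (m i j)))"
proof -
  have "B K (act [i, j] K) = B (refl i K) (refl j K)"
    using B_refl[of i K "refl i (refl j K)"] by simp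
  also have "\<dots> = B K K - 2 * ((B K (u i))\<^sup>2 + (B K (u j))\<^sup>2 + 2 * B K (u i) * B K (u j) * cos (pi / real (m i j)))"
    by (simp add: refl_def B_simps gram[OF assms] B_sym[of "u _" K] algebra_simps power2_eq_square)
  finally show ?thesis .
qed

text \<open>All Gram entries are at most 1, so the form of a nonnegative combination is at most the
  square of its coefficient sum.\<close>

lemma sum_coeffs_ge_1:
  assumes "\<And>i. 0 \<le> a i" "r = (\<Sum>i\<in>UNIV. a i *\<^sub>R u i)" "B r r = 1"
  shows "1 \<le> (\<Sum>i\<in>UNIV. a i)"
proof -
  have le: "B (u i) (u j) \<le> 1" for i j
    using gram[of i j] unit[of i] by (cases "i = j") (auto simp: cos_ge_minus_one minus_le_iff)
  have "1 = (\<Sum>i\<in>UNIV. \<Sum>j\<in>UNIV. a i * (a j * B (u j) (u i)))"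
    using assms(3) by (simp add: assms(2) B_sum B_scale B_sym[of "u _" "sum _ _"] sum_distrib_left)
  also have "\<dots> \<le> (\<Sum>i\<in>UNIV. \<Sum>j\<in>UNIV. a i * (a j * 1))"
    by (intro sum_mono mult_left_mono le assms(1))
  also have "\<dots> = (\<Sum>i\<in>UNIV. a i)\<^sup>2"
    by (simp add: power2_eq_square sum_product)
  finally have "1 \<le> (\<Sum>i\<in>UNIV. a i)\<^sup>2" .
  then show ?thesis
    using sum_nonneg[of UNIV a] assms(1) by (metis one_power2 power2_le_imp_le)
qed

text \<open>Quantitative form of \<open>B_act_le\<close>: if both points keep a margin from the
  walls, each letter of a reduced word contributes a fixed amount. Discreteness of the orbits comes
  from this linear growth.\<close>

lemma B_act_growth:
  assumes "reduced w" "\<And>i. B K (u i) \<le> - \<kappa>" "\<And>i. B X (u i) \<le> - \<xi>" "0 \<le> \<kappa>" "0 \<le> \<xi>"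
  shows "B X (act w K) \<le> B X K - 2 * \<kappa> * \<xi> * real (length w)"
  using assms(1)
proof (induction w rule: rev_induct)
  case (snoc j w)
  have X: "B X (u i) \<le> 0" for i using assms(3)[of i] assms(5) by linarith
  obtain a where a: "\<And>i. 0 \<le> a i" "act w (u j) = (\<Sum>i\<in>UNIV. a i *\<^sub>R u i)"
    using pos_root[OF snoc.prems] by (auto simp: pos_def)
  have "1 \<le> (\<Sum>i\<in>UNIV. a i)"
    using a by (rule sum_coeffs_ge_1) (simp add: B_act unit)
  then have "\<xi> \<le> (\<Sum>i\<in>UNIV. a i * \<xi>)"
    using assms(5) mult_right_mono[of 1 _ \<xi>] by (simp add: sum_distrib_right[symmetric])
  also have "\<dots> \<le> (\<Sum>i\<in>UNIV. a i * - B X (u i))"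
    using assms(3) by (intro sum_mono mult_left_mono a) (simp add: le_minus_iff)
  also have "\<dots> = - B X (act w (u j))"
    by (simp add: a(2) B_sym[of X] B_sum B_scale sum_negf)
  finally have *: "\<xi> \<le> - B X (act w (u j))" .
  have "\<kappa> * \<xi> \<le> - B K (u j) * - B X (act w (u j))"
    using assms(2)[of j] by (intro mult_mono *) (use assms(4,5) in auto)
  moreover have "B X (act (w @ [j]) K) = B X (act w K) - 2 * (- B K (u j) * - B X (act w (u j)))"
    by (simp add: refl_def act_diff act_scale B_simps)
  moreover have "B X (act w K) \<le> B X K - 2 * \<kappa> * \<xi> * real (length w)"
    by (rule snoc.IH[OF reduced_prefix[OF snoc.prems]])
  ultimately show ?case by (simp add: algebra_simps)
qed simp

end

section \<open>The hyperboloid model\<close>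

text \<open>
  The form of signature \<open>(2, 1)\<close>, its cross product, the projection of the disk to the hyperboloid
  \<open>mink v v = -1\<close>, and the reflection of the disk in the line with unit normal \<open>n\<close>.
\<close>

definition mink :: "complex \<times> real \<Rightarrow> complex \<times> real \<Rightarrow> real" where
  "mink v w = Re (fst v * cnj (fst w)) - snd v * snd w"

definition cross :: "complex \<times> real \<Rightarrow> complex \<times> real \<Rightarrow> complex \<times> real" where
  "cross v w =
     (Complex (Im (fst v) * snd w - snd v * Im (fst w)) (snd v * Re (fst w) - Re (fst v) * snd w),
      - (Re (fst v) * Im (fst w) - Im (fst v) * Re (fst w)))"

definition lift :: "complex \<Rightarrow> complex \<times> real" where
  "lift z = (of_real (2 / (1 - (cmod z)\<^sup>2)) * z, (1 + (cmod z)\<^sup>2) / (1 - (cmod z)\<^sup>2))"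

definition drefl :: "complex \<times> real \<Rightarrow> complex \<Rightarrow> complex" where
  "drefl n z = (fst n * cnj z - of_real (snd n)) / (of_real (snd n) * cnj z - cnj (fst n))"

lemma mink_add: "mink (x + y) z = mink x z + mink y z"
  and mink_scale: "mink (c *\<^sub>R x) z = c * mink x z"
  and mink_sym: "mink x y = mink y x"
  by (auto simp: mink_def algebra_simps)

lemma mink_add2: "mink z (x + y) = mink z x + mink z y"
  and mink_scale2: "mink z (c *\<^sub>R x) = c * mink z x"
  and mink_minus: "mink (- x) z = - mink x z"
  and mink_minus2: "mink z (- x) = - mink z x"
  and mink_diff: "mink (x - y) z = mink x z - mink y z"
  and mink_diff2: "mink z (x - y) = mink z x - mink z y"
  by (auto simp: mink_def algebra_simps)

lemmas mink_simps = mink_add mink_add2 mink_scale mink_scale2 mink_minus mink_minus2 mink_diff mink_diff2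

lemma vec_cases:
  fixes v :: "complex \<times> real"
  obtains x y h where "v = (Complex x y, h)"
  by (metis complex.exhaust surj_pair)

lemma mink_cross_cross: "mink (cross v w) (cross y z) = mink v z * mink w y - mink v y * mink w z"
  by (simp add: mink_def cross_def algebra_simps)

lemma mink_cross_left: "mink (cross v w) v = 0" "mink (cross v w) w = 0"
  by (simp_all add: mink_def cross_def algebra_simps)

lemma mink_cross_rotate: "mink (cross v w) z = mink (cross w z) v"
  by (simp add: mink_def cross_def algebra_simps)

lemma cross_expand:
  "mink n n *\<^sub>R cross v w = mink w n *\<^sub>R cross v n + mink v n *\<^sub>R cross n w + mink (cross v w) n *\<^sub>R n"
  by (rule prod_eqI) (simp_all add: mink_def cross_def complex_eq_iff algebra_simps)

lemma cross_bilinear: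
  "cross (x - c *\<^sub>R n) (y - d *\<^sub>R n) = cross x y - d *\<^sub>R cross x n - c *\<^sub>R cross n y"
  by (rule prod_eqI) (simp_all add: cross_def complex_eq_iff algebra_simps)

text \<open>A reflection reverses orientation; this sign later separates odd words from even
  ones.\<close>

lemma cross_refl:
  assumes "mink n n = 1"
  shows "cross (v - (2 * mink v n) *\<^sub>R n) (w - (2 * mink w n) *\<^sub>R n) =
    - (cross v w - (2 * mink (cross v w) n) *\<^sub>R n)"
proof -
  have "cross v w = mink w n *\<^sub>R cross v n + mink v n *\<^sub>R cross n w + mink (cross v w) n *\<^sub>R n"
    using cross_expand[of n v w] assms by simp
  from arg_cong[OF this, of "\<lambda>x. 2 *\<^sub>R x"] show ?thesis
    unfolding cross_bilinear by (simp only: scaleR_add_right scaleR_scaleR) (simp add: scaleR_2 algebra_simps)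
qed

lemma H2_iff: "z \<in> H2 \<longleftrightarrow> (cmod z)\<^sup>2 < 1"
  by (simp add: H2_def abs_square_less_1)

lemma H2_pos: "z \<in> H2 \<Longrightarrow> 0 < 1 - (cmod z)\<^sup>2"
  by (simp add: H2_iff)

lemma mink_lift:
  assumes "z \<in> H2" "w \<in> H2"
  shows "mink (lift z) (lift w) = - 1 - 2 * (cmod (z - w))\<^sup>2 / ((1 - (cmod z)\<^sup>2) * (1 - (cmod w)\<^sup>2))"
proof -
  define p q where "p = 1 - (cmod z)\<^sup>2" and "q = 1 - (cmod w)\<^sup>2"
  have pq: "p > 0" "q > 0" using assms by (auto simp: p_def q_def H2_iff)
  have "mink (lift z) (lift w) = (4 * Re (z * cnj w) - (1 + (cmod z)\<^sup>2) * (1 + (cmod w)\<^sup>2)) / (p * q)"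
    by (simp add: mink_def lift_def diff_divide_distrib add_divide_distrib flip: p_def q_def) (simp add: algebra_simps add_divide_distrib)
  also have "4 * Re (z * cnj w) - (1 + (cmod z)\<^sup>2) * (1 + (cmod w)\<^sup>2) = - p * q - 2 * (cmod (z - w))\<^sup>2"
    by (simp add: p_def q_def cmod_power2) (simp add: algebra_simps power2_eq_square)
  also have "\<dots> / (p * q) = - 1 - 2 * (cmod (z - w))\<^sup>2 / (p * q)"
    using pq by (simp add: field_simps)
  finally show ?thesis by (simp add: p_def q_def)
qed

lemma mink_lift_self: "z \<in> H2 \<Longrightarrow> mink (lift z) (lift z) = -1"
  by (simp add: mink_lift)

lemma mink_lift_le: "z \<in> H2 \<Longrightarrow> w \<in> H2 \<Longrightarrow> mink (lift z) (lift w) \<le> -1"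
  using H2_pos[of z] H2_pos[of w] by (simp add: mink_lift)

lemma mink_lift_eq_iff: "z \<in> H2 \<Longrightarrow> w \<in> H2 \<Longrightarrow> mink (lift z) (lift w) = -1 \<longleftrightarrow> z = w"
  using H2_pos[of z] H2_pos[of w] by (auto simp add: mink_lift)

lemma lift_inj: "z \<in> H2 \<Longrightarrow> w \<in> H2 \<Longrightarrow> lift z = lift w \<Longrightarrow> z = w"
  using mink_lift_eq_iff[of z w] mink_lift_self[of w] by simp

lemma h2_dist_mink: "z \<in> H2 \<Longrightarrow> w \<in> H2 \<Longrightarrow> h2_dist z w = arcosh (- mink (lift z) (lift w))"
  by (simp add: h2_dist_def mink_lift add.commute)

lemma h2_dist_le_iff:
  assumes "z \<in> H2" "w \<in> H2" "z' \<in> H2" "w' \<in> H2"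
  shows "h2_dist z w \<le> h2_dist z' w' \<longleftrightarrow> mink (lift z') (lift w') \<le> mink (lift z) (lift w)"
  using mink_lift_le[OF assms(1,2)] mink_lift_le[OF assms(3,4)] assms
  by (simp add: h2_dist_mink not_less[symmetric])

lemma h2_dist_nonneg: "z \<in> H2 \<Longrightarrow> w \<in> H2 \<Longrightarrow> 0 \<le> h2_dist z w"
  using mink_lift_le[of z w] by (simp add: h2_dist_mink)

lemma h2_dist_eq_0_iff: "z \<in> H2 \<Longrightarrow> w \<in> H2 \<Longrightarrow> h2_dist z w = 0 \<longleftrightarrow> z = w"
  using mink_lift_le[of z w] mink_lift_eq_iff[of z w] by (auto simp add: h2_dist_mink)

lemma lift_surj:
  assumes "mink v v = -1" "0 < snd v"
  obtains z where "z \<in> H2" "lift z = v"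
proof -
  obtain x y h where v: "v = (Complex x y, h)" by (rule vec_cases)
  have h: "x\<^sup>2 + y\<^sup>2 = h\<^sup>2 - 1" "h > 0" using assms by (auto simp: mink_def v power2_eq_square)
  have h1: "h \<ge> 1" using h zero_le_power2[of x] zero_le_power2[of y]
    by (smt (verit) one_le_power power2_eq_square mult_less_cancel_left2)
  \<comment> \<open>Stereographic projection from (0, -1), the inverse of
    \<open>lift\<close>.\<close>
  define z where "z = Complex (x / (1 + h)) (y / (1 + h))"
  have "(cmod z)\<^sup>2 = (x\<^sup>2 + y\<^sup>2) / (1 + h)\<^sup>2"
    by (simp add: z_def cmod_power2 power_divide add_divide_distrib)
  also have "\<dots> = (h - 1) / (h + 1)"
  proof -
    have "x\<^sup>2 + y\<^sup>2 = (h - 1) * (1 + h)" using h(1) by (simp add: power2_eq_square algebra_simps)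
    then show ?thesis using h1 by (simp add: power2_eq_square add.commute)
  qed
  finally have c: "(cmod z)\<^sup>2 = (h - 1) / (h + 1)" .
  then have "z \<in> H2" using h1 by (simp add: H2_iff)
  moreover have "1 - (cmod z)\<^sup>2 = 2 / (h + 1)" "1 + (cmod z)\<^sup>2 = 2 * h / (h + 1)"
    using h1 by (simp_all add: c field_simps)
  then have "lift z = v"
    using h1 by (simp add: lift_def v z_def complex_eq_iff) (simp add: field_simps)
  ultimately show thesis by (rule that)
qed

text \<open>A zero of the denominator would satisfy h^2 |z|^2 = h^2 + 1, which is impossible inside
  the disk.\<close>

lemma drefl_denom:
  assumes "mink n n = 1" "z \<in> H2"
  shows "0 < (cmod (of_real (snd n) * cnj z - cnj (fst n)))\<^sup>2"
proof -
  obtain x y h where n: "n = (Complex x y, h)" by (rule vec_cases)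
  have h: "x\<^sup>2 + y\<^sup>2 = h\<^sup>2 + 1" using assms by (auto simp: mink_def n power2_eq_square)
  have "of_real (snd n) * cnj z - cnj (fst n) \<noteq> 0"
  proof
    assume "of_real (snd n) * cnj z - cnj (fst n) = 0"
    then have "(cmod (of_real h * cnj z))\<^sup>2 = (cmod (cnj (Complex x y)))\<^sup>2" by (simp add: n)
    then have "h\<^sup>2 * (cmod z)\<^sup>2 = h\<^sup>2 + 1"
      using h by (simp add: norm_mult power_mult_distrib cmod_power2[of "Complex x y"])
    moreover have "h\<^sup>2 * (cmod z)\<^sup>2 \<le> h\<^sup>2 * 1" using assms(2) by (intro mult_left_mono) (auto simp: H2_iff)
    ultimately show False by linarith
  qed
  then show ?thesis by simp
qed

text \<open>The squared moduli of denominator and numerator of \<open>drefl\<close> differ exactly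
  by the weight 1 - |z|^2. This gives the first and the last claim; the linear formula is a
  computation over the common denominator.\<close>

lemma drefl_props:
  assumes "mink n n = 1" "z \<in> H2"
  shows drefl_H2: "drefl n z \<in> H2"
    and lift_drefl: "lift (drefl n z) = lift z - (2 * mink (lift z) n) *\<^sub>R n"
    and drefl_weight: "1 - (cmod (drefl n z))\<^sup>2 = (1 - (cmod z)\<^sup>2) / (cmod (of_real (snd n) * cnj z - cnj (fst n)))\<^sup>2"
proof -
  obtain p q a where n: "n = (Complex p q, a)" by (rule vec_cases)
  obtain x y where z: "z = Complex x y" by (cases z)
  have h: "p\<^sup>2 + q\<^sup>2 = a\<^sup>2 + 1" using assms by (auto simp: mink_def n power2_eq_square)
  define N where "N = (cmod (of_real (snd n) * cnj z - cnj (fst n)))\<^sup>2"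
  have N0: "N > 0" using drefl_denom[OF assms] by (simp add: N_def)
  have Neq: "N = (a * x - p)\<^sup>2 + (a * y - q)\<^sup>2"
    by (simp add: N_def n z cmod_power2) (simp add: power2_eq_square algebra_simps)
  define w where "w = 1 - (cmod z)\<^sup>2"
  have w: "w > 0" "w = 1 - x\<^sup>2 - y\<^sup>2" using H2_pos[OF assms(2)] by (auto simp: w_def z cmod_power2)
  have c: "(cmod (drefl n z))\<^sup>2 = (cmod (fst n * cnj z - of_real (snd n)))\<^sup>2 / N"
    by (simp add: drefl_def N_def norm_divide power_divide)
  have c1: "(cmod (fst n * cnj z - of_real (snd n)))\<^sup>2 = N - w"
  proof -
    have "(cmod (fst n * cnj z - of_real (snd n)))\<^sup>2 = (p\<^sup>2 + q\<^sup>2) * (x\<^sup>2 + y\<^sup>2) - 2 * a * (p * x + q * y) + a\<^sup>2"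
      by (simp add: n z cmod_power2) (simp add: power2_eq_square algebra_simps)
    moreover have "N = a\<^sup>2 * (x\<^sup>2 + y\<^sup>2) - 2 * a * (p * x + q * y) + (p\<^sup>2 + q\<^sup>2)"
      by (simp add: Neq power2_eq_square algebra_simps)
    ultimately show ?thesis unfolding h w(2) by (simp add: algebra_simps)
  qed
  have s: "1 - (cmod (drefl n z))\<^sup>2 = w / N" "1 + (cmod (drefl n z))\<^sup>2 = (2 * N - w) / N"
    unfolding c c1 using N0 by (simp_all add: field_simps)
  show "1 - (cmod (drefl n z))\<^sup>2 = (1 - (cmod z)\<^sup>2) / (cmod (of_real (snd n) * cnj z - cnj (fst n)))\<^sup>2"
    using s(1) by (simp add: w_def N_def)
  have "0 < w / N" using w N0 by simp
  with s(1) show "drefl n z \<in> H2" by (simp add: H2_iff)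
  have dr: "drefl n z = (fst n * cnj z - of_real (snd n)) * (of_real (snd n) * z - fst n) / of_real N"
    unfolding drefl_def N_def
    using complex_div_cnj[of "fst n * cnj z - of_real (snd n)" "of_real (snd n) * cnj z - cnj (fst n)"] by simp
  have m: "mink (lift z) n = (2 * (p * x + q * y) - a * (1 + x\<^sup>2 + y\<^sup>2)) / w"
    by (simp add: mink_def lift_def n flip: w_def)
      (simp add: z cmod_power2 field_simps diff_divide_distrib add_divide_distrib)
  have f: "fst (lift (drefl n z)) = of_real (2 / w) * ((fst n * cnj z - of_real (snd n)) * (of_real (snd n) * z - fst n))"
    using N0 w(1) by (simp add: lift_def s(1)) (simp add: dr)
  have f2: "(fst n * cnj z - of_real (snd n)) * (of_real (snd n) * z - fst n) = z - of_real (2 * (p * x + q * y) - a * (1 + x\<^sup>2 + y\<^sup>2)) * fst n"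
  proof -
    have "x = x * (p\<^sup>2 + q\<^sup>2 - a\<^sup>2)" "y = y * (p\<^sup>2 + q\<^sup>2 - a\<^sup>2)" using h by simp_all
    then show ?thesis
      by (simp add: complex_eq_iff n z power2_eq_square algebra_simps)
  qed
  have g: "snd (lift (drefl n z)) = (2 * N - w) / w"
    using N0 w(1) by (simp add: lift_def s)
  have g2: "2 * N - w = 1 + x\<^sup>2 + y\<^sup>2 - 2 * (2 * (p * x + q * y) - a * (1 + x\<^sup>2 + y\<^sup>2)) * a"
  proof -
    have "N = a\<^sup>2 * (x\<^sup>2 + y\<^sup>2) - 2 * a * (p * x + q * y) + (p\<^sup>2 + q\<^sup>2)"
      by (simp add: Neq power2_eq_square algebra_simps)
    then show ?thesis unfolding h w(2) by (simp add: algebra_simps power2_eq_square)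
  qed
  show "lift (drefl n z) = lift z - (2 * mink (lift z) n) *\<^sub>R n"
  proof (rule prod_eqI)
    show "fst (lift (drefl n z)) = fst (lift z - (2 * mink (lift z) n) *\<^sub>R n)"
      unfolding f f2 m by (simp add: lift_def scaleR_conv_of_real right_diff_distrib flip: w_def)
    show "snd (lift (drefl n z)) = snd (lift z - (2 * mink (lift z) n) *\<^sub>R n)"
    proof -
      have gen: "snd (lift z) - 2 * mink (lift z) n * a = (1 + x\<^sup>2 + y\<^sup>2 - 2 * (2 * (p * x + q * y) - a * (1 + x\<^sup>2 + y\<^sup>2)) * a) / w"
        if "snd (lift z) = (1 + x\<^sup>2 + y\<^sup>2) / w"
        unfolding m that by (simp add: diff_divide_distrib[of "1 + x\<^sup>2 + y\<^sup>2"])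
      have "snd (lift z) = (1 + x\<^sup>2 + y\<^sup>2) / w"
        by (simp add: lift_def flip: w_def) (simp add: z cmod_power2)
      from gen[OF this] show ?thesis using g unfolding g2 by (simp add: n)
    qed
  qed
qed

section \<open>Angles and rotations\<close>

lemma moebius_denom: "P \<in> H2 \<Longrightarrow> z \<in> H2 \<Longrightarrow> 1 - cnj P * z \<noteq> 0"
  using norm_mult_less[of "cnj P" 1 z 1] by (auto simp: H2_def)

lemma moebius_H2: "P \<in> H2 \<Longrightarrow> z \<in> H2 \<Longrightarrow> Moebius_function 0 P z \<in> H2"
  using Moebius_function_norm_lt_1[of P z 0] by (simp add: H2_def)

lemma moebius_weight:
  assumes "P \<in> H2" "z \<in> H2"
  shows "1 - (cmod (Moebius_function 0 P z))\<^sup>2 = (1 - (cmod P)\<^sup>2) * (1 - (cmod z)\<^sup>2) / (cmod (1 - cnj P * z))\<^sup>2"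
proof -
  have d: "(cmod (1 - cnj P * z))\<^sup>2 \<noteq> 0" using moebius_denom[OF assms] by simp
  have "of_real ((cmod (1 - cnj P * z))\<^sup>2 - (cmod (z - P))\<^sup>2) = (of_real ((1 - (cmod P)\<^sup>2) * (1 - (cmod z)\<^sup>2)) :: complex)"
    by (simp add: complex_norm_square algebra_simps del: of_real_power)
  then have "(cmod (1 - cnj P * z))\<^sup>2 - (cmod (z - P))\<^sup>2 = (1 - (cmod P)\<^sup>2) * (1 - (cmod z)\<^sup>2)"
    by (simp only: of_real_eq_iff)
  then show ?thesis
    using d unfolding Moebius_function_simple norm_divide power_divide by (simp add: field_simps)
qed

lemma moebius_diff:
  assumes "P \<in> H2" "z \<in> H2" "w \<in> H2"
  shows "Moebius_function 0 P z - Moebius_function 0 P w =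
    (z - w) * of_real (1 - (cmod P)\<^sup>2) / ((1 - cnj P * z) * (1 - cnj P * w))"
  using moebius_denom[OF assms(1,2)] moebius_denom[OF assms(1,3)]
  unfolding Moebius_function_simple of_real_diff complex_norm_square
  by (simp add: field_simps)

lemma mink_moebius:
  assumes "P \<in> H2" "z \<in> H2" "w \<in> H2"
  shows "mink (lift (Moebius_function 0 P z)) (lift (Moebius_function 0 P w)) = mink (lift z) (lift w)"
proof -
  have d: "(cmod (1 - cnj P * z))\<^sup>2 > 0" "(cmod (1 - cnj P * w))\<^sup>2 > 0" "1 - (cmod P)\<^sup>2 > 0"
    "1 - (cmod z)\<^sup>2 > 0" "1 - (cmod w)\<^sup>2 > 0"
    using moebius_denom[OF assms(1,2)] moebius_denom[OF assms(1,3)] assms by (simp_all add: H2_iff)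
  have e: "(cmod (Moebius_function 0 P z - Moebius_function 0 P w))\<^sup>2 =
     (cmod (z - w))\<^sup>2 * (1 - (cmod P)\<^sup>2)\<^sup>2 / ((cmod (1 - cnj P * z))\<^sup>2 * (cmod (1 - cnj P * w))\<^sup>2)"
    unfolding moebius_diff[OF assms] norm_divide norm_mult power_divide power_mult_distrib norm_of_real power2_abs ..
  show ?thesis
  proof -
    have gen: "2 * (d * p\<^sup>2 / (a * b)) / ((p * c / a) * (p * e / b)) = 2 * d / (c * e)"
      if "a > 0" "b > 0" "p > 0" "c > 0" "e > 0" for a b c d e p :: real
      using that by (simp add: power2_eq_square)
    show ?thesis
      unfolding mink_lift[OF moebius_H2[OF assms(1,2)] moebius_H2[OF assms(1,3)]] mink_lift[OF assms(2,3)]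
        moebius_weight[OF assms(1,2)] moebius_weight[OF assms(1,3)] e
        gen[OF d] ..
  qed
qed

lemma lift_0: "lift 0 = (0, 1)"
  by (simp add: lift_def)

text \<open>The hyperbolic law of cosines, since \<open>- mink\<close> of two lifts is cosh of the
  distance. It is read off after moving P to the centre, where the angle is Euclidean.\<close>

lemma h2_angle_mink:
  assumes H: "P \<in> H2" "Q \<in> H2" "R \<in> H2" and ne: "P \<noteq> Q" "P \<noteq> R"
  shows "mink (lift Q) (lift R) + mink (lift P) (lift Q) * mink (lift P) (lift R) =
    sqrt ((mink (lift P) (lift Q))\<^sup>2 - 1) * sqrt ((mink (lift P) (lift R))\<^sup>2 - 1) * cos (h2_angle Q P R)"
proof -
  define \<phi> where "\<phi> = Moebius_function 0 P"
  have \<phi>P: "\<phi> P = 0" by (simp add: \<phi>_def Moebius_function_eq_zero)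
  have s: "snd (lift (\<phi> z)) = - mink (lift P) (lift z)" if "z \<in> H2" for z
    using mink_moebius[OF H(1,1) that] \<phi>P by (simp add: \<phi>_def lift_0 mink_def)
  have n: "cmod (fst (lift (\<phi> z))) = sqrt ((mink (lift P) (lift z))\<^sup>2 - 1)" if "z \<in> H2" for z
  proof -
    have "mink (lift (\<phi> z)) (lift (\<phi> z)) = -1"
      using that H by (simp add: \<phi>_def moebius_H2 mink_lift_self)
    then have "(cmod (fst (lift (\<phi> z))))\<^sup>2 = (snd (lift (\<phi> z)))\<^sup>2 - 1"
      by (simp add: mink_def cmod_power2) (simp add: power2_eq_square)
    then have "(cmod (fst (lift (\<phi> z))))\<^sup>2 = (mink (lift P) (lift z))\<^sup>2 - 1"
      by (simp add: s[OF that])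
    from real_sqrt_unique[OF this norm_ge_zero] show ?thesis by simp
  qed
  have ne0: "\<phi> Q \<noteq> 0" "\<phi> R \<noteq> 0"
    using ne moebius_denom[OF H(1,2)] moebius_denom[OF H(1,3)] by (simp_all add: \<phi>_def Moebius_function_simple)
  define x y where "x = \<phi> R" and "y = \<phi> Q"
  have xy: "x \<noteq> 0" "y \<noteq> 0" "x \<in> H2" "y \<in> H2" using ne0 H by (auto simp: x_def y_def \<phi>_def moebius_H2)
  have "cos (h2_angle Q P R) = cos (Arg (x / y))"
    by (simp add: h2_angle_def x_def y_def \<phi>_def abs_if)
  also have "\<dots> = Re (x / y) / cmod (x / y)"
    using xy by (simp add: cos_Arg)
  also have "\<dots> = Re (x * cnj y) / (cmod x * cmod y)"
  proof -
    have "Re (x / y) = Re (x * cnj y) / (cmod y)\<^sup>2"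
      by (simp add: Re_divide cmod_power2)
    then show ?thesis using xy by (simp add: norm_divide power2_eq_square)
  qed
  finally have c: "Re (x * cnj y) = cmod x * cmod y * cos (h2_angle Q P R)" using xy by simp
  define cx cy where "cx = 2 / (1 - (cmod x)\<^sup>2)" and "cy = 2 / (1 - (cmod y)\<^sup>2)"
  have cc: "cx > 0" "cy > 0" using xy by (auto simp: cx_def cy_def H2_iff)
  have "mink (lift Q) (lift R) = mink (lift x) (lift y)"
    using mink_moebius[OF H(1,3,2)] by (simp add: x_def y_def \<phi>_def mink_sym)
  also have "\<dots> = Re (fst (lift x) * cnj (fst (lift y))) - snd (lift x) * snd (lift y)"
    by (simp add: mink_def)
  also have "Re (fst (lift x) * cnj (fst (lift y))) = cx * cy * Re (x * cnj y)"
    by (simp add: lift_def cx_def[symmetric] cy_def[symmetric] algebra_simps)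
  also have "\<dots> = (cx * cmod x) * (cy * cmod y) * cos (h2_angle Q P R)"
    unfolding c by simp
  also have "cx * cmod x = cmod (fst (lift x))"
    using cc by (simp add: lift_def norm_mult cx_def[symmetric])
  also have "cy * cmod y = cmod (fst (lift y))"
    using cc by (simp add: lift_def norm_mult cy_def[symmetric])
  finally show ?thesis
    using s[OF H(2)] s[OF H(3)] n[OF H(2)] n[OF H(3)] by (simp add: x_def y_def mult.commute)
qed

text \<open>The unit tangent normal at \<open>P\<close> of a line through \<open>P\<close>, transported to the centre.\<close>

definition dir :: "complex \<Rightarrow> complex \<times> real \<Rightarrow> complex" where
  "dir P n = (fst n + cnj (fst n) * P\<^sup>2 - 2 * of_real (snd n) * P) / of_real (1 - (cmod P)\<^sup>2)"

context
  fixes P :: complex and n :: "complex \<times> real"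
  assumes P: "P \<in> H2" and n: "mink (lift P) n = 0"
begin

text \<open>Orthogonality of n to \<open>lift P\<close>, written as a polynomial relation between
  complex numbers and their conjugates so that it can enter algebraic identities.\<close>

lemma dir_rel: "cnj (fst n) * P + fst n * cnj P = of_real (snd n) * (1 + P * cnj P)"
proof -
  have "2 * Re (P * cnj (fst n)) = snd n * (1 + (cmod P)\<^sup>2)"
    using n H2_pos[OF P] by (simp add: mink_def lift_def diff_divide_distrib[symmetric] add_divide_distrib[symmetric] field_simps)
  moreover have "cnj (fst n) * P + fst n * cnj P = of_real (2 * Re (P * cnj (fst n)))"
    using complex_add_cnj[of "P * cnj (fst n)"] by (simp add: mult.commute)
  ultimately show ?thesis by (simp add: complex_norm_square del: of_real_power)
qed

lemma dir_times: "dir P n * (1 - P * cnj P) = fst n + cnj (fst n) * P\<^sup>2 - 2 * of_real (snd n) * P"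
  "1 - P * cnj P \<noteq> 0"
proof -
  have e: "1 - P * cnj P = of_real (1 - (cmod P)\<^sup>2)" by (simp add: complex_norm_square del: of_real_power)
  have "of_real (1 - (cmod P)\<^sup>2) \<noteq> (0::complex)" using H2_pos[OF P] by (simp only: of_real_eq_0_iff)
  then show "1 - P * cnj P \<noteq> 0" and "dir P n * (1 - P * cnj P) = fst n + cnj (fst n) * P\<^sup>2 - 2 * of_real (snd n) * P"
    unfolding e dir_def by auto
qed

lemma cnj_dir_times: "cnj (dir P n) * (1 - P * cnj P) = cnj (fst n) + fst n * (cnj P)\<^sup>2 - 2 * of_real (snd n) * cnj P"
  using arg_cong[OF dir_times(1), of cnj] by (simp add: mult.commute)

end

lemma dir_inner:
  assumes P: "P \<in> H2" and n: "mink (lift P) n = 0" and n': "mink (lift P) n' = 0"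
  shows "Re (dir P n * cnj (dir P n')) = mink n n'"
proof -
  note r = dir_rel[OF P n] dir_rel[OF P n'] dir_times[OF P n] dir_times(1)[OF P n'] cnj_dir_times[OF P n] cnj_dir_times[OF P n']
  have "(dir P n * cnj (dir P n') + cnj (dir P n) * dir P n') * (1 - P * cnj P)\<^sup>2 =
    (fst n * cnj (fst n') + cnj (fst n) * fst n' - 2 * of_real (snd n) * of_real (snd n')) * (1 - P * cnj P)\<^sup>2"
    using r by algebra
  then have "dir P n * cnj (dir P n') + cnj (dir P n) * dir P n' =
    fst n * cnj (fst n') + cnj (fst n) * fst n' - 2 * of_real (snd n) * of_real (snd n')"
    using r(4) by simp
  from arg_cong[OF this, of Re] show ?thesis by (simp add: mink_def)
qed

text \<open>Transported to the centre, the map becomes \<zeta> \<mapsto> - b^2 cnj \<zeta>, the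
  reflection in the diameter orthogonal to the unit vector b = \<open>dir P n\<close>.\<close>

lemma drefl_through:
  assumes P: "P \<in> H2" and n: "mink (lift P) n = 0" and u: "mink n n = 1" and z: "z \<in> H2"
  shows "drefl n z = Moebius_function 0 (- P) (- (dir P n)\<^sup>2 * cnj (Moebius_function 0 P z))"
proof -
  define b where "b = dir P n"
  note r = dir_rel[OF P n] dir_times[OF P n, folded b_def] cnj_dir_times[OF P n, folded b_def]
  define w where "w = 1 - P * cnj P"
  have bb: "b * cnj b = 1"
  proof -
    have "Re (b * cnj b) = 1" using dir_inner[OF P n n] u by (simp add: b_def)
    then show ?thesis by (simp add: complex_eq_iff)
  qed
  have "cnj (1 - cnj P * z) \<noteq> 0" using moebius_denom[OF P z] by (simp only: complex_cnj_zero_iff not_False_eq_True)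
  then have d: "1 - P * cnj z \<noteq> 0" by simp
  have cn: "cnj (Moebius_function 0 P z) = (cnj z - cnj P) / (1 - P * cnj z)"
    by (simp add: Moebius_function_simple)
  have "Moebius_function 0 (- P) (- b\<^sup>2 * cnj (Moebius_function 0 P z)) =
     (- b\<^sup>2 * (cnj z - cnj P) + P * (1 - P * cnj z)) / ((1 - P * cnj z) - cnj P * b\<^sup>2 * (cnj z - cnj P))"
    unfolding cn Moebius_function_simple using d by (simp add: divide_simps)
  \<comment> \<open>The factor \<open>- cnj b * w\<close> clears the division hidden in
    \<open>dir\<close>; numerator and denominator then follow from b cnj b = 1,
    \<open>dir_rel\<close> and \<open>dir_times\<close> as polynomial identities.\<close>
  also have "\<dots> = ((- cnj b * w) * (- b\<^sup>2 * (cnj z - cnj P) + P * (1 - P * cnj z))) / ((- cnj b * w) * ((1 - P * cnj z) - cnj P * b\<^sup>2 * (cnj z - cnj P)))"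
    using bb r(3) by (subst mult_divide_mult_cancel_left) (auto simp: w_def)
  also have "(- cnj b * w) * (- b\<^sup>2 * (cnj z - cnj P) + P * (1 - P * cnj z)) = w\<^sup>2 * (fst n * cnj z - of_real (snd n))"
    using bb r(1,2,4) unfolding w_def by algebra
  also have "(- cnj b * w) * ((1 - P * cnj z) - cnj P * b\<^sup>2 * (cnj z - cnj P)) = w\<^sup>2 * (of_real (snd n) * cnj z - cnj (fst n))"
    using bb r(1,2,4) unfolding w_def by algebra
  also have "w\<^sup>2 * (fst n * cnj z - of_real (snd n)) / (w\<^sup>2 * (of_real (snd n) * cnj z - cnj (fst n))) = drefl n z"
    using r(3) by (simp add: drefl_def w_def)
  finally show ?thesis by (simp add: b_def)
qed

lemma drefl_drefl_rotation:
  assumes P: "P \<in> H2" and n: "mink (lift P) n = 0" "mink (lift P) n' = 0" and u: "mink n n = 1" "mink n' n' = 1"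
    and \<alpha>: "(dir P n * cnj (dir P n'))\<^sup>2 = cis \<alpha>"
  shows "h2_rotation P \<alpha> = (\<lambda>z\<in>H2. drefl n (drefl n' z))"
  unfolding h2_rotation_def
proof (rule restrict_ext)
  fix z assume z: "z \<in> H2"
  define b b' where "b = dir P n" and "b' = dir P n'"
  have b': "cmod b' = 1"
    using dir_inner[OF P n(2,2)] u by (simp add: b'_def cmod_def power2_eq_square)
  define \<zeta> where "\<zeta> = - b'\<^sup>2 * cnj (Moebius_function 0 P z)"
  have \<zeta>: "cmod \<zeta> < 1"
    using moebius_H2[OF P z] b' by (simp add: \<zeta>_def norm_mult norm_power H2_def)
  have "drefl n (drefl n' z) = Moebius_function 0 (- P) (- b\<^sup>2 * cnj (Moebius_function 0 P (drefl n' z)))"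
    using drefl_through[OF P n(1) u(1), of "drefl n' z"] drefl_H2[OF u(2) z] by (simp add: b_def)
  also have e: "drefl n' z = Moebius_function 0 (- P) \<zeta>"
    using drefl_through[OF P n(2) u(2) z] by (simp add: \<zeta>_def b'_def)
  also have "Moebius_function 0 P (Moebius_function 0 (- P) \<zeta>) = \<zeta>"
    by (rule Moebius_function_compose) (use P \<zeta> in \<open>auto simp: H2_def\<close>)
  also have "- b\<^sup>2 * cnj \<zeta> = cis \<alpha> * Moebius_function 0 P z"
    using \<alpha> by (simp add: \<zeta>_def b_def b'_def power_mult_distrib)
  finally show "Moebius_function 0 (- P) (cis \<alpha> * Moebius_function 0 P z) = drefl n (drefl n' z)" by (simp add: e)
qed

text \<open>The Gram entry fixes the cosine of the angle between the mirrors but not its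
  orientation, so the order of the two reflections stays open. Either sense s is covered, as the
  definition of the group requires.\<close>

lemma two_reflections:
  assumes P: "P \<in> H2" and n: "mink (lift P) n = 0" "mink (lift P) n' = 0" and u: "mink n n = 1" "mink n' n' = 1"
    and \<alpha>: "mink n n' = - cos \<alpha>" and s: "s \<in> {1, -1::real}"
  shows "h2_rotation P (s * (2 * \<alpha>)) = (\<lambda>z\<in>H2. drefl n (drefl n' z)) \<or>
    h2_rotation P (s * (2 * \<alpha>)) = (\<lambda>z\<in>H2. drefl n' (drefl n z))"
proof -
  define e where "e = dir P n * cnj (dir P n')"
  have "cmod (dir P n) = 1" "cmod (dir P n') = 1"
    using dir_inner[OF P n(1,1)] dir_inner[OF P n(2,2)] u by (simp_all add: cmod_def power2_eq_square)
  then have "cmod e = 1" by (simp add: e_def norm_mult)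
  then have "(Re e)\<^sup>2 + (Im e)\<^sup>2 = 1" by (metis cmod_power2 one_power2)
  moreover have Re: "Re e = - cos \<alpha>" using dir_inner[OF P n] \<alpha> by (simp add: e_def)
  ultimately have "(Im e)\<^sup>2 = (sin \<alpha>)\<^sup>2" by (simp add: sin_squared_eq)
  then have "Im e = sin \<alpha> \<or> Im e = - sin \<alpha>" by (simp add: power2_eq_iff)
  then have e: "e = - cis \<alpha> \<or> e = - cis (- \<alpha>)" using Re by (auto simp: complex_eq_iff)
  have e2: "e\<^sup>2 = cis (2 * \<alpha>) \<or> e\<^sup>2 = cis (- (2 * \<alpha>))"
  proof -
    have "(- cis x)\<^sup>2 = cis (2 * x)" for x by (simp add: power2_eq_square cis_mult)
    from this[of \<alpha>] this[of "- \<alpha>"] e show ?thesis by (elim disjE) simp_all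
  qed
  have "(dir P n' * cnj (dir P n))\<^sup>2 = cnj (e\<^sup>2)" by (simp add: e_def mult.commute)
  then have "(e\<^sup>2 = cis (s * (2 * \<alpha>))) \<or> (dir P n' * cnj (dir P n))\<^sup>2 = cis (s * (2 * \<alpha>))"
  proof -
    have "s = 1 \<or> s = -1" using s by simp
    moreover have "cnj (cis x) = cis (- x)" for x by (rule cis_cnj)
    ultimately show ?thesis using e2 \<open>(dir P n' * cnj (dir P n))\<^sup>2 = cnj (e\<^sup>2)\<close>
      by (elim disjE) simp_all
  qed
  then show ?thesis
    using drefl_drefl_rotation[OF P n u, of "s * (2 * \<alpha>)"] drefl_drefl_rotation[OF P n(2,1) u(2,1), of "s * (2 * \<alpha>)"]
    unfolding e_def by blast
qed

text \<open>On the left stands the square of the determinant of the three vectors, on the right the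
  negative of their Gram determinant.\<close>

lemma gram_det:
  "(mink (cross v w) z)\<^sup>2 = mink v v * ((mink w z)\<^sup>2 - mink w w * mink z z) + mink w w * (mink v z)\<^sup>2
     + mink z z * (mink v w)\<^sup>2 - 2 * mink v w * mink w z * mink v z"
  by (simp add: mink_def cross_def power2_eq_square algebra_simps)

text \<open>The normal of a side is the normalised cross product of the lifts of its end points;
  \<open>h2_angle_mink\<close> turns the angles into Gram entries.\<close>

lemma triangle_normals:
  assumes tri: "h2_triangle A B C (pi / 2) \<beta> \<gamma>"
  obtains uA uB uC where "mink uA uA = 1" "mink uB uB = 1" "mink uC uC = 1"
    "mink uB uC = 0" "mink uA uC = - cos \<beta>" "mink uA uB = - cos \<gamma>"
    "mink (lift A) uA < 0" "mink (lift A) uB = 0" "mink (lift A) uC = 0"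
    "mink (lift B) uA = 0" "mink (lift B) uC = 0" "mink (lift B) uB < 0"
    "mink (lift C) uA = 0" "mink (lift C) uB = 0" "mink (lift C) uC < 0"
proof -
  have H: "A \<in> H2" "B \<in> H2" "C \<in> H2" and ne: "A \<noteq> B" "B \<noteq> C" "C \<noteq> A"
    and ang: "h2_angle B A C = pi / 2" "h2_angle A B C = \<beta>" "h2_angle A C B = \<gamma>"
    using tri by (auto simp: h2_triangle_def)
  define a b c where "a = lift A" and "b = lift B" and "c = lift C"
  define nab nbc nca where "nab = sqrt ((mink a b)\<^sup>2 - 1)" and "nbc = sqrt ((mink b c)\<^sup>2 - 1)" and "nca = sqrt ((mink c a)\<^sup>2 - 1)"
  have lt: "mink (lift z) (lift w) < -1" if "z \<in> H2" "w \<in> H2" "z \<noteq> w" for z w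
    using mink_lift_le[OF that(1,2)] mink_lift_eq_iff[OF that(1,2)] that(3) by linarith
  have gt: "x\<^sup>2 - 1 > 0" if "x < -1" for x :: real
    using mult_strict_mono[of 1 "-x" 1 "-x"] that by (simp add: power2_eq_square)
  have pos: "(mink a b)\<^sup>2 - 1 > 0" "(mink b c)\<^sup>2 - 1 > 0" "(mink c a)\<^sup>2 - 1 > 0"
    using gt[OF lt[OF H(1,2) ne(1)]] gt[OF lt[OF H(2,3) ne(2)]] gt[OF lt[OF H(3,1) ne(3)]]
    by (simp_all add: a_def b_def c_def)
  have self: "mink a a = -1" "mink b b = -1" "mink c c = -1"
    using H by (simp_all add: a_def b_def c_def mink_lift_self)
  have n0: "nab > 0" "nbc > 0" "nca > 0" using pos by (simp_all add: nab_def nbc_def nca_def)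
  have nsq: "nab * nab = (mink a b)\<^sup>2 - 1" "nbc * nbc = (mink b c)\<^sup>2 - 1" "nca * nca = (mink c a)\<^sup>2 - 1"
    using pos by (simp_all add: nab_def nbc_def nca_def)
  have angA: "mink b c + mink a b * mink a c = 0"
    using h2_angle_mink[OF H(1,2,3)] ne ang by (auto simp: a_def b_def c_def)
  have angB: "mink a c + mink b a * mink b c = nab * nbc * cos \<beta>"
    using h2_angle_mink[OF H(2,1,3)] ne ang by (auto simp: a_def b_def c_def nab_def nbc_def mink_sym)
  have angC: "mink a b + mink c a * mink c b = nca * nbc * cos \<gamma>"
    using h2_angle_mink[OF H(3,1,2)] ne ang by (auto simp: a_def b_def c_def nca_def nbc_def mink_sym)
  define D where "D = mink (cross a b) c"
  \<comment> \<open>The right angle at A makes the Gram determinant factor, so the three lifts are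
    independent.\<close>
  have "D\<^sup>2 = ((mink a b)\<^sup>2 - 1) * ((mink c a)\<^sup>2 - 1)"
  proof -
    have bc: "mink b c = - (mink a b * mink a c)" using angA by simp
    show ?thesis unfolding D_def gram_det self bc
      by (simp add: mink_sym[of c a] algebra_simps power2_eq_square)
  qed
  then have "D \<noteq> 0" using pos by auto
  \<comment> \<open>The sign of D is the orientation of the triangle; with e the normals point
    outward for either orientation.\<close>
  define e where "e = - sgn D"
  have e: "e * e = 1" "e * D < 0" using \<open>D \<noteq> 0\<close> by (auto simp: e_def sgn_if)
  define uA uB uC where "uA = (e / nbc) *\<^sub>R cross b c" and "uB = (e / nca) *\<^sub>R cross c a" and "uC = (e / nab) *\<^sub>R cross a b"
  note u = uA_def uB_def uC_def
  show thesis
  proof (rule that[of uA uB uC])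
    have k: "e / x * (e / y * t) = t / (x * y)" for x y t
    proof -
      have "e / x * (e / y * t) = (e * e) * (t / (x * y))"
        by (simp only: divide_inverse inverse_mult_distrib mult_ac)
      then show ?thesis using e(1) by simp
    qed
    show "mink uA uA = 1" "mink uB uB = 1" "mink uC uC = 1"
      using pos unfolding u mink_scale mink_scale2 mink_cross_cross k nsq self
      by (simp_all add: mink_sym power2_eq_square)
    show "mink uB uC = 0"
    proof -
      have "mink uB uC = - (mink b c + mink a b * mink a c) / (nca * nab)"
        unfolding u mink_scale mink_scale2 mink_cross_cross k self
        by (simp add: mink_sym[of c] mink_sym[of b a] mult.commute)
      then show ?thesis by (simp add: angA)
    qed
    show "mink uA uC = - cos \<beta>"
    proof -
      have "mink uA uC = - (mink a c + mink b a * mink b c) / (nbc * nab)"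
        unfolding u mink_scale mink_scale2 mink_cross_cross k self
        by (simp add: mink_sym[of c] mink_sym[of b a] mult.commute)
      then show ?thesis using n0 by (simp add: angB)
    qed
    show "mink uA uB = - cos \<gamma>"
    proof -
      have "mink uA uB = - (mink a b + mink c a * mink c b) / (nbc * nca)"
        unfolding u mink_scale mink_scale2 mink_cross_cross k self
        by (simp add: mink_sym[of c] mink_sym[of b a] mult.commute)
      then show ?thesis using n0 by (simp add: angC)
    qed
    have "mink (lift A) uA = e * D / nbc"
      unfolding D_def mink_cross_rotate[of a b c] by (simp add: u mink_scale2 a_def mink_sym)
    then show "mink (lift A) uA < 0" using e n0 by (simp add: divide_neg_pos)
    have "mink (lift B) uB = e * D / nca"
      unfolding D_def mink_cross_rotate[of a b c] mink_cross_rotate[of b c a] by (simp add: u mink_scale2 b_def mink_sym)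
    then show "mink (lift B) uB < 0" using e n0 by (simp add: divide_neg_pos)
    have "mink (lift C) uC = e * D / nab"
      by (simp add: D_def u mink_scale2 c_def mink_sym)
    then show "mink (lift C) uC < 0" using e n0 by (simp add: divide_neg_pos)
    show "mink (lift A) uB = 0" "mink (lift A) uC = 0" "mink (lift B) uA = 0" "mink (lift B) uC = 0"
      "mink (lift C) uA = 0" "mink (lift C) uB = 0"
      using mink_cross_left
      by (simp_all add: u mink_scale2 mink_sym[of "lift _"] a_def b_def c_def)
  qed
qed

section \<open>Hyperbolic area\<close>

text \<open>The change of variables theorem speaks of vectors over a finite index type, so the
  complex plane is identified with \<open>real^2\<close>.\<close>

definition c2v :: "complex \<Rightarrow> real^2" where "c2v z = vector [Re z, Im z]"
definition v2c :: "real^2 \<Rightarrow> complex" where "v2c v = Complex (v $ 1) (v $ 2)"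

lemma c2v_v2c [simp]: "c2v (v2c v) = v" and v2c_c2v [simp]: "v2c (c2v z) = z"
  by (simp_all add: c2v_def v2c_def vec_eq_iff forall_2)

lemma linear_c2v: "linear c2v" and linear_v2c: "linear v2c"
  by (auto intro!: linearI simp: c2v_def v2c_def vec_eq_iff forall_2 complex_eq_iff)

lemmas bounded_linear_c2v = linear_conv_bounded_linear[THEN iffD1, OF linear_c2v]
lemmas bounded_linear_v2c = linear_conv_bounded_linear[THEN iffD1, OF linear_v2c]

lemma c2v_measurable [measurable]: "c2v \<in> borel_measurable borel"
  by (intro borel_measurable_continuous_onI linear_continuous_on bounded_linear_c2v)

lemma v2c_measurable [measurable]: "v2c \<in> borel_measurable borel"
  by (intro borel_measurable_continuous_onI linear_continuous_on bounded_linear_v2c)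

lemma Basis_real_2: "(Basis :: (real^2) set) = {axis 1 1, axis 2 1}"
  by (auto simp: Basis_vec_def UNIV_2)

lemma lborel_complex_vec: "(lborel :: complex measure) = distr lborel borel v2c"
proof (rule lborel_eqI)
  fix l u :: complex assume lu: "\<And>b. b \<in> Basis \<Longrightarrow> l \<bullet> b \<le> u \<bullet> b"
  have ax: "axis 1 (1::real) \<noteq> (axis 2 1 :: real^2)" by (simp add: axis_eq_axis)
  have "v2c -` box l u = box (c2v l) (c2v u)"
    by (auto simp: box_def Basis_real_2 Basis_complex_def c2v_def v2c_def inner_axis)
  moreover have "emeasure lborel (box (c2v l) (c2v u)) = (\<Prod>b\<in>Basis. (c2v u - c2v l) \<bullet> b)"
    using lu[of 1] lu[of \<i>] by (intro emeasure_lborel_box) (auto simp: Basis_real_2 Basis_complex_def c2v_def inner_axis)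
  ultimately show "emeasure (distr lborel borel v2c) (box l u) = (\<Prod>b\<in>Basis. (u - l) \<bullet> b)"
    using ax by (simp add: emeasure_distr Basis_real_2 Basis_complex_def c2v_def inner_axis)
qed simp

lemma lborel_complex_prod: "(lborel :: complex measure) = distr (lborel \<Otimes>\<^sub>M lborel) borel (\<lambda>(x, y). Complex x y)"
proof (rule lborel_eqI)
  have m: "(\<lambda>(x, y). Complex x y) \<in> (lborel \<Otimes>\<^sub>M lborel) \<rightarrow>\<^sub>M borel"
    unfolding lborel_prod measurable_lborel2
    by (intro borel_measurable_continuous_onI) (auto simp: case_prod_beta intro!: continuous_intros)
  fix l u :: complex assume lu: "\<And>b. b \<in> Basis \<Longrightarrow> l \<bullet> b \<le> u \<bullet> b"
  have le: "Re l \<le> Re u" "Im l \<le> Im u" using lu[of 1] lu[of \<i>] by (auto simp: Basis_complex_def)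
  have "(\<lambda>(x, y). Complex x y) -` box l u = {Re l<..<Re u} \<times> {Im l<..<Im u}"
    by (auto simp: box_def Basis_complex_def)
  then show "emeasure (distr (lborel \<Otimes>\<^sub>M lborel) borel (\<lambda>(x, y). Complex x y)) (box l u) = (\<Prod>b\<in>Basis. (u - l) \<bullet> b)"
    using m le by (simp add: emeasure_distr lborel.emeasure_pair_measure_Times Basis_complex_def ennreal_mult space_pair_measure)
qed simp

text \<open>For nonnegative functions integrability means a finite integral. The theorem for
  integrable functions therefore settles infinite values too: neither side is finite without the
  other.\<close>

lemma nn_integral_substitution_vec:
  fixes f :: "real^2 \<Rightarrow> real" and g :: "real^2 \<Rightarrow> real^2"
  assumes S: "S \<in> sets lebesgue"
    and der: "\<And>x. x \<in> S \<Longrightarrow> (g has_derivative g' x) (at x within S)" and inj: "inj_on g S"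
    and f0: "\<And>x. 0 \<le> f x"
    and m1: "(\<lambda>x. if x \<in> g ` S then f x else 0) \<in> borel_measurable borel"
    and m2: "(\<lambda>x. if x \<in> S then \<bar>det (matrix (g' x))\<bar> * f (g x) else 0) \<in> borel_measurable borel"
  shows "(\<integral>\<^sup>+x. ennreal (if x \<in> g ` S then f x else 0) \<partial>lborel) =
    (\<integral>\<^sup>+x. ennreal (if x \<in> S then \<bar>det (matrix (g' x))\<bar> * f (g x) else 0) \<partial>lborel)"
proof -
  define F1 where "F1 = (\<lambda>x. if x \<in> g ` S then f x else 0)"
  define F2 where "F2 = (\<lambda>x. if x \<in> S then \<bar>det (matrix (g' x))\<bar> * f (g x) else 0)"
  have pos: "0 \<le> F1 x" "0 \<le> F2 x" for x by (simp_all add: F1_def F2_def f0)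
  have nn: "(F has_integral r) UNIV \<longleftrightarrow> (\<integral>\<^sup>+x. ennreal (F x) \<partial>lborel) = ennreal r \<and> 0 \<le> r"
    if "F \<in> borel_measurable borel" "\<And>x. 0 \<le> F x" for F :: "real^2 \<Rightarrow> real" and r
  proof -
    have l: "F \<in> borel_measurable lebesgue"
      by (rule measurable_completion) (use that(1) in simp)
    have c: "(\<integral>\<^sup>+x. ennreal (F x) \<partial>lebesgue) = (\<integral>\<^sup>+x. ennreal (F x) \<partial>lborel)"
      by (rule nn_integral_completion)
    show ?thesis
      unfolding has_integral_iff_nn_integral_lebesgue[OF that(2)] c using l by blast
  qed
  have ai: "h absolutely_integrable_on T \<and> integral T h = r \<longleftrightarrow> ((\<lambda>x. if x \<in> T then h x else 0) has_integral r) UNIV"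
    if "\<And>x. x \<in> T \<Longrightarrow> 0 \<le> h x" for h :: "real^2 \<Rightarrow> real" and T r
  proof -
    have "((\<lambda>x. if x \<in> T then h x else 0) has_integral r) UNIV \<longleftrightarrow> (h has_integral r) T"
      by (rule has_integral_restrict_UNIV)
    moreover have "(h has_integral r) T \<longleftrightarrow> h integrable_on T \<and> integral T h = r"
      by (rule has_integral_iff)
    moreover have "h absolutely_integrable_on T \<longleftrightarrow> h integrable_on T"
      by (rule absolutely_integrable_on_iff_nonneg) (rule that)
    ultimately show ?thesis by blast
  qed
  \<comment> \<open>The theorem concerns vector-valued integrands; \<open>vec\<close> embeds the
    reals as \<open>real^1\<close>.\<close>
  have iff: "(F1 has_integral r) UNIV \<longleftrightarrow> (F2 has_integral r) UNIV" for r
    using has_absolute_integral_change_of_variables[OF S der inj, of "\<lambda>x. vec (f x) :: real^1" "vec r"]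
    unfolding absolutely_integrable_on_1_iff integral_on_1_eq
    using ai[of "g ` S" f r] ai[of S "\<lambda>x. \<bar>det (matrix (g' x))\<bar> * f (g x)" r] f0
    by (simp add: F1_def F2_def)
  have n1: "(\<integral>\<^sup>+x. ennreal (F1 x) \<partial>lborel) = ennreal r \<and> 0 \<le> r \<longleftrightarrow> (\<integral>\<^sup>+x. ennreal (F2 x) \<partial>lborel) = ennreal r \<and> 0 \<le> r" for r
    using nn[of F1 r] nn[of F2 r] m1 m2 pos iff[of r] unfolding F1_def[symmetric] F2_def[symmetric] by simp
  have "(\<integral>\<^sup>+x. ennreal (F1 x) \<partial>lborel) = (\<integral>\<^sup>+x. ennreal (F2 x) \<partial>lborel)"
  proof (cases "\<integral>\<^sup>+x. ennreal (F1 x) \<partial>lborel" rule: ennreal_cases)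
    case (real r)
    with n1[of r] show ?thesis by (simp del: ennreal_inj)
  next
    case top
    show ?thesis
    proof (cases "\<integral>\<^sup>+x. ennreal (F2 x) \<partial>lborel" rule: ennreal_cases)
      case (real r)
      with n1[of r] show ?thesis by (simp del: ennreal_inj)
    qed (simp add: top)
  qed
  then show ?thesis by (simp add: F1_def F2_def)
qed

lemma nn_integral_substitution_complex:
  fixes f :: "complex \<Rightarrow> real" and g :: "complex \<Rightarrow> complex"
  assumes S: "S \<in> sets borel" and gS: "g ` S \<in> sets borel"
    and der: "\<And>z. z \<in> S \<Longrightarrow> (g has_derivative g' z) (at z)" and inj: "inj_on g S"
    and f0: "\<And>x. 0 \<le> f x"
    and f [measurable]: "f \<in> borel_measurable borel" and g [measurable]: "g \<in> borel_measurable borel"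
    and J [measurable]: "J \<in> borel_measurable borel"
    and Jg: "\<And>z. z \<in> S \<Longrightarrow> J z = \<bar>Re (g' z 1) * Im (g' z \<i>) - Im (g' z 1) * Re (g' z \<i>)\<bar>"
  shows "(\<integral>\<^sup>+x\<in>g ` S. ennreal (f x) \<partial>lborel) = (\<integral>\<^sup>+z\<in>S. ennreal (J z * f (g z)) \<partial>lborel)"
proof -
  define G where "G = (\<lambda>v. c2v (g (v2c v)))"
  define G' where "G' = (\<lambda>v h. c2v (g' (v2c v) (v2c h)))"
  define T where "T = v2c -` S"
  have T [measurable]: "T \<in> sets borel"
    using measurable_sets_borel[OF v2c_measurable S] by (simp add: T_def)
  have inT: "v \<in> T \<longleftrightarrow> v2c v \<in> S" for v by (simp add: T_def)
  have inGT: "v \<in> G ` T \<longleftrightarrow> v2c v \<in> g ` S" for v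
  proof
    assume "v2c v \<in> g ` S"
    then obtain s where s: "s \<in> S" "v2c v = g s" by blast
    have "v = G (c2v s)" unfolding G_def v2c_c2v s(2)[symmetric] by simp
    moreover have "c2v s \<in> T" using s(1) by (simp add: T_def)
    ultimately show "v \<in> G ` T" by blast
  qed (auto simp: G_def T_def)
  have det: "\<bar>det (matrix (G' v))\<bar> = J (v2c v)" if "v \<in> T" for v
  proof -
    have "v2c (axis 1 1) = 1" "v2c (axis 2 1) = \<i>" by (simp_all add: v2c_def axis_def complex_eq_iff)
    then show ?thesis
      using that unfolding Jg[OF inT[THEN iffD1, OF that]]
      by (simp add: det_2 matrix_def G'_def c2v_def mult.commute)
  qed
  have d: "(G has_derivative G' v) (at v within T)" if "v \<in> T" for v
  proof -
    have "(v2c has_derivative v2c) (at v within T)" by (rule bounded_linear_imp_has_derivative[OF bounded_linear_v2c])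
    from has_derivative_compose[OF this der[OF inT[THEN iffD1, OF that]]]
    have "((\<lambda>v. g (v2c v)) has_derivative (\<lambda>h. g' (v2c v) (v2c h))) (at v within T)" .
    from bounded_linear.has_derivative[OF bounded_linear_c2v this] show ?thesis by (simp add: G_def[abs_def] G'_def)
  qed
  have i: "inj_on G T"
  proof (rule inj_onI)
    fix v w assume "v \<in> T" "w \<in> T" "G v = G w"
    then have "g (v2c v) = g (v2c w)" unfolding G_def by (metis v2c_c2v)
    then have "v2c v = v2c w" using inj \<open>v \<in> T\<close> \<open>w \<in> T\<close> by (simp add: inT inj_on_eq_iff)
    then show "v = w" by (metis c2v_v2c)
  qed
  have [measurable]: "S \<in> sets borel" "g ` S \<in> sets borel" by fact+
  have "(\<integral>\<^sup>+x\<in>g ` S. ennreal (f x) \<partial>lborel) = (\<integral>\<^sup>+v. ennreal (if v \<in> G ` T then f (v2c v) else 0) \<partial>lborel)"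
    unfolding lborel_complex_vec
    by (subst nn_integral_distr) (auto intro!: nn_integral_cong simp: inGT simp del: image_iff split: split_indicator)
  also have "\<dots> = (\<integral>\<^sup>+v. ennreal (if v \<in> T then \<bar>det (matrix (G' v))\<bar> * f (v2c (G v)) else 0) \<partial>lborel)"
  proof (rule nn_integral_substitution_vec[OF _ d i])
    show "(\<lambda>x. if x \<in> G ` T then f (v2c x) else 0) \<in> borel_measurable borel"
      unfolding inGT by measurable
    have "(\<lambda>x. if x \<in> T then J (v2c x) * f (v2c (G x)) else 0) \<in> borel_measurable borel"
      unfolding G_def by measurable
    then show "(\<lambda>x. if x \<in> T then \<bar>det (matrix (G' x))\<bar> * f (v2c (G x)) else 0) \<in> borel_measurable borel"
      by (rule measurable_cong[THEN iffD1, rotated]) (auto simp: det)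
  qed (auto simp: f0)
  also have "\<dots> = (\<integral>\<^sup>+v. ennreal (if v \<in> T then J (v2c v) * f (g (v2c v)) else 0) \<partial>lborel)"
    by (intro nn_integral_cong) (auto simp: det G_def)
  also have "\<dots> = (\<integral>\<^sup>+z\<in>S. ennreal (J z * f (g z)) \<partial>lborel)"
    unfolding lborel_complex_vec
    by (subst nn_integral_distr) (auto intro!: nn_integral_cong simp: inT split: split_indicator)
  finally show ?thesis .
qed

section \<open>Invariance of the area under reflections\<close>

lemma borel_H2 [measurable]: "H2 \<in> sets borel"
  by (simp add: H2_def)

lemma borel_measurable_cnj [measurable]: "cnj \<in> borel_measurable borel"
  by (intro borel_measurable_continuous_onI continuous_intros)

lemma borel_measurable_cis [measurable]: "cis \<in> borel_measurable borel"
  by (intro borel_measurable_continuous_onI continuous_intros)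

lemma drefl_measurable [measurable]: "drefl n \<in> borel_measurable borel"
  unfolding drefl_def[abs_def] by measurable

lemma mink_lift_measurable [measurable]: "(\<lambda>z. mink (lift z) v) \<in> borel_measurable borel"
  unfolding mink_def lift_def fst_conv snd_conv by measurable

lemma drefl_drefl [simp]:
  assumes "mink n n = 1" "z \<in> H2"
  shows "drefl n (drefl n z) = z"
proof (rule lift_inj)
  show "lift (drefl n (drefl n z)) = lift z"
    using assms by (simp add: lift_drefl drefl_H2 mink_diff mink_scale algebra_simps)
qed (use assms in \<open>auto intro!: drefl_H2\<close>)

definition h2_area :: "complex measure" where
  "h2_area = density lborel (\<lambda>z. ennreal (4 / (1 - (cmod z)\<^sup>2)\<^sup>2) * indicator H2 z)"

lemma sets_h2_area [simp, measurable_cong]: "sets h2_area = sets borel"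
  by (simp add: h2_area_def)

lemma emeasure_h2_area:
  "A \<in> sets borel \<Longrightarrow> emeasure h2_area A = (\<integral>\<^sup>+z\<in>A \<inter> H2. ennreal (4 / (1 - (cmod z)\<^sup>2)\<^sup>2) \<partial>lborel)"
  unfolding h2_area_def
  by (subst emeasure_density) (auto intro!: nn_integral_cong split: split_indicator)

text \<open>\<open>drefl n\<close> is a Moebius map composed with conjugation. Because
  \<open>mink n n = 1\<close>, its Jacobian is 1 / N^2, and this cancels the change of the area
  density given by \<open>drefl_weight\<close>.\<close>

lemma h2_area_drefl:
  assumes n: "mink n n = 1" and A: "A \<in> sets borel"
  shows "emeasure h2_area {z \<in> H2. drefl n z \<in> A} = emeasure h2_area A"
proof -
  define S where "S = {z \<in> H2. drefl n z \<in> A}"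
  define a b where "a = complex_of_real (snd n)" and "b = fst n"
  define N where "N = (\<lambda>z. (cmod (a * cnj z - cnj b))\<^sup>2)"
  have [measurable]: "A \<in> sets borel" by fact
  have S: "S \<in> sets borel" unfolding S_def by measurable
  have gS: "drefl n ` S = A \<inter> H2"
  proof (intro equalityI subsetI)
    fix z assume "z \<in> A \<inter> H2"
    then have "drefl n z \<in> S" "z = drefl n (drefl n z)" using n by (auto simp: S_def drefl_H2)
    then show "z \<in> drefl n ` S" by blast
  qed (auto simp: S_def drefl_H2[OF n])
  define D where "D = (\<lambda>z. (b * (a * cnj z - cnj b) - (b * cnj z - a) * a) / (a * cnj z - cnj b)\<^sup>2)"
  have den: "a * cnj z - cnj b \<noteq> 0" if "z \<in> S" for z
    using drefl_denom[OF n, of z] that by (auto simp: S_def a_def b_def)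
  have der: "(drefl n has_derivative (\<lambda>h. D z * cnj h)) (at z)" if "z \<in> S" for z
  proof -
    have "((\<lambda>w. (b * w - a) / (a * w - cnj b)) has_field_derivative D z) (at (cnj z))"
      unfolding D_def using den[OF that]
      by (auto intro!: derivative_eq_intros simp: power2_eq_square)
    then have "((\<lambda>w. (b * w - a) / (a * w - cnj b)) has_derivative (*) (D z)) (at (cnj z))"
      by (rule has_field_derivative_imp_has_derivative)
    from has_derivative_compose[OF bounded_linear_imp_has_derivative[OF bounded_linear_cnj] this]
    show ?thesis by (simp add: drefl_def[abs_def] a_def b_def)
  qed
  have D: "Re (D z) * Re (D z) + Im (D z) * Im (D z) = 1 / (N z)\<^sup>2" if "z \<in> S" for z
  proof -
    have "b * cnj b - a * a = 1"
    proof -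
      have "complex_of_real (mink n n) = b * cnj b - a * a"
        by (simp add: mink_def a_def b_def complex_eq_iff)
      then show ?thesis using n by simp
    qed
    then have "D z = - 1 / (a * cnj z - cnj b)\<^sup>2" by (simp add: D_def algebra_simps)
    then have "(cmod (D z))\<^sup>2 = 1 / (N z)\<^sup>2"
      by (simp add: N_def norm_divide norm_power power_divide)
    then show ?thesis unfolding cmod_power2 by (simp add: power2_eq_square)
  qed
  define J where "J = (\<lambda>z. 1 / (N z)\<^sup>2)"
  have [measurable]: "J \<in> borel_measurable borel" unfolding J_def N_def by measurable
  define W where "W = (\<lambda>z::complex. 4 / (1 - (cmod z)\<^sup>2)\<^sup>2)"
  have [measurable]: "W \<in> borel_measurable borel" unfolding W_def by measurable
  have "emeasure h2_area A = (\<integral>\<^sup>+z\<in>drefl n ` S. ennreal (W z) \<partial>lborel)"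
    by (simp add: emeasure_h2_area A gS W_def)
  also have "\<dots> = (\<integral>\<^sup>+z\<in>S. ennreal (J z * W (drefl n z)) \<partial>lborel)"
  proof (rule nn_integral_substitution_complex[OF S _ der])
    show "drefl n ` S \<in> sets borel" unfolding gS by measurable
    show "inj_on (drefl n) S"
      by (rule inj_on_inverseI[of _ "drefl n"]) (auto simp: S_def n)
    show "J z = \<bar>Re (D z * cnj 1) * Im (D z * cnj \<i>) - Im (D z * cnj 1) * Re (D z * cnj \<i>)\<bar>" if "z \<in> S" for z
    proof -
      have "Re (D z * cnj 1) * Im (D z * cnj \<i>) - Im (D z * cnj 1) * Re (D z * cnj \<i>) = - (Re (D z) * Re (D z) + Im (D z) * Im (D z))"
        by simp
      then show ?thesis unfolding D[OF that] by (simp add: J_def)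
    qed
  qed (auto simp: W_def)
  also have "\<dots> = (\<integral>\<^sup>+z\<in>S. ennreal (W z) \<partial>lborel)"
  proof (intro nn_integral_cong)
    fix z
    show "ennreal (J z * W (drefl n z)) * indicator S z = ennreal (W z) * indicator S z"
    proof (cases "z \<in> S")
      case True
      then have z: "z \<in> H2" by (simp add: S_def)
      have "N z > 0" using drefl_denom[OF n z] by (simp add: N_def a_def b_def)
      moreover have "1 - (cmod (drefl n z))\<^sup>2 = (1 - (cmod z)\<^sup>2) / N z"
        using drefl_weight[OF n z] by (simp add: N_def a_def b_def)
      ultimately have "J z * W (drefl n z) = W z" by (simp add: J_def W_def power_divide)
      then show ?thesis by simp
    qed simp
  qed
  also have "\<dots> = emeasure h2_area S"
  proof -
    have "S \<inter> H2 = S" by (auto simp: S_def)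
    then show ?thesis by (simp add: emeasure_h2_area S W_def)
  qed
  finally show ?thesis by (simp add: S_def)
qed

text \<open>
  Polar coordinates with angle \<open>Re \<zeta>\<close> and \<open>Im \<zeta> = cosh d\<close>, where \<open>d\<close> is the distance to the centre; in
  them the area form is Lebesgue measure.
\<close>

definition polar :: "complex \<Rightarrow> complex" where
  "polar \<zeta> = of_real (sqrt ((Im \<zeta> - 1) / (Im \<zeta> + 1))) * cis (Re \<zeta>)"

lemma polar_norm:
  assumes "1 < Im \<zeta>"
  shows "(cmod (polar \<zeta>))\<^sup>2 = (Im \<zeta> - 1) / (Im \<zeta> + 1)" and "polar \<zeta> \<in> H2"
    and "1 - (cmod (polar \<zeta>))\<^sup>2 = 2 / (Im \<zeta> + 1)"
    and "snd (lift (polar \<zeta>)) = Im \<zeta>"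
    and "fst (lift (polar \<zeta>)) = of_real (sqrt ((Im \<zeta>)\<^sup>2 - 1)) * cis (Re \<zeta>)"
proof -
  show 1: "(cmod (polar \<zeta>))\<^sup>2 = (Im \<zeta> - 1) / (Im \<zeta> + 1)"
    using assms by (simp add: polar_def norm_mult)
  then show "polar \<zeta> \<in> H2" using assms by (simp add: H2_iff)
  show 2: "1 - (cmod (polar \<zeta>))\<^sup>2 = 2 / (Im \<zeta> + 1)"
    unfolding 1 using assms by (simp add: field_simps)
  have 3: "1 + (cmod (polar \<zeta>))\<^sup>2 = 2 * Im \<zeta> / (Im \<zeta> + 1)"
    unfolding 1 using assms by (simp add: field_simps)
  show "snd (lift (polar \<zeta>)) = Im \<zeta>" unfolding lift_def snd_conv 2 3 using assms by simp
  have "(Im \<zeta> + 1) * sqrt ((Im \<zeta> - 1) / (Im \<zeta> + 1)) = sqrt ((Im \<zeta> + 1)\<^sup>2 * ((Im \<zeta> - 1) / (Im \<zeta> + 1)))"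
    unfolding real_sqrt_mult using assms by simp
  also have "(Im \<zeta> + 1)\<^sup>2 * ((Im \<zeta> - 1) / (Im \<zeta> + 1)) = (Im \<zeta>)\<^sup>2 - 1"
    using assms by (simp add: power2_eq_square field_simps)
  finally show "fst (lift (polar \<zeta>)) = of_real (sqrt ((Im \<zeta>)\<^sup>2 - 1)) * cis (Re \<zeta>)"
  proof -
    assume e: "(Im \<zeta> + 1) * sqrt ((Im \<zeta> - 1) / (Im \<zeta> + 1)) = sqrt ((Im \<zeta>)\<^sup>2 - 1)"
    have "2 / (2 / (Im \<zeta> + 1)) = Im \<zeta> + 1" by simp
    then show ?thesis
      unfolding lift_def fst_conv 2 by (simp only: polar_def mult.assoc[symmetric] of_real_mult[symmetric] e)
  qed
qed

lemma h2_area_polar: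
  assumes A: "A \<in> sets borel"
  shows "emeasure h2_area A = emeasure lborel {\<zeta>. - pi < Re \<zeta> \<and> Re \<zeta> < pi \<and> 1 < Im \<zeta> \<and> polar \<zeta> \<in> A}"
proof -
  define S where "S = {\<zeta>. - pi < Re \<zeta> \<and> Re \<zeta> < pi \<and> 1 < Im \<zeta> \<and> polar \<zeta> \<in> A}"
  \<comment> \<open>The angle runs over an open interval and the radius is positive, so the image of
    \<open>polar\<close> misses the centre and the negative real axis, a null set.\<close>
  define slit where "slit = {z::complex. Im z = 0 \<and> Re z \<le> 0}"
  have [measurable]: "A \<in> sets borel" by fact
  have pm [measurable]: "polar \<in> borel_measurable borel"
    unfolding polar_def[abs_def] by measurable
  have S: "S \<in> sets borel" unfolding S_def by measurable
  have [measurable]: "slit \<in> sets borel" unfolding slit_def by measurable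
  have arg: "Arg (polar \<zeta>) = Re \<zeta>" if "- pi < Re \<zeta>" "Re \<zeta> < pi" "1 < Im \<zeta>" for \<zeta>
  proof (rule cis_Arg_unique)
    have "sqrt ((Im \<zeta> - 1) / (Im \<zeta> + 1)) > 0" using that by simp
    then show "sgn (polar \<zeta>) = cis (Re \<zeta>)"
      unfolding polar_def sgn_mult sgn_of_real by (simp add: sgn_div_norm[of "cis _"])
  qed (use that in auto)
  have gS: "polar ` S = A \<inter> H2 - slit"
  proof (intro equalityI subsetI)
    fix z assume "z \<in> polar ` S"
    then obtain \<zeta> where \<zeta>: "z = polar \<zeta>" "- pi < Re \<zeta>" "Re \<zeta> < pi" "1 < Im \<zeta>" "polar \<zeta> \<in> A"
      by (auto simp: S_def)
    have "z \<notin> slit"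
    proof
      assume "z \<in> slit"
      have "(cmod z)\<^sup>2 > 0" using polar_norm(1)[OF \<zeta>(4)] \<zeta> by simp
      then have "Im z = 0" "Re z < 0" using \<open>z \<in> slit\<close> by (auto simp: slit_def complex_eq_iff order.order_iff_strict)
      then have "Arg z = pi" by (metis Arg_eq_pi)
      then show False using arg[OF \<zeta>(2-4)] \<zeta> by simp
    qed
    then show "z \<in> A \<inter> H2 - slit" using \<zeta> polar_norm(2) by simp
  next
    fix z assume z: "z \<in> A \<inter> H2 - slit"
    then have z0: "z \<noteq> 0" by (auto simp: slit_def)
    have c: "0 < (cmod z)\<^sup>2" "(cmod z)\<^sup>2 < 1" using z z0 by (auto simp: H2_iff)
    define u where "u = (1 + (cmod z)\<^sup>2) / (1 - (cmod z)\<^sup>2)"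
    have u1: "1 < u" using c by (simp add: u_def)
    have "u - 1 = 2 * (cmod z)\<^sup>2 / (1 - (cmod z)\<^sup>2)" "u + 1 = 2 / (1 - (cmod z)\<^sup>2)"
      using c by (simp_all add: u_def field_simps)
    then have "(u - 1) / (u + 1) = (cmod z)\<^sup>2" using c by simp
    then have p: "polar (Complex (Arg z) u) = z"
      using rcis_cmod_Arg[of z] by (simp add: polar_def rcis_def)
    have "Arg z \<noteq> pi"
      using z z0 Arg_eq_pi[of z] by (auto simp: slit_def)
    then have "Complex (Arg z) u \<in> S"
      using Arg_bounded[of z] u1 z p by (auto simp: S_def)
    then show "z \<in> polar ` S" using p by (metis image_eqI)
  qed
  have slit0: "emeasure lborel slit = 0"
  proof -
    have "negligible {z::complex. \<i> \<bullet> z = 0}" by (rule negligible_hyperplane) auto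
    moreover have "slit \<subseteq> {z::complex. \<i> \<bullet> z = 0}" by (auto simp: slit_def inner_complex_def)
    ultimately have "negligible slit" by (rule negligible_subset)
    then have "slit \<in> null_sets lebesgue" by (simp add: negligible_iff_null_sets)
    then show ?thesis by (simp add: null_sets_def)
  qed
  define W where "W = (\<lambda>z::complex. 4 / (1 - (cmod z)\<^sup>2)\<^sup>2)"
  have [measurable]: "W \<in> borel_measurable borel" unfolding W_def by measurable
  define J where "J = (\<lambda>\<zeta>. 1 / (Im \<zeta> + 1)\<^sup>2)"
  have [measurable]: "J \<in> borel_measurable borel" unfolding J_def by measurable
  define R where "R = (\<lambda>t::real. sqrt ((t - 1) / (t + 1)))"
  define R' where "R' = (\<lambda>t. 1 / ((t + 1)\<^sup>2 * R t))"
  have dR: "(R has_field_derivative R' t) (at t)" if "1 < t" for t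
  proof -
    have "((\<lambda>t. (t - 1) / (t + 1)) has_field_derivative (((t + 1) - (t - 1)) / (t + 1)\<^sup>2)) (at t)"
      using that by (auto intro!: derivative_eq_intros simp: power2_eq_square)
    from DERIV_chain2[OF DERIV_real_sqrt this] that
    have "(R has_field_derivative inverse (R t) / 2 * (((t + 1) - (t - 1)) / (t + 1)\<^sup>2)) (at t)"
      unfolding R_def by simp
    also have "inverse (R t) / 2 * (((t + 1) - (t - 1)) / (t + 1)\<^sup>2) = R' t"
      by (simp add: R'_def divide_simps)
    finally show ?thesis .
  qed
  define P' where "P' = (\<lambda>\<zeta> h. of_real (R (Im \<zeta>)) * (Re h *\<^sub>R (\<i> * cis (Re \<zeta>))) + of_real (R' (Im \<zeta>) * Im h) * cis (Re \<zeta>))"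
  have der: "(polar has_derivative P' \<zeta>) (at \<zeta>)" if "\<zeta> \<in> S" for \<zeta>
  proof -
    have "(R has_derivative (*) (R' (Im \<zeta>))) (at (Im \<zeta>))"
      using dR that by (intro has_field_derivative_imp_has_derivative) (auto simp: S_def)
    from has_derivative_compose[OF bounded_linear_imp_has_derivative[OF bounded_linear_Im] this]
    have 1: "((\<lambda>x. R (Im x)) has_derivative (\<lambda>h. R' (Im \<zeta>) * Im h)) (at \<zeta>)" .
    have 2: "((\<lambda>x. cis (Re x)) has_derivative (\<lambda>h. Re h *\<^sub>R (\<i> * cis (Re \<zeta>)))) (at \<zeta>)"
      by (intro has_derivative_cis bounded_linear_imp_has_derivative bounded_linear_Re)
    show ?thesis
      using has_derivative_mult[OF has_derivative_of_real[OF 1] 2]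
      by (simp add: P'_def polar_def[abs_def] R_def)
  qed
  have "emeasure h2_area A = (\<integral>\<^sup>+z\<in>polar ` S. ennreal (W z) \<partial>lborel)"
  proof -
    have "AE z in lborel. z \<notin> slit"
      using slit0 by (intro AE_not_in) (auto simp: null_sets_def)
    then show ?thesis
      unfolding emeasure_h2_area[OF A] gS W_def
      by (intro nn_integral_cong_AE) (auto elim!: eventually_mono split: split_indicator)
  qed
  also have "\<dots> = (\<integral>\<^sup>+\<zeta>\<in>S. ennreal (J \<zeta> * W (polar \<zeta>)) \<partial>lborel)"
  proof (rule nn_integral_substitution_complex[OF S _ der])
    show "polar ` S \<in> sets borel" unfolding gS by measurable
    show "inj_on polar S"
    proof (rule inj_onI)
      fix \<zeta> \<xi> assume *: "\<zeta> \<in> S" "\<xi> \<in> S" "polar \<zeta> = polar \<xi>"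
      then have "Re \<zeta> = Re \<xi>" using arg[of \<zeta>] arg[of \<xi>] by (auto simp: S_def)
      moreover have "Im \<zeta> = Im \<xi>"
        using * polar_norm(4)[of \<zeta>] polar_norm(4)[of \<xi>] by (auto simp: S_def)
      ultimately show "\<zeta> = \<xi>" by (rule complex_eqI)
    qed
    show "J \<zeta> = \<bar>Re (P' \<zeta> 1) * Im (P' \<zeta> \<i>) - Im (P' \<zeta> 1) * Re (P' \<zeta> \<i>)\<bar>" if "\<zeta> \<in> S" for \<zeta>
    proof -
      have R0: "R (Im \<zeta>) > 0" using that by (simp add: S_def R_def)
      have "Re (P' \<zeta> 1) * Im (P' \<zeta> \<i>) - Im (P' \<zeta> 1) * Re (P' \<zeta> \<i>) =
        - (R (Im \<zeta>) * R' (Im \<zeta>)) * (sin (Re \<zeta>) * sin (Re \<zeta>)) - (R (Im \<zeta>) * R' (Im \<zeta>)) * (cos (Re \<zeta>) * cos (Re \<zeta>))"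
        by (simp add: P'_def)
      also have "\<dots> = - (R (Im \<zeta>) * R' (Im \<zeta>)) * ((sin (Re \<zeta>))\<^sup>2 + (cos (Re \<zeta>))\<^sup>2)"
        by (simp only: power2_eq_square distrib_left) simp
      also have "\<dots> = - J \<zeta>" using R0 by (simp add: R'_def J_def)
      finally show ?thesis by (simp add: J_def)
    qed
  qed (auto simp: W_def)
  also have "\<dots> = (\<integral>\<^sup>+\<zeta>\<in>S. 1 \<partial>lborel)"
  proof (intro nn_integral_cong)
    fix \<zeta>
    have "J \<zeta> * W (polar \<zeta>) = 1" if "\<zeta> \<in> S"
      using that polar_norm(3)[of \<zeta>] by (simp add: S_def J_def W_def power_divide)
    then show "ennreal (J \<zeta> * W (polar \<zeta>)) * indicator S \<zeta> = 1 * indicator S \<zeta>"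
      by (auto split: split_indicator)
  qed
  also have "\<dots> = emeasure lborel S" using S by simp
  finally show ?thesis by (simp add: S_def)
qed

section \<open>Area of discs\<close>

lemma emeasure_lborel_complex:
  assumes B: "B \<in> sets borel"
  shows "emeasure (lborel :: complex measure) B = (\<integral>\<^sup>+x. emeasure lborel {y. Complex x y \<in> B} \<partial>lborel)"
proof -
  have m: "(\<lambda>(x, y). Complex x y) \<in> (lborel \<Otimes>\<^sub>M lborel) \<rightarrow>\<^sub>M borel"
    unfolding lborel_prod measurable_lborel2
    by (intro borel_measurable_continuous_onI) (auto simp: case_prod_beta intro!: continuous_intros)
  have s: "(\<lambda>(x, y). Complex x y) -` B \<in> sets (lborel \<Otimes>\<^sub>M lborel)"
    using measurable_sets[OF m, of B] B by (simp add: space_pair_measure)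
  show ?thesis
    unfolding lborel_complex_prod using B m s
    by (subst emeasure_distr) (auto simp: space_pair_measure lborel.emeasure_pair_measure_alt vimage_def)
qed

lemma h2_dist_le_cosh:
  assumes "P \<in> H2" "z \<in> H2" "0 \<le> R"
  shows "h2_dist P z \<le> R \<longleftrightarrow> - mink (lift z) (lift P) \<le> cosh R"
proof -
  have "h2_dist P z \<le> R \<longleftrightarrow> arcosh (- mink (lift z) (lift P)) \<le> arcosh (cosh R)"
    using assms by (simp add: h2_dist_mink mink_sym arcosh_cosh_real)
  also have "\<dots> \<longleftrightarrow> - mink (lift z) (lift P) \<le> cosh R"
    using mink_lift_le[OF assms(2,1)] cosh_real_ge_1[of R] arcosh_less_iff_real[of "cosh R" "- mink (lift z) (lift P)"]
    by (simp add: not_less[symmetric] del: arcosh_less_iff_real)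
  finally show ?thesis .
qed

lemma h2_disc_borel:
  assumes "P \<in> H2" "0 \<le> R"
  shows "{z \<in> H2. h2_dist P z \<le> R} \<in> sets borel"
proof -
  have "{z \<in> H2. - mink (lift z) (lift P) \<le> cosh R} \<in> sets borel" by measurable
  also have "{z \<in> H2. - mink (lift z) (lift P) \<le> cosh R} = {z \<in> H2. h2_dist P z \<le> R}"
    using h2_dist_le_cosh[OF assms(1) _ assms(2)] by blast
  finally show ?thesis .
qed

lemma h2_disc_area_0:
  assumes "0 \<le> R"
  shows "emeasure h2_area {z \<in> H2. h2_dist 0 z \<le> R} = ennreal (2 * pi * (cosh R - 1))"
proof -
  have eq: "{z \<in> H2. h2_dist 0 z \<le> R} = {z \<in> H2. - mink (lift z) (lift 0) \<le> cosh R}"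
    using assms h2_dist_le_cosh[of 0] by (auto simp: H2_iff)
  have l0: "lift 0 = (0, 1)" by (simp add: lift_def)
  have B: "{z \<in> H2. - mink (lift z) (lift 0) \<le> cosh R} \<in> sets borel" by measurable
  have "{\<zeta>. - pi < Re \<zeta> \<and> Re \<zeta> < pi \<and> 1 < Im \<zeta> \<and> polar \<zeta> \<in> {z \<in> H2. - mink (lift z) (lift 0) \<le> cosh R}} =
     {\<zeta>. - pi < Re \<zeta> \<and> Re \<zeta> < pi \<and> 1 < Im \<zeta> \<and> Im \<zeta> \<le> cosh R}"
    using polar_norm(2,4) by (auto simp: l0 mink_def)
  then have "emeasure h2_area {z \<in> H2. h2_dist 0 z \<le> R} =
     emeasure lborel {\<zeta>. - pi < Re \<zeta> \<and> Re \<zeta> < pi \<and> 1 < Im \<zeta> \<and> Im \<zeta> \<le> cosh R}"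
    unfolding eq h2_area_polar[OF B] by simp
  also have "\<dots> = (\<integral>\<^sup>+x. emeasure lborel {y. Complex x y \<in> {\<zeta>. - pi < Re \<zeta> \<and> Re \<zeta> < pi \<and> 1 < Im \<zeta> \<and> Im \<zeta> \<le> cosh R}} \<partial>lborel)"
    by (rule emeasure_lborel_complex) measurable
  also have "\<dots> = (\<integral>\<^sup>+x. ennreal (cosh R - 1) * indicator {- pi<..<pi} x \<partial>lborel)"
  proof (intro nn_integral_cong)
    fix x :: real
    have "{y. Complex x y \<in> {\<zeta>. - pi < Re \<zeta> \<and> Re \<zeta> < pi \<and> 1 < Im \<zeta> \<and> Im \<zeta> \<le> cosh R}} =
       (if x \<in> {- pi<..<pi} then {1<..cosh R} else {})" by auto
    then show "emeasure lborel {y. Complex x y \<in> {\<zeta>. - pi < Re \<zeta> \<and> Re \<zeta> < pi \<and> 1 < Im \<zeta> \<and> Im \<zeta> \<le> cosh R}} =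
       ennreal (cosh R - 1) * indicator {- pi<..<pi} x"
      by (simp add: cosh_real_ge_1)
  qed
  also have "\<dots> = ennreal (cosh R - 1) * ennreal (2 * pi)"
    by (simp add: nn_integral_cmult_indicator)
  also have "\<dots> = ennreal (2 * pi * (cosh R - 1))"
    by (simp add: ennreal_mult'[symmetric] cosh_real_ge_1 mult.commute)
  finally show ?thesis .
qed

definition vrefl :: "complex \<times> real \<Rightarrow> complex \<times> real \<Rightarrow> complex \<times> real" where
  "vrefl n v = v - (2 * mink v n) *\<^sub>R n"

lemma lift_drefl': "mink n n = 1 \<Longrightarrow> z \<in> H2 \<Longrightarrow> lift (drefl n z) = vrefl n (lift z)"
  by (simp add: lift_drefl vrefl_def)

lemma mink_vrefl: "mink n n = 1 \<Longrightarrow> mink (vrefl n v) (vrefl n w) = mink v w"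
  by (simp add: vrefl_def mink_simps mink_sym[of n w])

lemma mink_vrefl_left: "mink (vrefl n v) w = mink v (vrefl n w)"
  by (simp add: vrefl_def mink_simps mink_sym[of n w])

lemma h2_dist_drefl:
  "mink n n = 1 \<Longrightarrow> z \<in> H2 \<Longrightarrow> w \<in> H2 \<Longrightarrow> h2_dist (drefl n z) (drefl n w) = h2_dist z w"
  by (simp add: h2_dist_mink drefl_H2 lift_drefl' mink_vrefl)

lemma reflection_to_centre:
  assumes "P \<in> H2" "P \<noteq> 0"
  obtains n where "mink n n = 1" "drefl n P = 0"
proof -
  define r where "r = (cmod P)\<^sup>2"
  have r: "0 < r" "r < 1" using assms by (auto simp: r_def H2_iff)
  define l where "l = 1 / sqrt (r * (1 - r))"
  have l: "l\<^sup>2 * (r * (1 - r)) = 1" using r by (simp add: l_def power_divide)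
  \<comment> \<open>The difference of the lifts of P and 0 is a multiple of (P, |P|^2) and normal to
    their perpendicular bisector; l scales it to length one.\<close>
  define n where "n = (of_real l * P, l * r)"
  have "mink n n = l\<^sup>2 * r - (l * r)\<^sup>2"
    by (simp add: mink_def n_def r_def cmod_power2) (simp add: power2_eq_square algebra_simps)
  also have "\<dots> = 1" using l by (simp add: power2_eq_square algebra_simps)
  finally have "mink n n = 1" .
  moreover have "drefl n P = 0"
    by (simp add: drefl_def n_def r_def complex_norm_square del: of_real_power)
  ultimately show thesis by (rule that)
qed

lemma h2_disc_area:
  assumes P: "P \<in> H2" and R: "0 \<le> R"
  shows "emeasure h2_area {z \<in> H2. h2_dist P z \<le> R} = ennreal (2 * pi * (cosh R - 1))"
proof (cases "P = 0")
  case False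
  obtain n where n: "mink n n = 1" "drefl n P = 0" using reflection_to_centre[OF P False] by blast
  have "{z \<in> H2. h2_dist P z \<le> R} = {z \<in> H2. drefl n z \<in> {z \<in> H2. h2_dist 0 z \<le> R}}"
    using h2_dist_drefl[OF n(1) P] n drefl_H2[OF n(1)] by auto
  moreover have "{z \<in> H2. h2_dist 0 z \<le> R} \<in> sets borel"
    using R by (intro h2_disc_borel) (auto simp: H2_iff)
  ultimately show ?thesis
    by (simp only: h2_area_drefl[OF n(1)] h2_disc_area_0[OF R])
qed (use h2_disc_area_0[OF R] in simp)

section \<open>Area of lines and of right triangles\<close>

lemma h2_area_null:
  assumes "A \<in> sets borel" "negligible A"
  shows "emeasure h2_area A = 0"
proof -
  have "A \<in> null_sets lborel"
    using assms negligible_iff_null_sets[of A] by (auto simp: null_sets_def)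
  then have "AE z in lborel. z \<notin> A" by (rule AE_not_in)
  then have "(\<integral>\<^sup>+z\<in>A \<inter> H2. ennreal (4 / (1 - (cmod z)\<^sup>2)\<^sup>2) \<partial>lborel) = (\<integral>\<^sup>+z. 0 \<partial>(lborel::complex measure))"
    by (intro nn_integral_cong_AE) (auto elim!: eventually_mono)
  then show ?thesis using assms by (simp add: emeasure_h2_area)
qed

text \<open>The set lies on a diameter if the last coordinate of v is 0, and otherwise on a
  Euclidean circle.\<close>

lemma h2_area_line:
  assumes "v \<noteq> 0"
  shows "emeasure h2_area {z \<in> H2. mink (lift z) v = 0} = 0"
proof (rule h2_area_null)
  show "{z \<in> H2. mink (lift z) v = 0} \<in> sets borel" by measurable
  obtain p q h where v: "v = (Complex p q, h)" by (rule vec_cases)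
  have rel: "2 * (p * Re z + q * Im z) = h * (1 + (Re z)\<^sup>2 + (Im z)\<^sup>2)" if "z \<in> H2" "mink (lift z) v = 0" for z
    using that H2_pos[OF that(1)]
    by (simp add: mink_def lift_def v diff_divide_distrib[symmetric] add_divide_distrib[symmetric] cmod_power2 algebra_simps)
  show "negligible {z \<in> H2. mink (lift z) v = 0}"
  proof (cases "h = 0")
    case True
    then have "Complex p q \<noteq> 0" using assms by (auto simp: v zero_prod_def)
    then have "negligible {z. Complex p q \<bullet> z = 0}" by (intro negligible_hyperplane) auto
    then show ?thesis
    proof (rule negligible_subset, safe)
      fix z assume "z \<in> H2" "mink (lift z) v = 0"
      from rel[OF this] True show "Complex p q \<bullet> z = 0" by (simp add: inner_complex_def)
    qed
  next
    case False
    define c where "c = Complex (p / h) (q / h)"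
    have "{z \<in> H2. mink (lift z) v = 0} \<subseteq> sphere c (sqrt ((p / h)\<^sup>2 + (q / h)\<^sup>2 - 1))"
    proof safe
      fix z assume z: "z \<in> H2" "mink (lift z) v = 0"
      have "(cmod (c - z))\<^sup>2 = (p / h)\<^sup>2 + (q / h)\<^sup>2 - (2 * (p * Re z + q * Im z)) / h + (Re z)\<^sup>2 + (Im z)\<^sup>2"
        by (simp add: c_def cmod_power2) (simp add: power2_eq_square add_divide_distrib algebra_simps)
      also have "\<dots> = (p / h)\<^sup>2 + (q / h)\<^sup>2 - 1"
        unfolding rel[OF z] using False by simp
      finally have "cmod (c - z) = sqrt ((p / h)\<^sup>2 + (q / h)\<^sup>2 - 1)"
        by (metis norm_ge_zero real_sqrt_unique)
      then show "z \<in> sphere c (sqrt ((p / h)\<^sup>2 + (q / h)\<^sup>2 - 1))" by (simp add: dist_norm)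
    qed
    then show ?thesis by (rule negligible_subset[OF negligible_sphere])
  qed
qed

definition chamber :: "(complex \<times> real) \<Rightarrow> (complex \<times> real) \<Rightarrow> (complex \<times> real) \<Rightarrow> complex set" where
  "chamber uA uB uC = {z \<in> H2. mink (lift z) uA < 0 \<and> mink (lift z) uB < 0 \<and> mink (lift z) uC < 0}"

lemma chamber_borel [measurable]: "chamber uA uB uC \<in> sets borel"
  unfolding chamber_def by measurable

lemma chamber_area_vrefl:
  assumes "mink n n = 1"
  shows "emeasure h2_area (chamber (vrefl n uA) (vrefl n uB) (vrefl n uC)) = emeasure h2_area (chamber uA uB uC)"
proof -
  have "chamber (vrefl n uA) (vrefl n uB) (vrefl n uC) = {z \<in> H2. drefl n z \<in> chamber uA uB uC}"
    using assms by (auto simp: chamber_def lift_drefl' mink_vrefl_left drefl_H2)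
  then show ?thesis using h2_area_drefl[OF assms] by simp
qed

lemma mink_lift_polar:
  "1 < Im \<zeta> \<Longrightarrow> mink (lift (polar \<zeta>)) v = sqrt ((Im \<zeta>)\<^sup>2 - 1) * Re (cis (Re \<zeta>) * cnj (fst v)) - Im \<zeta> * snd v"
  unfolding mink_def polar_norm(4,5) by (simp add: algebra_simps)

text \<open>Here B is the centre, one side lies on the real axis and one in direction \<beta>. In
  polar coordinates the area is the integral of U - 1 over the angle, where U is cosh of the
  distance to the third side. The antiderivative is arcsin (p sin x) - x, and p sin \<beta> = cos
  \<gamma> produces the Gauss-Bonnet value.\<close>

lemma chamber_area_normal_form:
  assumes \<beta>: "0 < \<beta>" "\<beta> < pi / 2" and \<gamma>: "0 < \<gamma>" "\<gamma> < pi / 2"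
    and p: "p * sin \<beta> = cos \<gamma>" and h: "p\<^sup>2 - h\<^sup>2 = 1" "0 < h"
  shows "emeasure h2_area (chamber (Complex (- sin \<beta>) (cos \<beta>), 0) (of_real p, h) (- \<i>, 0)) = ennreal (pi / 2 - \<beta> - \<gamma>)"
proof -
  define T where "T = chamber (Complex (- sin \<beta>) (cos \<beta>), 0) (of_real p, h) (- \<i>, 0)"
  define B where "B = {\<zeta>. - pi < Re \<zeta> \<and> Re \<zeta> < pi \<and> 1 < Im \<zeta> \<and> polar \<zeta> \<in> T}"
  have sb: "sin \<beta> > 0" using \<beta> by (intro sin_gt_zero) auto
  have cg: "0 < cos \<gamma>" "cos \<gamma> < 1" using \<gamma> cos_gt_zero[of \<gamma>] cos_monotone_0_pi[of 0 \<gamma>] by auto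
  have p0: "p > 0" using p sb cg by (metis zero_less_mult_pos2)
  have ps: "p * sin x \<le> cos \<gamma>" if "0 \<le> x" "x \<le> \<beta>" for x
    using that \<beta> p0 unfolding p[symmetric] by (intro mult_left_mono sin_monotone_2pi_le) auto
  have ps0: "0 \<le> p * sin x" if "0 \<le> x" "x \<le> \<beta>" for x
    using that \<beta> p0 by (intro mult_nonneg_nonneg sin_ge_zero) auto
  have D: "0 < 1 - (p * sin x)\<^sup>2" if "0 \<le> x" "x \<le> \<beta>" for x
    using ps[OF that] ps0[OF that] cg by (simp add: abs_square_less_1)
  define U where "U = (\<lambda>x. p * cos x / sqrt (1 - (p * sin x)\<^sup>2))"
  have U1: "1 \<le> U x" if "0 \<le> x" "x \<le> \<beta>" for x
  proof -
    have "1 - (p * sin x)\<^sup>2 \<le> (p * cos x)\<^sup>2"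
    proof -
      have "(p * cos x)\<^sup>2 + (p * sin x)\<^sup>2 = p\<^sup>2"
        by (simp add: power_mult_distrib flip: distrib_left)
      then show ?thesis using h zero_le_power2[of h] by linarith
    qed
    moreover have "0 \<le> p * cos x" using p0 that \<beta> by (intro mult_nonneg_nonneg cos_ge_zero) auto
    ultimately have "sqrt (1 - (p * sin x)\<^sup>2) \<le> p * cos x" by (intro real_le_lsqrt) auto
    then show ?thesis using D[OF that] by (simp add: U_def)
  qed
  have sq: "a < b \<longleftrightarrow> a\<^sup>2 < b\<^sup>2" if "0 \<le> a" "0 \<le> b" for a b :: real
    using that power_strict_mono[of a b 2] power2_less_imp_less[of a b] by auto
  have fiber: "{y. Complex x y \<in> B} = (if 0 < x \<and> x < \<beta> then {1<..<U x} else {})" for x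
  proof -
    have A: "Complex x y \<in> B \<longleftrightarrow> 0 < x \<and> x < \<beta> \<and> 1 < y \<and> y < U x" for y
    proof (cases "- pi < x \<and> x < pi \<and> 1 < y")
      case True
      then have w: "0 < sqrt (y\<^sup>2 - 1)"
        using mult_strict_mono[of 1 y 1 y] by (simp add: power2_eq_square)
      have "polar (Complex x y) \<in> H2" using polar_norm(2) True by simp
      then have "Complex x y \<in> B \<longleftrightarrow> sqrt (y\<^sup>2 - 1) * sin (x - \<beta>) < 0 \<and> sqrt (y\<^sup>2 - 1) * (cos x * p) - y * h < 0 \<and> sqrt (y\<^sup>2 - 1) * - sin x < 0"
        using True by (simp add: B_def T_def chamber_def mink_lift_polar sin_diff algebra_simps)
      also have "\<dots> \<longleftrightarrow> sin (x - \<beta>) < 0 \<and> sqrt (y\<^sup>2 - 1) * (cos x * p) - y * h < 0 \<and> 0 < sin x"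
        using w by (simp add: mult_less_0_iff zero_less_mult_iff)
      also have "\<dots> \<longleftrightarrow> 0 < x \<and> x < \<beta> \<and> sqrt (y\<^sup>2 - 1) * (cos x * p) - y * h < 0"
      proof -
        have "0 < sin x \<longleftrightarrow> 0 < x"
          using True sin_gt_zero[of x] sin_ge_zero[of "- x"] by (cases "0 < x") auto
        moreover have "sin (x - \<beta>) < 0 \<longleftrightarrow> x < \<beta>" if "0 < x"
        proof -
          have "sin (x - \<beta>) = - sin (\<beta> - x)" using sin_minus[of "\<beta> - x"] by simp
          then show ?thesis
            using True \<beta> that sin_gt_zero[of "\<beta> - x"] sin_ge_zero[of "x - \<beta>"] by (cases "x < \<beta>") auto
        qed
        ultimately show ?thesis by blast
      qed
      also have "\<dots> \<longleftrightarrow> 0 < x \<and> x < \<beta> \<and> y < U x"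
      proof (intro conj_cong refl)
        assume x: "0 < x" "x < \<beta>"
        then have D': "0 < 1 - (p * sin x)\<^sup>2" by (intro D) auto
        have c0: "0 \<le> p * cos x" using p0 x \<beta> by (intro mult_nonneg_nonneg cos_ge_zero) auto
        have "sqrt (y\<^sup>2 - 1) * (cos x * p) - y * h < 0 \<longleftrightarrow> sqrt (y\<^sup>2 - 1) * (p * cos x) < y * h"
          by (simp add: mult.commute)
        also have "\<dots> \<longleftrightarrow> (sqrt (y\<^sup>2 - 1) * (p * cos x))\<^sup>2 < (y * h)\<^sup>2"
          by (rule sq[OF mult_nonneg_nonneg[OF less_imp_le[OF w] c0]]) (use True h in simp)
        also have "\<dots> \<longleftrightarrow> (y\<^sup>2 - 1) * (p * cos x)\<^sup>2 < y\<^sup>2 * h\<^sup>2"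
          using w by (simp add: power_mult_distrib)
        also have "\<dots> \<longleftrightarrow> y\<^sup>2 * (1 - (p * sin x)\<^sup>2) < (p * cos x)\<^sup>2"
        proof -
          define C E where "C = (p * cos x)\<^sup>2" and "E = (p * sin x)\<^sup>2"
          have "C = p\<^sup>2 - E" by (simp add: C_def E_def power_mult_distrib cos_squared_eq right_diff_distrib)
          then have "h\<^sup>2 = C + E - 1" using h by simp
          show ?thesis unfolding C_def[symmetric] E_def[symmetric] \<open>h\<^sup>2 = C + E - 1\<close> by (simp add: algebra_simps)
        qed
        also have "\<dots> \<longleftrightarrow> (y * sqrt (1 - (p * sin x)\<^sup>2))\<^sup>2 < (p * cos x)\<^sup>2"
          using D' by (simp add: power_mult_distrib)
        also have "\<dots> \<longleftrightarrow> y * sqrt (1 - (p * sin x)\<^sup>2) < p * cos x"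
          by (rule sq[OF _ c0, symmetric]) (use D' True in simp)
        also have "\<dots> \<longleftrightarrow> y < U x" using D' by (simp add: U_def field_simps)
        finally show "sqrt (y\<^sup>2 - 1) * (cos x * p) - y * h < 0 \<longleftrightarrow> y < U x" .
      qed
      finally show ?thesis using True by blast
    next
      case False
      then show ?thesis using \<beta> by (auto simp: B_def)
    qed
    have "{y. Complex x y \<in> B} = {y. 0 < x \<and> x < \<beta> \<and> 1 < y \<and> y < U x}"
      by (simp only: A)
    also have "\<dots> = (if 0 < x \<and> x < \<beta> then {1<..<U x} else {})" by auto
    finally show ?thesis .
  qed
  define F where "F = (\<lambda>x. arcsin (p * sin x) - x)"
  have "emeasure h2_area T = emeasure lborel B"
    unfolding B_def by (rule h2_area_polar) (simp add: T_def)
  also have "\<dots> = (\<integral>\<^sup>+x. emeasure lborel {y. Complex x y \<in> B} \<partial>lborel)"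
  proof (rule emeasure_lborel_complex)
    have "T \<in> sets borel" by (simp add: T_def)
    moreover have "polar \<in> borel_measurable borel" unfolding polar_def[abs_def] by measurable
    ultimately show "B \<in> sets borel" unfolding B_def by measurable
  qed
  also have "\<dots> = (\<integral>\<^sup>+x. ennreal (U x - 1) * indicator {0..\<beta>} x \<partial>lborel)"
  proof (intro nn_integral_cong_AE)
    have "AE x in lborel. x \<noteq> 0 \<and> x \<noteq> \<beta>" using AE_lborel_singleton[of 0] AE_lborel_singleton[of \<beta>] by eventually_elim simp
    then show "AE x in lborel. emeasure lborel {y. Complex x y \<in> B} = ennreal (U x - 1) * indicator {0..\<beta>} x"
    proof eventually_elim
      fix x assume x: "x \<noteq> 0 \<and> x \<noteq> \<beta>"
      show "emeasure lborel {y. Complex x y \<in> B} = ennreal (U x - 1) * indicator {0..\<beta>} x"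
      proof (cases "0 < x \<and> x < \<beta>")
        case True
        then show ?thesis unfolding fiber using U1[of x] by simp
      next
        case False
        then show ?thesis unfolding fiber using x by auto
      qed
    qed
  qed
  also have "\<dots> = ennreal (F \<beta> - F 0)"
  proof (rule nn_integral_FTC_Icc)
    show "(\<lambda>x. U x - 1) \<in> borel_measurable borel" unfolding U_def by measurable
    fix x assume "x \<in> {0..\<beta>}"
    then have x: "0 \<le> x" "x \<le> \<beta>" by auto
    have "-1 < p * sin x" "p * sin x < 1" using ps0[OF x] ps[OF x] cg by auto
    then have d: "(arcsin has_real_derivative inverse (sqrt (1 - (p * sin x)\<^sup>2))) (at (p * sin x))"
      by (rule DERIV_arcsin)
    have "((\<lambda>x. p * sin x) has_real_derivative p * cos x) (at x)"
      by (auto intro!: derivative_eq_intros)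
    from DERIV_diff[OF DERIV_chain2[OF d this] DERIV_ident]
    have "(F has_real_derivative (inverse (sqrt (1 - (p * sin x)\<^sup>2)) * (p * cos x) - 1)) (at x)"
      by (simp add: F_def)
    then show "(F has_real_derivative U x - 1) (at x)" by (simp add: U_def divide_inverse mult.commute)
    show "0 \<le> U x - 1" using U1[OF x] by simp
  qed (use \<beta> in auto)
  also have "F \<beta> - F 0 = pi / 2 - \<beta> - \<gamma>"
  proof -
    have "arcsin (cos \<gamma>) = pi / 2 - \<gamma>"
      using \<gamma> arcsin_sin[of "pi / 2 - \<gamma>"] by (simp add: sin_diff)
    then show ?thesis by (simp add: F_def p)
  qed
  finally show ?thesis by (simp add: T_def)
qed

text \<open>At most three reflections lead to the normal form: one takes B to the centre, one takes
  \<open>uC\<close> to -i, and if necessary one exchanges the two halves of the disk beside the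
  imaginary axis.\<close>

lemma chamber_area:
  assumes \<beta>: "0 < \<beta>" "\<beta> < pi / 2" and \<gamma>: "0 < \<gamma>" "\<gamma> < pi / 2"
    and B: "B \<in> H2" "mink (lift B) uA = 0" "mink (lift B) uC = 0" "mink (lift B) uB < 0"
    and u: "mink uA uA = 1" "mink uB uB = 1" "mink uC uC = 1"
    and g: "mink uB uC = 0" "mink uA uC = - cos \<beta>" "mink uA uB = - cos \<gamma>"
  shows "emeasure h2_area (chamber uA uB uC) = ennreal (pi / 2 - \<beta> - \<gamma>)"
proof -
  have sb: "sin \<beta> > 0" using \<beta> by (intro sin_gt_zero) auto
  have c: "emeasure h2_area (chamber uA uB uC) = ennreal (pi / 2 - \<beta> - \<gamma>)"
    if "snd uA = 0" "snd uB > 0" and C: "uC = (- \<i>, 0)" and u: "mink uA uA = 1" "mink uB uB = 1"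
      and g: "mink uB uC = 0" "mink uA uC = - cos \<beta>" "mink uA uB = - cos \<gamma>" for uA uB uC
  proof -
    obtain x y a where "uA = (Complex x y, a)" by (rule vec_cases)
    with that(1) have A: "uA = (Complex x y, 0)" by simp
    obtain p q h where Bv: "uB = (Complex p q, h)" by (rule vec_cases)
    have y: "y = cos \<beta>" using g(2) by (simp add: A C mink_def)
    have q: "q = 0" using g(1) by (simp add: Bv C mink_def)
    have x2: "x\<^sup>2 = (sin \<beta>)\<^sup>2" 
    proof -
      have "x\<^sup>2 + (cos \<beta>)\<^sup>2 = 1" using u(1) by (simp add: A mink_def y power2_eq_square)
      then show ?thesis by (simp add: sin_squared_eq)
    qed
    have ph: "p\<^sup>2 - h\<^sup>2 = 1" "0 < h" using u(2) that(2) by (simp_all add: Bv mink_def q power2_eq_square)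
    have xp: "x * p = - cos \<gamma>" using g(3) by (simp add: A Bv mink_def q)
    consider "x = - sin \<beta>" | "x = sin \<beta>" using x2 by (auto simp: power2_eq_iff)
    then show ?thesis
    proof cases
      case 1
      have "uB = (of_real p, h)" by (simp add: Bv q complex_eq_iff)
      then show ?thesis
        using chamber_area_normal_form[OF \<beta> \<gamma>, of p h] ph xp 1 by (simp add: A y C mult.commute)
    next
      case 2
      let ?n = "(1, 0) :: complex \<times> real"
      have n: "mink ?n ?n = 1" by (simp add: mink_def)
      have "vrefl ?n uA = (Complex (- sin \<beta>) (cos \<beta>), 0)" "vrefl ?n uB = (of_real (- p), h)" "vrefl ?n uC = (- \<i>, 0)"
        by (simp_all add: vrefl_def A Bv C mink_def q y 2 complex_eq_iff scaleR_prod_def)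
      then show ?thesis
        using chamber_area_normal_form[OF \<beta> \<gamma>, of "- p" h] ph xp 2 chamber_area_vrefl[OF n, of uA uB uC] by (simp add: mult.commute)
    qed
  qed
  have b: "emeasure h2_area (chamber uA uB uC) = ennreal (pi / 2 - \<beta> - \<gamma>)"
    if "snd uA = 0" "snd uC = 0" "snd uB > 0" and u: "mink uA uA = 1" "mink uB uB = 1" "mink uC uC = 1"
      and g: "mink uB uC = 0" "mink uA uC = - cos \<beta>" "mink uA uB = - cos \<gamma>" for uA uB uC
  proof -
    define c where "c = fst uC"
    have C: "uC = (c, 0)" using that(2) by (simp add: c_def prod_eq_iff)
    have "(cmod c)\<^sup>2 = 1" using u(3) by (simp add: C mink_def cmod_power2) (simp add: power2_eq_square)
    then have cc: "c * cnj c = 1" by (metis complex_norm_square of_real_1)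
    \<comment> \<open>For a unit number b with b^2 = i c, the reflection with normal (b, 0) sends c
      to - b^2 cnj c = -i.\<close>
    define b where "b = csqrt (\<i> * c)"
    have bsq: "b\<^sup>2 = \<i> * c" by (simp add: b_def)
    have "cmod c = 1" using \<open>(cmod c)\<^sup>2 = 1\<close> by (metis norm_ge_zero one_power2 power2_eq_imp_eq zero_le_one)
    then have "(cmod b)\<^sup>2 = 1" using arg_cong[OF bsq, of cmod] by (simp add: norm_power norm_mult)
    then have bb: "b * cnj b = 1" by (metis complex_norm_square of_real_1)
    let ?n = "(b, 0) :: complex \<times> real"
    have n: "mink ?n ?n = 1" using bb by (simp add: mink_def)
    have "of_real (2 * Re (c * cnj b)) = c * cnj b + cnj c * b"
      using complex_add_cnj[of "c * cnj b"] by simp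
    then have "of_real (2 * Re (c * cnj b)) * b = c * (b * cnj b) + cnj c * b\<^sup>2"
      by (simp add: power2_eq_square algebra_simps)
    then have "of_real (2 * Re (c * cnj b)) * b = c + \<i>" using bb bsq cc by (simp add: algebra_simps)
    then have C': "vrefl ?n uC = (- \<i>, 0)"
      by (simp add: vrefl_def C mink_def scaleR_conv_of_real scaleR_prod_def)
    have "emeasure h2_area (chamber (vrefl ?n uA) (vrefl ?n uB) (vrefl ?n uC)) = ennreal (pi / 2 - \<beta> - \<gamma>)"
    proof (rule c)
      show "snd (vrefl (b, 0) uA) = 0" "0 < snd (vrefl (b, 0) uB)" using that by (simp_all add: vrefl_def)
    qed (fact C' | simp only: mink_vrefl[OF n] u g)+
    then show ?thesis using chamber_area_vrefl[OF n] by simp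
  qed
  have s: "snd v = - mink (0, 1) v" for v :: "complex \<times> real" by (simp add: mink_def)
  have l0: "lift 0 = (0, 1)" by (simp add: lift_def)
  show ?thesis
  proof (cases "B = 0")
    case True
    then show ?thesis using B by (intro b u g) (auto simp: s l0)
  next
    case False
    obtain n where n: "mink n n = 1" "drefl n B = 0" using reflection_to_centre[OF B(1) False] by blast
    have "mink (0, 1) (vrefl n v) = mink (lift B) v" for v
      using lift_drefl'[OF n(1) B(1)] mink_vrefl[OF n(1), of "lift B" v] by (simp add: n(2) l0)
    then have "emeasure h2_area (chamber (vrefl n uA) (vrefl n uB) (vrefl n uC)) = ennreal (pi / 2 - \<beta> - \<gamma>)"
      using B by (intro b) (simp_all add: s u g mink_vrefl[OF n(1)])
    then show ?thesis using chamber_area_vrefl[OF n(1)] by simp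
  qed
qed

section \<open>Orthonormal coordinates and heights on the hyperboloid\<close>

lemma cramer:
  "mink (cross v w) z *\<^sub>R x = mink x v *\<^sub>R cross w z + mink x w *\<^sub>R cross z v + mink x z *\<^sub>R cross v w"
  by (rule prod_eqI) (simp_all add: mink_def cross_def complex_eq_iff algebra_simps)

text \<open>The three vectors are independent by their Gram determinant, so the remainder of the
  expansion, orthogonal to all of them, vanishes by Cramer's rule.\<close>

lemma orthonormal_expansion:
  assumes "mink e e = -1" "mink v v = 1" "mink w w = 1" "mink v w = 0" "mink e v = 0" "mink e w = 0"
  shows "x = (- mink x e) *\<^sub>R e + mink x v *\<^sub>R v + mink x w *\<^sub>R w"
proof -
  have "(mink (cross v w) e)\<^sup>2 = 1"
    unfolding gram_det using assms by (simp add: mink_sym[of v e] mink_sym[of w e])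
  then have d: "mink (cross v w) e \<noteq> 0" by auto
  define y where "y = x - ((- mink x e) *\<^sub>R e + mink x v *\<^sub>R v + mink x w *\<^sub>R w)"
  have "mink y v = 0" "mink y w = 0" "mink y e = 0"
    using assms by (simp_all add: y_def mink_simps mink_sym[of v e] mink_sym[of w e] mink_sym[of w v])
  with cramer[of v w e y] have "mink (cross v w) e *\<^sub>R y = 0" by simp
  with d have "y = 0" by simp
  then show ?thesis by (simp add: y_def)
qed

text \<open>Stereographic projection back to the disk. It lets a linear map act on the disk without
  choosing a word for it.\<close>

definition unlift :: "complex \<times> real \<Rightarrow> complex" where
  "unlift v = fst v / of_real (1 + snd v)"

lemma unlift_lift [simp]: "z \<in> H2 \<Longrightarrow> unlift (lift z) = z"
proof -
  assume z: "z \<in> H2"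
  then have r: "1 - (cmod z)\<^sup>2 > 0" by (simp add: H2_iff)
  then have "1 + snd (lift z) = 2 / (1 - (cmod z)\<^sup>2)"
    by (simp add: lift_def field_simps)
  moreover have "complex_of_real (2 / (1 - (cmod z)\<^sup>2)) \<noteq> 0"
    using r by (simp only: of_real_eq_0_iff) simp
  ultimately show ?thesis
    unfolding unlift_def by (simp only: lift_def fst_conv nonzero_mult_div_cancel_left not_False_eq_True)
qed

lemma snd_lift_pos: "z \<in> H2 \<Longrightarrow> 0 < snd (lift z)"
  by (simp add: lift_def H2_iff add_pos_nonneg)

lemma norm_fst_lift:
  assumes "z \<in> H2"
  shows "(cmod (fst (lift z)))\<^sup>2 = (snd (lift z))\<^sup>2 - 1" "cmod (fst (lift z)) < snd (lift z)"
proof -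
  show "(cmod (fst (lift z)))\<^sup>2 = (snd (lift z))\<^sup>2 - 1"
  proof -
    have "(cmod (fst (lift z)))\<^sup>2 = Re (fst (lift z) * cnj (fst (lift z)))"
      using arg_cong[OF complex_norm_square, of Re] by (simp only: Re_complex_of_real)
    then show ?thesis
      using mink_lift_self[OF assms] unfolding mink_def power2_eq_square[of "snd _"] by linarith
  qed
  then have "(cmod (fst (lift z)))\<^sup>2 < (snd (lift z))\<^sup>2" by linarith
  then show "cmod (fst (lift z)) < snd (lift z)"
    by (rule power2_less_imp_less) (rule less_imp_le[OF snd_lift_pos[OF assms]])
qed

text \<open>Comparison of the form with heights replaces the triangle inequality of the hyperbolic metric.\<close>

lemma mink_lift_lower:
  assumes "z \<in> H2" "w \<in> H2"
  shows "snd (lift w) \<le> 2 * snd (lift z) * - mink (lift z) (lift w)"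
proof -
  define a b x y where "a = cmod (fst (lift z))" and "b = cmod (fst (lift w))" and "x = snd (lift z)" and "y = snd (lift w)"
  have ab: "0 \<le> a" "a < x" "0 \<le> b" "b < y" "a\<^sup>2 = x\<^sup>2 - 1"
    using norm_fst_lift[OF assms(1)] norm_fst_lift(2)[OF assms(2)] by (simp_all add: a_def b_def x_def y_def)
  have "Re (fst (lift z) * cnj (fst (lift w))) \<le> a * b"
    using complex_Re_le_cmod[of "fst (lift z) * cnj (fst (lift w))"] by (simp add: a_def b_def norm_mult)
  also have "\<dots> \<le> a * y" using ab by (intro mult_left_mono) auto
  finally have "(x - a) * y \<le> - mink (lift z) (lift w)"
    by (simp add: mink_def x_def y_def algebra_simps)
  then have "2 * x * ((x - a) * y) \<le> 2 * x * - mink (lift z) (lift w)"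
    using ab by (intro mult_left_mono) auto
  moreover have "y \<le> 2 * x * ((x - a) * y)"
  proof -
    have "1 = (x - a) * (x + a)" using ab by (simp add: algebra_simps power2_eq_square)
    also have "\<dots> \<le> (x - a) * (2 * x)" using ab by (intro mult_left_mono) auto
    finally have "1 * y \<le> (x - a) * (2 * x) * y" using ab by (intro mult_right_mono) auto
    then show ?thesis by (simp add: algebra_simps)
  qed
  ultimately show ?thesis unfolding x_def y_def by linarith
qed

lemma mink_lift_upper:
  assumes "z \<in> H2" "w \<in> H2"
  shows "- mink (lift z) (lift w) \<le> 2 * snd (lift z) * snd (lift w)"
proof -
  have "- Re (fst (lift z) * cnj (fst (lift w))) \<le> cmod (fst (lift z)) * cmod (fst (lift w))"
    using abs_Re_le_cmod[of "fst (lift z) * cnj (fst (lift w))"] by (simp add: norm_mult)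
  also have "\<dots> \<le> snd (lift z) * snd (lift w)"
    using norm_fst_lift(2)[OF assms(1)] norm_fst_lift(2)[OF assms(2)] snd_lift_pos[OF assms(1)]
    by (intro mult_mono less_imp_le norm_ge_zero)
  finally show ?thesis unfolding mink_def by linarith
qed

section \<open>The triangle group as a reflection group\<close>

text \<open>
  \<open>SA\<close>, \<open>SB\<close>, \<open>SC\<close> are the sides opposite to the vertices \<open>A\<close>, \<open>B\<close>, \<open>C\<close>, and \<open>uA\<close>, \<open>uB\<close>, \<open>uC\<close> their outer
  unit normals.
\<close>

datatype side = SA | SB | SC

lemma UNIV_side: "(UNIV :: side set) = {SA, SB, SC}"
  using side.exhaust by auto

instance side :: finite
  by standard (simp add: UNIV_side)

locale hyp_triangle =
  fixes uA uB uC :: "complex \<times> real" and p1 p2 :: nat and A B :: complex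
  assumes p: "3 \<le> p1" "3 \<le> p2" "1 / real p1 + 1 / real p2 < 1 / 2"
    and unitA: "mink uA uA = 1" and unitB: "mink uB uB = 1" and unitC: "mink uC uC = 1"
    and gramBC: "mink uB uC = 0" and gramAC: "mink uA uC = - cos (pi / real p1)" and gramAB: "mink uA uB = - cos (pi / real p2)"
    and A: "A \<in> H2" "mink (lift A) uA < 0" "mink (lift A) uB = 0" "mink (lift A) uC = 0"
    and B: "B \<in> H2" "mink (lift B) uA = 0" "mink (lift B) uB < 0" "mink (lift B) uC = 0"
begin

definition u :: "side \<Rightarrow> complex \<times> real" where
  "u i = (case i of SA \<Rightarrow> uA | SB \<Rightarrow> uB | SC \<Rightarrow> uC)"

lemma u_simps [simp]: "u SA = uA" "u SB = uB" "u SC = uC"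
  by (simp_all add: u_def)

definition m :: "side \<Rightarrow> side \<Rightarrow> nat" where
  "m i j = (if {i, j} = {SA, SC} then p1 else if {i, j} = {SA, SB} then p2 else 2)"

lemma m_simps [simp]: "m SA SC = p1" "m SC SA = p1" "m SA SB = p2" "m SB SA = p2" "m SB SC = 2" "m SC SB = 2"
  by (auto simp: m_def doubleton_eq_iff)

sublocale coxeter_form mink u m
proof
  fix i j :: side
  show "mink (u i) (u i) = 1" by (cases i) (simp_all add: unitA unitB unitC)
  show "mink (u i) (u j) = - cos (pi / real (m i j))" if "i \<noteq> j"
    using that by (cases i; cases j) (simp_all add: gramBC gramAC gramAB mink_sym[of uC uA] mink_sym[of uC uB] mink_sym[of uB uA])
  show "m i j = m j i" by (simp add: m_def insert_commute)
  show "2 \<le> m i j" using p by (simp add: m_def)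
qed (rule mink_add mink_scale mink_sym)+

definition \<beta> :: real where "\<beta> = pi / real p1"
definition \<gamma> :: real where "\<gamma> = pi / real p2"

lemma angles: "0 < \<beta>" "\<beta> \<le> pi / 3" "0 < \<gamma>" "\<gamma> \<le> pi / 3" "\<beta> + \<gamma> < pi / 2"
proof -
  show "0 < \<beta>" "0 < \<gamma>" using p by (simp_all add: \<beta>_def \<gamma>_def)
  show "\<beta> \<le> pi / 3" "\<gamma> \<le> pi / 3" unfolding \<beta>_def \<gamma>_def using p by (intro divide_left_mono; simp)+
  have "\<beta> + \<gamma> = pi * (1 / real p1 + 1 / real p2)" by (simp add: \<beta>_def \<gamma>_def algebra_simps)
  also have "\<dots> < pi * (1 / 2)" using p by (intro mult_strict_left_mono) auto
  finally show "\<beta> + \<gamma> < pi / 2" by simp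
qed

lemma refl_vrefl: "refl i = vrefl (u i)"
  by (simp add: refl_def vrefl_def fun_eq_iff)

lemma unit_u: "mink (u i) (u i) = 1"
  by (rule unit)

abbreviation dact :: "side list \<Rightarrow> complex \<Rightarrow> complex" where
  "dact \<equiv> foldr (\<lambda>i. drefl (u i))"

lemma dact_lift: "z \<in> H2 \<Longrightarrow> dact w z \<in> H2 \<and> lift (dact w z) = act w (lift z)"
  by (induction w) (auto simp: drefl_H2 unit_u lift_drefl' refl_vrefl)

lemma dact_H2: "z \<in> H2 \<Longrightarrow> dact w z \<in> H2" and lift_dact: "z \<in> H2 \<Longrightarrow> lift (dact w z) = act w (lift z)"
  using dact_lift by auto

lemma dact_append: "dact (v @ w) z = dact v (dact w z)"
  by simp

lemma dact_rev: "z \<in> H2 \<Longrightarrow> dact (rev w) (dact w z) = z" "z \<in> H2 \<Longrightarrow> dact w (dact (rev w) z) = z"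
  by (rule lift_inj; simp add: dact_H2 lift_dact del: foldr_append)+

lemma h2_dist_dact: "z \<in> H2 \<Longrightarrow> z' \<in> H2 \<Longrightarrow> h2_dist (dact w z) (dact w z') = h2_dist z z'"
  by (simp add: h2_dist_mink dact_H2 lift_dact B_act)

lemma cross_act: "cross (act w v) (act w v') = (if even (length w) then act w (cross v v') else - act w (cross v v'))"
proof (induction w arbitrary: v v')
  case (Cons i w)
  have *: "cross (refl i x) (refl i y) = - refl i (cross x y)" for x y
    using cross_refl[OF unit_u[of i], of x y] by (simp add: refl_def)
  have "refl i (- x) = - refl i x" for x using refl_scale[of i "-1" x] by simp
  then show ?case by (simp add: * Cons)
qed simp

text \<open>Even words preserve the cross product and odd ones reverse it, so parity belongs to the
  linear map and not to the word.\<close>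

lemma act_parity:
  assumes "act w = act w'"
  shows "even (length w) \<longleftrightarrow> even (length w')"
proof (rule ccontr)
  assume ne: "\<not> ?thesis"
  define x where "x = cross (1, 0) (\<i>, 0)"
  have "act w x = - act w x"
    using cross_act[of w "(1, 0)" "(\<i>, 0)"] cross_act[of w' "(1, 0)" "(\<i>, 0)"] ne
    by (auto simp: x_def[symmetric] assms split: if_splits)
  then have "act w x = 0" by (simp add: eq_neg_iff_add_eq_0 scaleR_2[symmetric])
  then have "x = 0" by (metis act_rev act_scale scaleR_zero_left)
  then show False by (simp add: x_def cross_def zero_prod_def complex_eq_iff)
qed

lemma act_eq_id:
  assumes "\<And>z. z \<in> H2 \<Longrightarrow> act w (lift z) = lift z"
  shows "act w = id"
proof
  fix v :: "complex \<times> real"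
  obtain x y h where v: "v = (Complex x y, h)" by (rule vec_cases)
  have l: "lift 0 = (0, 1)" "lift (1/2) = (4/3, 5/3)" "lift (\<i>/2) = (4/3 * \<i>, 5/3)"
    by (simp_all add: lift_def power2_eq_square complex_eq_iff)
  \<comment> \<open>The lifts of 0, 1/2 and i/2 form a basis; these are the coordinates of v in
    it.\<close>
  have "v = (3/4 * x) *\<^sub>R lift (1/2) + (3/4 * y) *\<^sub>R lift (\<i>/2) + (h - 5/4 * (x + y)) *\<^sub>R lift 0"
    by (simp add: v l complex_eq_iff scaleR_prod_def plus_prod_def field_simps)
  moreover have "0 \<in> H2" "1/2 \<in> H2" "\<i>/2 \<in> H2" by (simp_all add: H2_iff power2_eq_square norm_divide)
  ultimately show "act w v = id v" using assms by (simp only: act_add act_scale id_apply)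
qed

section \<open>The tessellation by images of the chamber\<close>

abbreviation closed_chamber :: "complex set" where
  "closed_chamber \<equiv> {z \<in> H2. \<forall>i. mink (lift z) (u i) \<le> 0}"

lemma chamber_iff: "z \<in> chamber uA uB uC \<longleftrightarrow> z \<in> H2 \<and> (\<forall>i. mink (lift z) (u i) < 0)"
proof -
  have "(\<forall>i. mink (lift z) (u i) < 0) \<longleftrightarrow> (\<forall>i\<in>UNIV. mink (lift z) (u i) < 0)" by simp
  also have "\<dots> \<longleftrightarrow> mink (lift z) uA < 0 \<and> mink (lift z) uB < 0 \<and> mink (lift z) uC < 0"
    unfolding UNIV_side by simp
  finally show ?thesis by (auto simp: chamber_def)
qed

lemma chamber_area': "emeasure h2_area (chamber uA uB uC) = ennreal (pi / 2 - \<beta> - \<gamma>)"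
  using angles pi_gt_zero
  by (intro chamber_area[where B = B]) (auto simp: B unitA unitB unitC gramBC gramAC gramAB \<beta>_def[symmetric] \<gamma>_def[symmetric])

text \<open>Positive area already provides an interior point.\<close>

lemma chamber_nonempty: "\<exists>z. z \<in> chamber uA uB uC"
proof (rule ccontr)
  assume "\<not> ?thesis"
  then have "chamber uA uB uC = {}" by auto
  then show False using chamber_area' angles by (simp add: ennreal_eq_0_iff)
qed

lemma chamber_margin:
  assumes "z \<in> chamber uA uB uC"
  obtains \<kappa> where "0 < \<kappa>" "\<And>i. mink (lift z) (u i) \<le> - \<kappa>"
proof -
  define \<kappa> where "\<kappa> = Min (range (\<lambda>i. - mink (lift z) (u i)))"
  have "0 < \<kappa>" using assms by (auto simp: \<kappa>_def chamber_iff Min_gr_iff)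
  moreover have "\<kappa> \<le> - mink (lift z) (u i)" for i by (auto simp: \<kappa>_def intro!: Min_le)
  ultimately show thesis using that[of \<kappa>] by (metis le_minus_iff)
qed

lemma reduced_displacement:
  assumes "z \<in> chamber uA uB uC"
  shows "\<exists>c>0. \<forall>w. reduced w \<longrightarrow> mink (lift z) (act w (lift z)) \<le> -1 - c * real (length w)"
proof -
  obtain \<kappa> where \<kappa>: "0 < \<kappa>" "\<And>i. mink (lift z) (u i) \<le> - \<kappa>" using chamber_margin[OF assms] by blast
  have "mink (lift z) (lift z) = -1" using assms by (intro mink_lift_self) (auto simp: chamber_iff)
  then show ?thesis
    using B_act_growth[OF _ \<kappa>(2) \<kappa>(2)] \<kappa>(1) by (intro exI[of _ "2 * \<kappa> * \<kappa>"]) auto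
qed

text \<open>Linear growth is available only at an interior point k0 of the chamber. Heights carry it
  over to arbitrary z and k: a bound on the product with z bounds the height of the image of k,
  hence that of the image of k0, hence the length of a reduced word.\<close>

lemma finite_near:
  assumes z: "z \<in> H2" and k: "k \<in> H2"
  shows "finite {f \<in> range act. - M \<le> mink (lift z) (f (lift k))}"
proof -
  obtain k0 where k0: "k0 \<in> chamber uA uB uC" using chamber_nonempty by blast
  then have k0': "k0 \<in> H2" by (simp add: chamber_iff)
  obtain c where c: "c > 0" "\<And>w. reduced w \<Longrightarrow> mink (lift k0) (act w (lift k0)) \<le> -1 - c * real (length w)"
    using reduced_displacement[OF k0] by blast
  define a where "a = - mink (lift k) (lift k0)"
  have a0: "a \<ge> 1" using mink_lift_le[OF k k0'] by (simp add: a_def)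
  define R where "R = (2 * snd (lift k0) * (2 * a * (2 * snd (lift z) * M))) * 2"
  define N where "N = nat \<lceil>R / c\<rceil>"
  have "{f \<in> range act. - M \<le> mink (lift z) (f (lift k))} \<subseteq> act ` {w. set w \<subseteq> UNIV \<and> length w \<le> N}"
  proof
    fix f assume "f \<in> {f \<in> range act. - M \<le> mink (lift z) (f (lift k))}"
    then obtain w0 where w0: "f = act w0" "- M \<le> mink (lift z) (f (lift k))" by auto
    obtain w where w: "act w = f" "reduced w" using exists_reduced[of w0] w0 by auto
    define x y where "x = dact w k" and "y = dact w k0"
    have xy: "x \<in> H2" "y \<in> H2" "lift x = f (lift k)" "lift y = f (lift k0)"
      using k k0' w by (auto simp: x_def y_def dact_H2 lift_dact)
    have pz: "snd (lift z) > 0" "snd (lift x) > 0" "snd (lift y) > 0" "snd (lift k0) > 0"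
      by (intro snd_lift_pos z xy k0')+
    have "snd (lift x) \<le> 2 * snd (lift z) * - mink (lift z) (lift x)" by (rule mink_lift_lower[OF z xy(1)])
    also have "\<dots> \<le> 2 * snd (lift z) * M" using w0(2) pz xy(3) by (intro mult_left_mono) auto
    finally have x1: "snd (lift x) \<le> 2 * snd (lift z) * M" .
    have "mink (lift x) (lift y) = - a" unfolding xy w(1)[symmetric] B_act by (simp add: a_def)
    then have "snd (lift y) \<le> 2 * snd (lift x) * a" using mink_lift_lower[OF xy(1,2)] by simp
    also have "\<dots> \<le> 2 * (2 * snd (lift z) * M) * a" using x1 a0 by (intro mult_right_mono mult_left_mono) auto
    finally have y1: "snd (lift y) \<le> 2 * a * (2 * snd (lift z) * M)" by (simp add: algebra_simps)
    have "1 + c * real (length w) \<le> - mink (lift k0) (lift y)" using c(2)[OF w(2)] w(1) xy(4) by simp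
    also have "\<dots> \<le> 2 * snd (lift k0) * snd (lift y)" by (rule mink_lift_upper[OF k0' xy(2)])
    also have "\<dots> \<le> 2 * snd (lift k0) * (2 * a * (2 * snd (lift z) * M))" using y1 pz by (intro mult_left_mono) auto
    finally have "1 + c * real (length w) \<le> 2 * snd (lift k0) * (2 * a * (2 * snd (lift z) * M))" .
    moreover have "0 \<le> c * real (length w)" using c(1) by simp
    ultimately have "c * real (length w) \<le> R" unfolding R_def by linarith
    then have "real (length w) \<le> R / c" using c(1) by (simp add: field_simps)
    then have "length w \<le> N" unfolding N_def by linarith
    then show "f \<in> act ` {w. set w \<subseteq> UNIV \<and> length w \<le> N}" using w(1) by auto
  qed
  then show ?thesis
    by (rule finite_subset) (intro finite_imageI finite_lists_length_le finite)
qed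

lemma nearest_exists:
  assumes "I \<subseteq> range act" "I \<noteq> {}" "z \<in> H2" "k \<in> H2"
  obtains f where "f \<in> I" "\<And>g. g \<in> I \<Longrightarrow> mink (lift z) (g (lift k)) \<le> mink (lift z) (f (lift k))"
proof -
  obtain f0 where f0: "f0 \<in> I" using assms(2) by blast
  define S where "S = {f \<in> I. mink (lift z) (f0 (lift k)) \<le> mink (lift z) (f (lift k))}"
  have "finite S"
    by (rule finite_subset[OF _ finite_near[OF assms(3,4), of "- mink (lift z) (f0 (lift k))"]]) (use assms(1) in \<open>auto simp: S_def\<close>)
  moreover have "f0 \<in> S" by (simp add: S_def f0)
  ultimately have "Max ((\<lambda>f. mink (lift z) (f (lift k))) ` S) \<in> (\<lambda>f. mink (lift z) (f (lift k))) ` S"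
    by (intro Max_in) auto
  then obtain f where f: "f \<in> S" "Max ((\<lambda>f. mink (lift z) (f (lift k))) ` S) = mink (lift z) (f (lift k))"
    by blast
  have f_max: "mink (lift z) (g (lift k)) \<le> mink (lift z) (f (lift k))" if "g \<in> S" for g
    unfolding f(2)[symmetric] using \<open>finite S\<close> that by (intro Max_ge) auto
  have "mink (lift z) (g (lift k)) \<le> mink (lift z) (f (lift k))" if "g \<in> I" for g
  proof (cases "g \<in> S")
    case False
    then have "mink (lift z) (g (lift k)) \<le> mink (lift z) (f0 (lift k))" using that by (auto simp: S_def)
    also have "\<dots> \<le> mink (lift z) (f (lift k))" using f(1) by (simp add: S_def)
    finally show ?thesis .
  qed (rule f_max)
  moreover have "f \<in> I" using f by (simp add: S_def)
  ultimately show thesis using that by blast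
qed

text \<open>Take the image of an interior point k nearest to z and move it back to k. Then k is at
  least as near as its mirror images in the walls, which puts the moved z on the inner side of every
  wall.\<close>

lemma chamber_covers:
  assumes z: "z \<in> H2"
  obtains w where "dact w z \<in> closed_chamber"
proof -
  obtain k where k: "k \<in> chamber uA uB uC" using chamber_nonempty by blast
  then have k': "k \<in> H2" by (simp add: chamber_iff)
  obtain f where f: "f \<in> range act" "\<And>g. g \<in> range act \<Longrightarrow> mink (lift z) (g (lift k)) \<le> mink (lift z) (f (lift k))"
    using nearest_exists[OF subset_refl _ z k'] by blast
  then obtain w where w: "f = act w" by auto
  have "mink (lift (dact (rev w) z)) (u i) \<le> 0" for i
  proof -
    define x where "x = lift (dact (rev w) z)"
    have wx: "lift z = act w x" using z by (simp add: x_def lift_dact)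
    have "mink (lift z) (act (w @ [i]) (lift k)) \<le> mink (lift z) (act w (lift k))"
      using f(2)[of "act (w @ [i])"] w by blast
    then have "mink x (refl i (lift k)) \<le> mink x (lift k)"
      unfolding wx by (simp add: B_act)
    then have "0 \<le> mink (lift k) (u i) * mink x (u i)"
      by (simp add: refl_def mink_simps mult.commute)
    moreover have "mink (lift k) (u i) < 0" using k by (simp add: chamber_iff)
    ultimately show ?thesis by (simp add: x_def zero_le_mult_iff)
  qed
  then show thesis using that[of "rev w"] z dact_H2 by simp
qed

text \<open>For two chamber points \<open>B_act_le\<close> forces w to fix z, and then a reduced
  form of w has length 0 by the growth estimate.\<close>

lemma chamber_disjoint:
  assumes "z \<in> chamber uA uB uC" "dact w z \<in> chamber uA uB uC"
  shows "act w = id"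
proof -
  have z: "z \<in> H2" using assms(1) by (simp add: chamber_iff)
  define x y where "x = lift z" and "y = lift (dact w z)"
  have y: "y = act w x" using z by (simp add: x_def y_def lift_dact)
  have "mink y (act w x) \<le> mink y x"
    using assms by (intro B_act_le) (auto simp: chamber_iff x_def y_def less_imp_le)
  then have "-1 \<le> mink y x"
    using y mink_lift_self[OF dact_H2[OF z, of w]] by (simp add: y_def)
  then have "dact w z = z"
    using mink_lift_le[OF dact_H2[OF z, of w] z] mink_lift_eq_iff[OF dact_H2[OF z, of w] z] by (simp add: x_def y_def)
  obtain w' where w': "act w' = act w" "reduced w'" using exists_reduced by blast
  obtain c where c: "c > 0" "mink x (act w' x) \<le> -1 - c * real (length w')"
    using reduced_displacement[OF assms(1)] w'(2) by (auto simp: x_def)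
  have "mink x (act w' x) = -1"
    using \<open>dact w z = z\<close> w'(1) z by (simp add: x_def mink_lift_self flip: lift_dact)
  then have "length w' = 0" using c by (simp add: mult_le_0_iff)
  then show ?thesis using w'(1) by (simp add: id_def)
qed

end

section \<open>Area of the Dirichlet cell\<close>

text \<open>D is cut by the translates of T and each piece is moved into T; the results are the
  pieces into which the translates of D cut T. The group appears as a countable index set with an
  inversion \<iota>.\<close>

lemma emeasure_fundamental_domains:
  fixes \<phi> :: "'g \<Rightarrow> 'a \<Rightarrow> 'a"
  assumes I: "countable I" and \<Omega>: "\<Omega> \<in> sets M"
    and meas: "\<And>g A. g \<in> I \<Longrightarrow> A \<in> sets M \<Longrightarrow> {x \<in> \<Omega>. \<phi> g x \<in> A} \<in> sets M"
    and pres: "\<And>g A. g \<in> I \<Longrightarrow> A \<in> sets M \<Longrightarrow> A \<subseteq> \<Omega> \<Longrightarrow> emeasure M {x \<in> \<Omega>. \<phi> g x \<in> A} = emeasure M A"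
    and closed: "\<And>g x. g \<in> I \<Longrightarrow> x \<in> \<Omega> \<Longrightarrow> \<phi> g x \<in> \<Omega>"
    and inv: "\<And>g. g \<in> I \<Longrightarrow> \<iota> g \<in> I" "\<And>g. g \<in> I \<Longrightarrow> \<iota> (\<iota> g) = g"
      "\<And>g x. g \<in> I \<Longrightarrow> x \<in> \<Omega> \<Longrightarrow> \<phi> g (\<phi> (\<iota> g) x) = x"
    and D: "D \<in> sets M" "D \<subseteq> \<Omega>" and T: "T \<in> sets M" "T \<subseteq> \<Omega>"
    and disjD: "\<And>g h x. g \<in> I \<Longrightarrow> h \<in> I \<Longrightarrow> x \<in> \<Omega> \<Longrightarrow> \<phi> g x \<in> D \<Longrightarrow> \<phi> h x \<in> D \<Longrightarrow> g = h"
    and disjT: "\<And>g h x. g \<in> I \<Longrightarrow> h \<in> I \<Longrightarrow> x \<in> \<Omega> \<Longrightarrow> \<phi> g x \<in> T \<Longrightarrow> \<phi> h x \<in> T \<Longrightarrow> g = h"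
    and covD: "emeasure M (\<Omega> - (\<Union>g\<in>I. {x \<in> \<Omega>. \<phi> g x \<in> D})) = 0"
    and covT: "emeasure M (\<Omega> - (\<Union>g\<in>I. {x \<in> \<Omega>. \<phi> g x \<in> T})) = 0"
  shows "emeasure M D = emeasure M T"
proof -
  have split: "emeasure M P = (\<integral>\<^sup>+g. emeasure M (P \<inter> {x \<in> \<Omega>. \<phi> g x \<in> Q}) \<partial>count_space I)"
    if P: "P \<in> sets M" "P \<subseteq> \<Omega>" and Q: "Q \<in> sets M"
      and disj: "\<And>g h x. g \<in> I \<Longrightarrow> h \<in> I \<Longrightarrow> x \<in> \<Omega> \<Longrightarrow> \<phi> g x \<in> Q \<Longrightarrow> \<phi> h x \<in> Q \<Longrightarrow> g = h"
      and cov: "emeasure M (\<Omega> - (\<Union>g\<in>I. {x \<in> \<Omega>. \<phi> g x \<in> Q})) = 0" for P Q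
  proof -
    define U where "U = (\<Union>g\<in>I. {x \<in> \<Omega>. \<phi> g x \<in> Q})"
    have U: "U \<in> sets M" unfolding U_def using I meas Q by (intro sets.countable_UN'') auto
    have "\<Omega> - U \<in> null_sets M" using cov U \<Omega> by (auto simp: U_def null_sets_def)
    then have "P \<inter> (\<Omega> - U) \<in> null_sets M" using P(1) by (rule null_set_Int1)
    then have "emeasure M (P - (P \<inter> (\<Omega> - U))) = emeasure M P" using P(1) by (rule emeasure_Diff_null_set)
    moreover have "P - (P \<inter> (\<Omega> - U)) = (\<Union>g\<in>I. P \<inter> {x \<in> \<Omega>. \<phi> g x \<in> Q})"
      using P(2) by (auto simp: U_def)
    ultimately have "emeasure M P = emeasure M (\<Union>g\<in>I. P \<inter> {x \<in> \<Omega>. \<phi> g x \<in> Q})" by simp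
    also have "\<dots> = (\<integral>\<^sup>+g. emeasure M (P \<inter> {x \<in> \<Omega>. \<phi> g x \<in> Q}) \<partial>count_space I)"
      using disj by (intro emeasure_UN_countable I sets.Int P(1) meas Q) (auto simp: disjoint_family_on_def)
    finally show ?thesis .
  qed
  have eq: "emeasure M (D \<inter> {x \<in> \<Omega>. \<phi> g x \<in> T}) = emeasure M (T \<inter> {x \<in> \<Omega>. \<phi> (\<iota> g) x \<in> D})" if g: "g \<in> I" for g
  proof -
    have "emeasure M {x \<in> \<Omega>. \<phi> (\<iota> g) x \<in> D \<inter> {x \<in> \<Omega>. \<phi> g x \<in> T}} = emeasure M (D \<inter> {x \<in> \<Omega>. \<phi> g x \<in> T})"
      by (intro pres inv(1) g sets.Int D meas T) auto
    moreover have "{x \<in> \<Omega>. \<phi> (\<iota> g) x \<in> D \<inter> {x \<in> \<Omega>. \<phi> g x \<in> T}} = T \<inter> {x \<in> \<Omega>. \<phi> (\<iota> g) x \<in> D}"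
      using T(2) inv(3)[OF g] closed[OF inv(1)[OF g]] by auto
    ultimately show ?thesis by simp
  qed
  have bij: "bij_betw \<iota> I I"
    by (rule bij_betw_byWitness[of _ \<iota>]) (auto simp: inv)
  have "emeasure M D = (\<integral>\<^sup>+g. emeasure M (D \<inter> {x \<in> \<Omega>. \<phi> g x \<in> T}) \<partial>count_space I)"
    by (rule split[OF D T(1) disjT covT])
  also have "\<dots> = (\<integral>\<^sup>+g. emeasure M (T \<inter> {x \<in> \<Omega>. \<phi> (\<iota> g) x \<in> D}) \<partial>count_space I)"
    by (intro nn_integral_cong) (simp add: eq)
  also have "\<dots> = (\<integral>\<^sup>+g. emeasure M (T \<inter> {x \<in> \<Omega>. \<phi> g x \<in> D}) \<partial>count_space I)"
    by (rule nn_integral_bij_count_space[OF bij])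
  also have "\<dots> = emeasure M T"
    by (rule split[OF T D(1) disjD covD, symmetric])
  finally show ?thesis .
qed

section \<open>The even subgroup and its Dirichlet cells\<close>

context hyp_triangle
begin

abbreviation finv :: "(complex \<times> real \<Rightarrow> complex \<times> real) \<Rightarrow> complex \<times> real \<Rightarrow> complex \<times> real" where
  "finv \<equiv> inv_into UNIV"

definition E :: "(complex \<times> real \<Rightarrow> complex \<times> real) set" where
  "E = act ` {w. even (length w)}"

lemma countable_act: "countable (range act)"
  by (intro countable_image) simp

lemma E_subset: "E \<subseteq> range act"
  by (auto simp: E_def)

lemma countable_E: "countable E"
  using E_subset countable_act by (rule countable_subset)

lemma E_actI: "even (length w) \<Longrightarrow> act w \<in> E"
  by (auto simp: E_def)

lemma id_E: "id \<in> E"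
  using E_actI[of "[]"] by (simp add: id_def)

lemma comp_E: "f \<in> E \<Longrightarrow> g \<in> E \<Longrightarrow> f \<circ> g \<in> E"
proof -
  assume "f \<in> E" "g \<in> E"
  then obtain v w where "f = act v" "g = act w" "even (length v)" "even (length w)" by (auto simp: E_def)
  then have "f \<circ> g = act (v @ w)" "even (length (v @ w))" by auto
  then show ?thesis using E_actI by metis
qed

lemma inv_act: "finv (act w) = act (rev w)"
  by (rule inv_unique_comp) (simp_all add: fun_eq_iff)

lemma inv_E: "f \<in> E \<Longrightarrow> finv f \<in> E"
  by (auto simp: E_def inv_act)

lemma inv_inv_E: "f \<in> E \<Longrightarrow> finv (finv f) = f"
  by (auto simp: E_def inv_act)

lemma E_inv_comp: "f \<in> E \<Longrightarrow> finv f (f x) = x" "f \<in> E \<Longrightarrow> f (finv f x) = x"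
  by (auto simp: E_def inv_act)

lemma mink_E: "f \<in> E \<Longrightarrow> mink (f v) (f w) = mink v w"
  by (auto simp: E_def B_act)

lemma mink_E_inv: "f \<in> E \<Longrightarrow> mink (f v) w = mink v (finv f w)"
  using mink_E[of f v "finv f w"] E_inv_comp(2)[of f w] by simp

lemma unlift_act: "z \<in> H2 \<Longrightarrow> unlift (act w (lift z)) = dact w z"
  by (simp add: dact_H2 flip: lift_dact)

lemma lift_E: "f \<in> E \<Longrightarrow> z \<in> H2 \<Longrightarrow> unlift (f (lift z)) \<in> H2 \<and> lift (unlift (f (lift z))) = f (lift z)"
  by (auto simp: E_def unlift_act dact_H2 lift_dact)

lemma dact_measurable [measurable]: "dact w \<in> borel_measurable borel"
proof (induction w)
  case (Cons i w)
  then have [measurable]: "dact w \<in> borel_measurable borel" .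
  have "(\<lambda>z. drefl (u i) (dact w z)) \<in> borel_measurable borel" by measurable
  then show ?case by (simp add: comp_def)
qed (simp add: id_def)

lemma h2_area_dact:
  assumes "X \<in> sets borel"
  shows "emeasure h2_area {z \<in> H2. dact w z \<in> X} = emeasure h2_area X"
  using assms
proof (induction w arbitrary: X)
  case Nil
  have "{z \<in> H2. dact [] z \<in> X} = X \<inter> H2" by auto
  then show ?case using Nil by (simp add: emeasure_h2_area)
next
  case (Cons i w)
  have [measurable]: "X \<in> sets borel" by fact
  have "{z \<in> H2. dact (i # w) z \<in> X} = {z \<in> H2. dact w z \<in> {y \<in> H2. drefl (u i) y \<in> X}}"
    by (auto simp: dact_H2)
  also have "emeasure h2_area \<dots> = emeasure h2_area {y \<in> H2. drefl (u i) y \<in> X}"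
    by (rule Cons.IH) measurable
  also have "\<dots> = emeasure h2_area X" by (rule h2_area_drefl[OF unit_u Cons.prems])
  finally show ?case .
qed

text \<open>A fundamental domain for the even words, up to null sets: the chamber and its mirror
  image in the side BC.\<close>

definition double_chamber :: "complex set" where
  "double_chamber = {z \<in> H2. z \<in> chamber uA uB uC \<or> drefl uA z \<in> chamber uA uB uC}"

lemma double_chamber_borel [measurable]: "double_chamber \<in> sets borel"
  unfolding double_chamber_def by measurable

lemma double_chamber_area: "emeasure h2_area double_chamber = ennreal (pi - 2 * \<beta> - 2 * \<gamma>)"
proof -
  define C where "C = chamber uA uB uC"
  define C' where "C' = {z \<in> H2. drefl uA z \<in> C}"
  have "C \<inter> C' = {}"
    by (auto simp: C_def C'_def chamber_def lift_drefl[OF unitA] mink_diff mink_scale unitA)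
  moreover have "C \<in> sets borel" "C' \<in> sets borel" unfolding C_def C'_def by measurable
  moreover have "double_chamber = C \<union> C'"
    by (auto simp: double_chamber_def C_def C'_def chamber_iff)
  ultimately have "emeasure h2_area double_chamber = emeasure h2_area C + emeasure h2_area C'"
    by (simp add: plus_emeasure)
  also have "emeasure h2_area C' = emeasure h2_area C"
    unfolding C'_def by (rule h2_area_drefl[OF unitA]) (simp add: C_def)
  finally show ?thesis
    using angles by (simp add: C_def chamber_area' flip: ennreal_plus)
qed

text \<open>Every point reaches the closed chamber; if it misses the open one, it lies on one of the
  countably many images of the walls.\<close>

lemma walls_null:
  "emeasure h2_area (H2 - {z \<in> H2. \<exists>w. dact w z \<in> chamber uA uB uC}) = 0"
proof -
  define N where "N = (\<Union>w. \<Union>i. {z \<in> H2. mink (lift z) (act w (u i)) = 0})"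
  have "emeasure h2_area {z \<in> H2. mink (lift z) (act w (u i)) = 0} = 0" for w i
  proof (rule h2_area_line)
    have "mink (act w (u i)) (act w (u i)) = 1" by (simp add: B_act unit_u)
    then show "act w (u i) \<noteq> 0" by (auto simp: mink_def)
  qed
  then have "{z \<in> H2. mink (lift z) (act w (u i)) = 0} \<in> null_sets h2_area" for w i
    by (intro null_setsI) auto
  then have N: "N \<in> null_sets h2_area" unfolding N_def by (intro null_sets_UN) auto
  have "H2 - {z \<in> H2. \<exists>w. dact w z \<in> chamber uA uB uC} \<subseteq> N"
  proof
    fix z assume z: "z \<in> H2 - {z \<in> H2. \<exists>w. dact w z \<in> chamber uA uB uC}"
    then have z': "z \<in> H2" by simp
    obtain w where w: "dact w z \<in> closed_chamber" using chamber_covers[OF z'] by blast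
    have "dact w z \<notin> chamber uA uB uC" using z by blast
    then have "\<not> (\<forall>i. mink (lift (dact w z)) (u i) < 0)" using w by (simp add: chamber_iff)
    then obtain i where "\<not> mink (lift (dact w z)) (u i) < 0" by blast
    moreover have "mink (lift (dact w z)) (u i) \<le> 0" using w by blast
    ultimately have "mink (lift (dact w z)) (u i) = 0" by linarith
    then have "mink (lift z) (act (rev w) (u i)) = 0"
      using B_act[of "rev w" "act w (lift z)" "u i"] z' by (simp add: lift_dact)
    then show "z \<in> N" using z' by (auto simp: N_def)
  qed
  moreover have "{z \<in> H2. \<exists>w. dact w z \<in> chamber uA uB uC} \<in> sets borel"
  proof -
    have "(\<Union>w. {z \<in> H2. dact w z \<in> chamber uA uB uC}) \<in> sets borel"
      by (intro sets.countable_UN'') auto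
    also have "(\<Union>w. {z \<in> H2. dact w z \<in> chamber uA uB uC}) = {z \<in> H2. \<exists>w. dact w z \<in> chamber uA uB uC}" by auto
    finally show ?thesis .
  qed
  ultimately have "H2 - {z \<in> H2. \<exists>w. dact w z \<in> chamber uA uB uC} \<in> null_sets h2_area"
    by (intro null_sets_subset[OF N]) auto
  then show ?thesis by (rule null_setsD1)
qed

text \<open>Translates of D overlap on bisectors, so the comparison with the double chamber is made
  for the strict cell D0, which has disjoint translates and differs from D by a null set.\<close>

theorem dirichlet_area:
  assumes k: "k \<in> H2" and stab: "\<And>f. f \<in> E \<Longrightarrow> f (lift k) = lift k \<Longrightarrow> f = id"
  defines "D \<equiv> {z \<in> H2. \<forall>f\<in>E. mink (lift z) (f (lift k)) \<le> mink (lift z) (lift k)}"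
  shows "D \<in> sets borel" "emeasure h2_area D = ennreal (pi - 2 * \<beta> - 2 * \<gamma>)"
proof -
  define D0 where "D0 = {z \<in> H2. \<forall>f\<in>E - {id}. mink (lift z) (f (lift k)) < mink (lift z) (lift k)}"
  have "H2 \<inter> (\<Inter>f\<in>E. {z. mink (lift z) (f (lift k)) \<le> mink (lift z) (lift k)}) \<in> sets borel"
    by (intro sets.Int sets.countable_INT'' countable_E) auto
  also have "H2 \<inter> (\<Inter>f\<in>E. {z. mink (lift z) (f (lift k)) \<le> mink (lift z) (lift k)}) = D"
    by (auto simp: D_def)
  finally show D: "D \<in> sets borel" .
  have "H2 \<inter> (\<Inter>f\<in>E - {id}. {z. mink (lift z) (f (lift k)) < mink (lift z) (lift k)}) \<in> sets borel"
    by (intro sets.Int sets.countable_INT'' countable_Diff countable_E) auto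
  also have "H2 \<inter> (\<Inter>f\<in>E - {id}. {z. mink (lift z) (f (lift k)) < mink (lift z) (lift k)}) = D0"
    by (auto simp: D0_def)
  finally have D0: "D0 \<in> sets borel" .
  \<comment> \<open>The bisectors of all pairs of orbit points of k, countably many lines.\<close>
  define N where "N = (\<Union>f\<in>E. \<Union>g\<in>E - {f}. {z \<in> H2. mink (lift z) (g (lift k) - f (lift k)) = 0})"
  have inj: "g = f" if "f \<in> E" "g \<in> E" "g (lift k) = f (lift k)" for f g
  proof -
    have "(finv f \<circ> g) (lift k) = lift k" using that E_inv_comp by simp
    then have "finv f \<circ> g = id" using stab comp_E inv_E that by blast
    then have "f ((finv f \<circ> g) x) = f x" for x by simp
    then have "g x = f x" for x
      using E_inv_comp(2)[OF that(1), of "g x"] by simp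
    then show ?thesis by (rule ext)
  qed
  have N: "N \<in> null_sets h2_area"
    unfolding N_def
  proof (intro null_sets_UN' countable_E countable_Diff)
    fix f g assume "f \<in> E" "g \<in> E - {f}"
    then have "g (lift k) - f (lift k) \<noteq> 0" using inj by auto
    from h2_area_line[OF this] show "{z \<in> H2. mink (lift z) (g (lift k) - f (lift k)) = 0} \<in> null_sets h2_area"
      by (intro null_setsI) auto
  qed
  have "D - D0 \<subseteq> N"
  proof
    fix z assume z: "z \<in> D - D0"
    then obtain f where "f \<in> E" "f \<noteq> id" "mink (lift z) (f (lift k)) = mink (lift z) (lift k)"
      by (auto simp: D_def D0_def not_less intro: antisym)
    then have "z \<in> {z \<in> H2. mink (lift z) (f (lift k) - id (lift k)) = 0}" "f \<in> E - {id}"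
      using z by (auto simp: D_def mink_diff2)
    then show "z \<in> N" unfolding N_def using id_E by blast
  qed
  then have "D - D0 \<in> null_sets h2_area" using D D0 by (intro null_sets_subset[OF N]) auto
  then have "emeasure h2_area (D - (D - D0)) = emeasure h2_area D" using D by (intro emeasure_Diff_null_set) auto
  moreover have "D0 \<subseteq> D"
  proof
    fix z assume z: "z \<in> D0"
    have "mink (lift z) (f (lift k)) \<le> mink (lift z) (lift k)" if "f \<in> E" for f
      using z that by (cases "f = id") (auto simp: D0_def less_imp_le)
    then show "z \<in> D" using z by (simp add: D_def D0_def)
  qed
  then have "D - (D - D0) = D0" by blast
  ultimately have DD0: "emeasure h2_area D = emeasure h2_area D0" by simp
  \<comment> \<open>The preimage of D0 under f is the strict cell of the orbit point belonging to
    the inverse of f.\<close>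
  have near: "unlift (f (lift z)) \<in> D0 \<longleftrightarrow> (\<forall>g\<in>E - {finv f}. mink (lift z) (g (lift k)) < mink (lift z) (finv f (lift k)))"
    if f: "f \<in> E" and z: "z \<in> H2" for f z
  proof -
    have "unlift (f (lift z)) \<in> D0 \<longleftrightarrow> (\<forall>h\<in>E - {id}. mink (lift z) (finv f (h (lift k))) < mink (lift z) (finv f (lift k)))"
      using lift_E[OF f z] by (simp add: D0_def mink_E_inv[OF f])
    also have "\<dots> \<longleftrightarrow> (\<forall>g\<in>E - {finv f}. mink (lift z) (g (lift k)) < mink (lift z) (finv f (lift k)))"
    proof (intro iffI ballI)
      fix g assume *: "\<forall>h\<in>E - {id}. mink (lift z) (finv f (h (lift k))) < mink (lift z) (finv f (lift k))" and g: "g \<in> E - {finv f}"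
      have "f \<circ> g \<noteq> id"
      proof
        assume "f \<circ> g = id"
        then have "finv f ((f \<circ> g) x) = finv f x" for x by simp
        then have "g x = finv f x" for x using E_inv_comp(1)[OF f, of "g x"] by simp
        then have "g = finv f" by (rule ext)
        with g show False by simp
      qed
      then show "mink (lift z) (g (lift k)) < mink (lift z) (finv f (lift k))"
        using *[rule_format, of "f \<circ> g"] comp_E[OF f, of g] g E_inv_comp(1)[OF f] by simp
    next
      fix h assume *: "\<forall>g\<in>E - {finv f}. mink (lift z) (g (lift k)) < mink (lift z) (finv f (lift k))" and h: "h \<in> E - {id}"
      have "finv f \<circ> h \<noteq> finv f"
      proof
        assume "finv f \<circ> h = finv f"
        then have "f ((finv f \<circ> h) x) = f (finv f x)" for x by simp
        then have "h x = x" for x using E_inv_comp(2)[OF f] by simp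
        then have "h = id" by (simp add: fun_eq_iff del: split_paired_All)
        with h show False by simp
      qed
      then show "mink (lift z) (finv f (h (lift k))) < mink (lift z) (finv f (lift k))"
        using *[rule_format, of "finv f \<circ> h"] comp_E[OF inv_E[OF f], of h] h by simp
    qed
    finally show ?thesis .
  qed
  have "emeasure h2_area D0 = emeasure h2_area double_chamber"
  proof (rule emeasure_fundamental_domains[where I = E and \<Omega> = H2 and \<phi> = "\<lambda>f z. unlift (f (lift z))" and \<iota> = finv])
    show "{z \<in> H2. unlift (f (lift z)) \<in> X} \<in> sets h2_area" if fX: "f \<in> E" "X \<in> sets h2_area" for f X
    proof -
      have [measurable]: "X \<in> sets borel" using that by simp
      obtain w where "f = act w" using fX(1) by (auto simp: E_def)
      then have "{z \<in> H2. unlift (f (lift z)) \<in> X} = {z \<in> H2. dact w z \<in> X}" by (auto simp: unlift_act)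
      then show ?thesis by simp
    qed
    show "emeasure h2_area {z \<in> H2. unlift (f (lift z)) \<in> X} = emeasure h2_area X"
      if fX: "f \<in> E" "X \<in> sets h2_area" "X \<subseteq> H2" for f X
    proof -
      obtain w where "f = act w" using fX(1) by (auto simp: E_def)
      then have "{z \<in> H2. unlift (f (lift z)) \<in> X} = {z \<in> H2. dact w z \<in> X}" by (auto simp: unlift_act)
      then show ?thesis using that h2_area_dact by simp
    qed
    show "unlift (f (lift z)) \<in> H2" if "f \<in> E" "z \<in> H2" for f z
      using lift_E that by blast
    show "unlift (f (lift (unlift (finv f (lift z))))) = z" if "f \<in> E" "z \<in> H2" for f z
      using lift_E[OF inv_E[OF that(1)] that(2)] E_inv_comp[OF that(1)] that by simp
    show "D0 \<subseteq> H2" "double_chamber \<subseteq> H2" by (auto simp: D0_def double_chamber_def)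
    show "f = g" if "f \<in> E" "g \<in> E" "z \<in> H2" "unlift (f (lift z)) \<in> D0" "unlift (g (lift z)) \<in> D0" for f g z
    proof (rule ccontr)
      assume "f \<noteq> g"
      then have ne: "finv f \<noteq> finv g" using inv_inv_E[OF that(1)] inv_inv_E[OF that(2)] by auto
      have "mink (lift z) (finv g (lift k)) < mink (lift z) (finv f (lift k))"
        using near[OF that(1,3), THEN iffD1, OF that(4)] by (rule bspec) (use inv_E[OF that(2)] ne in simp)
      moreover have "mink (lift z) (finv f (lift k)) < mink (lift z) (finv g (lift k))"
        using near[OF that(2,3), THEN iffD1, OF that(5)] by (rule bspec) (use inv_E[OF that(1)] ne in simp)
      ultimately show False by simp
    qed
    show "f = g" if fg: "f \<in> E" "g \<in> E" "z \<in> H2" "unlift (f (lift z)) \<in> double_chamber" "unlift (g (lift z)) \<in> double_chamber" for f g z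
    proof -
      obtain v w where v: "f = act v" "even (length v)" and w: "g = act w" "even (length w)"
        using fg by (auto simp: E_def)
      \<comment> \<open>The letter \<open>SA\<close> undoes the mirror half of the double chamber.
        Since v and w are even, parity shows that it is used for both or for neither.\<close>
      have ex: "\<exists>x\<in>{[], [SA]}. dact (x @ v) z \<in> chamber uA uB uC" if "unlift (act v (lift z)) \<in> double_chamber" for v
        using that fg(3) by (auto simp: unlift_act double_chamber_def)
      obtain x where x: "x \<in> {[], [SA]}" "dact (x @ v) z \<in> chamber uA uB uC" using ex[OF fg(4)[unfolded v(1)]] by blast
      obtain y where y: "y \<in> {[], [SA]}" "dact (y @ w) z \<in> chamber uA uB uC" using ex[OF fg(5)[unfolded w(1)]] by blast
      have "dact ((x @ v) @ rev (y @ w)) (dact (y @ w) z) = dact (x @ v) z"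
        using dact_rev(1)[OF fg(3), of "y @ w"] unfolding dact_append[of "x @ v" "rev (y @ w)"] by simp
      then have "act ((x @ v) @ rev (y @ w)) = id"
        using chamber_disjoint[OF y(2), of "(x @ v) @ rev (y @ w)"] x(2) by simp
      then have one: "act (x @ v) (act (rev (y @ w)) t) = t" for t by (metis foldr_append comp_apply id_apply)
      have eq: "act (x @ v) = act (y @ w)"
      proof
        fix t
        show "act (x @ v) t = act (y @ w) t" using one[of "act (y @ w) t"] by (simp only: act_rev)
      qed
      have xy: "x = y" using act_parity[OF eq] x(1) y(1) v w by auto
      show "f = g"
      proof
        fix t
        have "act (rev x) (act (x @ v) t) = act (rev x) (act (x @ w) t)" using eq xy by simp
        then show "f t = g t" by (simp add: v w)
      qed
    qed
    have "H2 - (\<Union>f\<in>E. {z \<in> H2. unlift (f (lift z)) \<in> D0}) \<subseteq> N"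
    proof
      fix z assume z: "z \<in> H2 - (\<Union>f\<in>E. {z \<in> H2. unlift (f (lift z)) \<in> D0})"
      obtain f where f: "f \<in> E" "\<And>g. g \<in> E \<Longrightarrow> mink (lift z) (g (lift k)) \<le> mink (lift z) (f (lift k))"
        using nearest_exists[OF E_subset _ _ k, of z] id_E z by blast
      have "unlift (finv f (lift z)) \<notin> D0" using z inv_E[OF f(1)] by blast
      then have "\<not> (\<forall>g\<in>E - {f}. mink (lift z) (g (lift k)) < mink (lift z) (f (lift k)))"
        using near[OF inv_E[OF f(1)], of z] z inv_inv_E[OF f(1)] by simp
      then obtain g where "g \<in> E" "g \<noteq> f" "mink (lift z) (f (lift k)) \<le> mink (lift z) (g (lift k))"
        unfolding not_less[symmetric] by blast
      then have "z \<in> {z \<in> H2. mink (lift z) (g (lift k) - f (lift k)) = 0}" "g \<in> E - {f}"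
        using z f(2)[of g] by (auto simp: mink_diff2)
      then show "z \<in> N" unfolding N_def using f(1) by blast
    qed
    moreover have "(\<Union>f\<in>E. {z \<in> H2. unlift (f (lift z)) \<in> D0}) \<in> sets borel"
    proof (intro sets.countable_UN'' countable_E)
      fix f assume "f \<in> E"
      then obtain w where "f = act w" by (auto simp: E_def)
      then have "{z \<in> H2. unlift (f (lift z)) \<in> D0} = {z \<in> H2. dact w z \<in> D0}" by (auto simp: unlift_act)
      moreover have "{z \<in> H2. dact w z \<in> D0} \<in> sets borel" using D0 by measurable
      ultimately show "{z \<in> H2. unlift (f (lift z)) \<in> D0} \<in> sets borel" by simp
    qed
    ultimately have "H2 - (\<Union>f\<in>E. {z \<in> H2. unlift (f (lift z)) \<in> D0}) \<in> null_sets h2_area"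
      by (intro null_sets_subset[OF N]) auto
    then show "emeasure h2_area (H2 - (\<Union>f\<in>E. {z \<in> H2. unlift (f (lift z)) \<in> D0})) = 0"
      by (rule null_setsD1)
    have "(\<Union>f\<in>E. {z \<in> H2. unlift (f (lift z)) \<in> double_chamber}) = {z \<in> H2. \<exists>w. dact w z \<in> chamber uA uB uC}"
    proof (intro equalityI subsetI)
      fix z assume "z \<in> {z \<in> H2. \<exists>w. dact w z \<in> chamber uA uB uC}"
      then obtain w where z: "z \<in> H2" and w: "dact w z \<in> chamber uA uB uC" by auto
      show "z \<in> (\<Union>f\<in>E. {z \<in> H2. unlift (f (lift z)) \<in> double_chamber})"
      proof (cases "even (length w)")
        case True
        then show ?thesis
          using z w dact_H2[OF z, of w] unlift_act[OF z, of w] E_actI[of w]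
          by (intro UN_I[of "act w"]) (auto simp: double_chamber_def)
      next
        case False
        have "drefl uA (dact (SA # w) z) = dact w z"
          using drefl_drefl[OF unitA dact_H2[OF z, of w]] by simp
        then show ?thesis
          using z w False dact_H2[OF z, of "SA # w"] unlift_act[OF z, of "SA # w"] E_actI[of "SA # w"]
          by (intro UN_I[of "act (SA # w)"]) (auto simp: double_chamber_def)
      qed
    next
      fix z assume "z \<in> (\<Union>f\<in>E. {z \<in> H2. unlift (f (lift z)) \<in> double_chamber})"
      then obtain w where z: "z \<in> H2" "dact w z \<in> double_chamber" by (auto simp: E_def unlift_act)
      then have "dact w z \<in> chamber uA uB uC \<or> dact (SA # w) z \<in> chamber uA uB uC"
        by (auto simp: double_chamber_def)
      then show "z \<in> {z \<in> H2. \<exists>w. dact w z \<in> chamber uA uB uC}" using z by blast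
    qed
    then show "emeasure h2_area (H2 - (\<Union>f\<in>E. {z \<in> H2. unlift (f (lift z)) \<in> double_chamber})) = 0"
      using walls_null by simp
  qed (use D0 in \<open>auto simp: countable_E inv_E inv_inv_E\<close>)
  then show "emeasure h2_area D = ennreal (pi - 2 * \<beta> - 2 * \<gamma>)"
    by (simp add: DD0 double_chamber_area)
qed

section \<open>The group generated by the rotations\<close>

definition rot :: "side list \<Rightarrow> complex \<Rightarrow> complex" where
  "rot w = (\<lambda>z\<in>H2. dact w z)"

definition rotation_group :: "(complex \<Rightarrow> complex) set" where
  "rotation_group = rot ` {w. even (length w)}"

lemma rot_Bij: "rot w \<in> carrier (BijGroup H2)"
proof -
  have "bij_betw (dact w) H2 H2"
    by (rule bij_betw_byWitness[of _ "dact (rev w)"]) (auto simp: dact_rev dact_H2)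
  then show ?thesis
    by (auto simp: BijGroup_def Bij_def rot_def bij_betw_restrict_eq)
qed

lemma rot_mult: "rot v \<otimes>\<^bsub>BijGroup H2\<^esub> rot w = rot (v @ w)"
proof -
  have "rot v \<otimes>\<^bsub>BijGroup H2\<^esub> rot w = compose H2 (rot v) (rot w)"
    using rot_Bij[of v] rot_Bij[of w] by (simp add: BijGroup_def)
  also have "\<dots> = rot (v @ w)"
    by (auto simp: compose_def rot_def dact_H2 fun_eq_iff)
  finally show ?thesis .
qed

lemma rot_one: "\<one>\<^bsub>BijGroup H2\<^esub> = rot []"
  by (simp add: BijGroup_def rot_def)

lemma rot_cong: "(\<And>z. z \<in> H2 \<Longrightarrow> dact v z = dact w z) \<Longrightarrow> rot v = rot w"
  by (auto simp: rot_def)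

lemma rot_inv: "inv\<^bsub>BijGroup H2\<^esub> (rot w) = rot (rev w)"
proof (rule group.inv_equality[OF group_BijGroup _ rot_Bij rot_Bij])
  show "rot (rev w) \<otimes>\<^bsub>BijGroup H2\<^esub> rot w = \<one>\<^bsub>BijGroup H2\<^esub>"
    unfolding rot_mult rot_one by (rule rot_cong) (simp add: dact_rev)
qed

lemma drefl_twice: "z \<in> H2 \<Longrightarrow> drefl (u i) (drefl (u i) z) = z"
  by (rule drefl_drefl[OF unit_u])

lemma generate_rotation_group:
  assumes g0: "g0 = rot [SC, SB] \<or> g0 = rot [SB, SC]" and g1: "g1 = rot [SC, SA] \<or> g1 = rot [SA, SC]"
  shows "generate (BijGroup H2) {g0, g1} = rotation_group"
proof
  show "generate (BijGroup H2) {g0, g1} \<subseteq> rotation_group"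
  proof
    fix g assume "g \<in> generate (BijGroup H2) {g0, g1}"
    then show "g \<in> rotation_group"
    proof induction
      case one
      show ?case unfolding rot_one rotation_group_def by (rule imageI) simp
    next
      case (incl h)
      then have "h \<in> {rot [SC, SB], rot [SB, SC], rot [SC, SA], rot [SA, SC]}" using g0 g1 by auto
      then show ?case unfolding rotation_group_def by (elim insertE) (auto intro!: imageI)
    next
      case (inv h)
      then have "h \<in> {rot [SC, SB], rot [SB, SC], rot [SC, SA], rot [SA, SC]}" using g0 g1 by auto
      then have "inv\<^bsub>BijGroup H2\<^esub> h \<in> {rot [SB, SC], rot [SC, SB], rot [SA, SC], rot [SC, SA]}"
        by (elim insertE) (auto simp: rot_inv)
      then show ?case unfolding rotation_group_def by (elim insertE) (auto intro!: imageI)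
    next
      case (eng h1 h2)
      then obtain v w where "h1 = rot v" "h2 = rot w" "even (length v)" "even (length w)"
        by (auto simp: rotation_group_def)
      then show ?case unfolding rotation_group_def by (auto simp: rot_mult intro!: imageI)
    qed
  qed
next
  let ?G = "generate (BijGroup H2) {g0, g1}"
  have mult: "rot (v @ w) \<in> ?G" if "rot v \<in> ?G" "rot w \<in> ?G" for v w
    using generate.eng[OF that] by (simp add: rot_mult)
  have "inv\<^bsub>BijGroup H2\<^esub> g0 \<in> ?G" "inv\<^bsub>BijGroup H2\<^esub> g1 \<in> ?G" "g0 \<in> ?G" "g1 \<in> ?G"
    by (auto intro: generate.inv generate.incl)
  then have gens: "rot [SC, SB] \<in> ?G" "rot [SB, SC] \<in> ?G" "rot [SC, SA] \<in> ?G" "rot [SA, SC] \<in> ?G"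
    using g0 g1 by (auto simp: rot_inv)
  have "rot [SA, SC, SC, SB] \<in> ?G" "rot [SB, SC, SC, SA] \<in> ?G"
    using mult[OF gens(4,1)] mult[OF gens(2,3)] by simp_all
  moreover have "rot [SA, SC, SC, SB] = rot [SA, SB]" "rot [SB, SC, SC, SA] = rot [SB, SA]"
    by (rule rot_cong; simp add: drefl_twice[of _ SC, simplified] drefl_H2 unitA unitB)+
  ultimately have gens2: "rot [SA, SB] \<in> ?G" "rot [SB, SA] \<in> ?G" by simp_all
  have one: "rot [] \<in> ?G" using generate.one[of "BijGroup H2" "{g0, g1}"] by (simp add: rot_one)
  have two: "rot [i, j] \<in> ?G" for i j
  proof (cases "i = j")
    case True
    have "rot [i, i] = rot []" by (rule rot_cong) (simp add: drefl_twice)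
    then show ?thesis using one True by simp
  next
    case False
    then show ?thesis using gens gens2 by (cases i; cases j) simp_all
  qed
  have "rot w \<in> ?G" if "even (length w)" for w
    using that
  proof (induction w rule: induct_list012)
    case (3 i j w)
    then show ?case using mult[OF two[of i j], of w] by simp
  qed (use one in auto)
  then show "rotation_group \<subseteq> ?G" by (auto simp: rotation_group_def)
qed

end

text \<open>Whatever triangle and senses are chosen, the group is the even part of a reflection
  group: a rotation about A or B is a product of the two mirrors through that vertex, by twice their
  angle.\<close>

lemma triangle_rotation_group_cases:
  assumes "admissible p1 p2" "triangle_rotation_group p1 p2 G"
  obtains uA uB uC A B where "hyp_triangle uA uB uC p1 p2 A B" "G = hyp_triangle.rotation_group uA uB uC"
proof -
  obtain A B C s s' where tri: "h2_triangle A B C (pi / 2) (pi / real p1) (pi / real p2)"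
    and s: "s \<in> {1, -1::real}"
    and G: "G = generate (BijGroup H2) {h2_rotation A pi, h2_rotation B (s * (2 * pi / real p1))}"
    using assms(2) unfolding triangle_rotation_group_def by blast
  obtain uA uB uC where u: "mink uA uA = 1" "mink uB uB = 1" "mink uC uC = 1"
    "mink uB uC = 0" "mink uA uC = - cos (pi / real p1)" "mink uA uB = - cos (pi / real p2)"
    "mink (lift A) uA < 0" "mink (lift A) uB = 0" "mink (lift A) uC = 0"
    "mink (lift B) uA = 0" "mink (lift B) uC = 0" "mink (lift B) uB < 0"
    using triangle_normals[OF tri] by metis
  have H: "A \<in> H2" "B \<in> H2" using tri by (auto simp: h2_triangle_def)
  interpret hyp_triangle uA uB uC p1 p2 A B
    using assms(1) u H by unfold_locales (auto simp: admissible_def)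
  have "h2_rotation A (1 * (2 * (pi / 2))) = (\<lambda>z\<in>H2. drefl uC (drefl uB z)) \<or>
      h2_rotation A (1 * (2 * (pi / 2))) = (\<lambda>z\<in>H2. drefl uB (drefl uC z))"
    by (rule two_reflections) (use u H in \<open>auto simp: mink_sym[of uC uB]\<close>)
  then have g0: "h2_rotation A pi = rot [SC, SB] \<or> h2_rotation A pi = rot [SB, SC]"
    by (simp add: rot_def)
  have "h2_rotation B (s * (2 * (pi / real p1))) = (\<lambda>z\<in>H2. drefl uC (drefl uA z)) \<or>
      h2_rotation B (s * (2 * (pi / real p1))) = (\<lambda>z\<in>H2. drefl uA (drefl uC z))"
    by (rule two_reflections) (use u H s in \<open>auto simp: mink_sym[of uC uA]\<close>)
  then have g1: "h2_rotation B (s * (2 * pi / real p1)) = rot [SC, SA] \<or> h2_rotation B (s * (2 * pi / real p1)) = rot [SA, SC]"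
    by (simp add: rot_def)
  have "G = rotation_group"
    unfolding G by (rule generate_rotation_group[OF g0 g1])
  then show thesis using that[of uA uB uC A B] hyp_triangle_axioms by blast
qed

section \<open>Volume in the product space\<close>

lemma emeasure_h2r_vol:
  assumes Y: "Y \<in> sets borel"
  shows "emeasure h2r_vol Y = (\<integral>\<^sup>+t. emeasure h2_area {z. (z, t) \<in> Y} \<partial>lborel)"
proof -
  have [measurable]: "Y \<in> sets (borel \<Otimes>\<^sub>M borel)" using Y unfolding borel_prod .
  define w where "w = (\<lambda>z. ennreal (4 / (1 - (cmod z)\<^sup>2)\<^sup>2) * indicator H2 z)"
  have [measurable]: "w \<in> borel_measurable borel" unfolding w_def by measurable
  have m: "(\<lambda>(z, t). w z * indicator Y (z, t)) \<in> borel_measurable (lborel \<Otimes>\<^sub>M lborel)" by measurable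
  have wd: "(\<lambda>X. ennreal (4 / (1 - (cmod (fst X))\<^sup>2)\<^sup>2) * indicator H2R X) = (\<lambda>X. w (fst X))"
    by (auto simp: w_def H2R_def fun_eq_iff split: split_indicator)
  have "emeasure h2r_vol Y = (\<integral>\<^sup>+X. w (fst X) * indicator Y X \<partial>lborel)"
    unfolding h2r_vol_def wd
  proof (rule emeasure_density)
    have "(\<lambda>X. w (fst X)) \<in> borel_measurable (borel \<Otimes>\<^sub>M borel :: (complex \<times> real) measure)" by measurable
    then show "(\<lambda>X. w (fst X)) \<in> borel_measurable (lborel :: (complex \<times> real) measure)" unfolding borel_prod by simp
  qed (use Y in simp)
  also have "\<dots> = (\<integral>\<^sup>+X. (case X of (z, t) \<Rightarrow> w z * indicator Y (z, t)) \<partial>(lborel \<Otimes>\<^sub>M lborel))"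
    unfolding lborel_prod by (auto intro!: nn_integral_cong)
  also have "\<dots> = (\<integral>\<^sup>+t. (\<integral>\<^sup>+z. w z * indicator Y (z, t) \<partial>lborel) \<partial>lborel)"
    using lborel_pair.nn_integral_snd[OF m] by simp
  also have "\<dots> = (\<integral>\<^sup>+t. emeasure h2_area {z. (z, t) \<in> Y} \<partial>lborel)"
  proof (intro nn_integral_cong)
    fix t :: real
    have "{z. (z, t) \<in> Y} \<in> sets borel" by measurable
    then show "(\<integral>\<^sup>+z. w z * indicator Y (z, t) \<partial>lborel) = emeasure h2_area {z. (z, t) \<in> Y}"
      unfolding h2_area_def w_def[symmetric]
      by (subst emeasure_density) (auto intro!: nn_integral_cong split: split_indicator)
  qed
  finally show ?thesis .
qed

lemma emeasure_h2r_vol_Times: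
  assumes "S \<in> sets borel" "T \<in> sets borel"
  shows "emeasure h2r_vol (S \<times> T) = emeasure h2_area S * emeasure lborel T"
proof -
  have "S \<times> T \<in> sets (borel \<Otimes>\<^sub>M borel)" using assms by (rule pair_measureI)
  then have "S \<times> T \<in> sets borel" unfolding borel_prod .
  then have "emeasure h2r_vol (S \<times> T) = (\<integral>\<^sup>+t. emeasure h2_area {z. (z, t) \<in> S \<times> T} \<partial>lborel)"
    by (rule emeasure_h2r_vol)
  also have "\<dots> = (\<integral>\<^sup>+t. emeasure h2_area S * indicator T t \<partial>lborel)"
    by (intro nn_integral_cong) (auto split: split_indicator)
  finally show ?thesis using assms by (simp add: nn_integral_cmult_indicator)
qed

lemma borel_measurable_cosh [measurable]: "(cosh :: real \<Rightarrow> real) \<in> borel_measurable borel"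
  by (intro borel_measurable_continuous_onI continuous_intros)

text \<open>The slice of a ball at relative height s is a hyperbolic disc of radius \<rho> sqrt (1 -
  s^2). With heights scaled to [-1, 1], monotonicity in \<rho> holds already for the
  integrand.\<close>

definition ball_profile :: "real \<Rightarrow> real" where
  "ball_profile \<rho> = integral {-1..1} (\<lambda>s. cosh (\<rho> * sqrt (1 - s\<^sup>2)) - 1)"

lemma ball_profile_integrable: "(\<lambda>s. cosh (\<rho> * sqrt (1 - s\<^sup>2)) - 1) integrable_on {-1..1}"
  by (intro integrable_continuous_real continuous_intros)

lemma ball_profile_mono: "0 \<le> \<rho> \<Longrightarrow> \<rho> \<le> \<sigma> \<Longrightarrow> ball_profile \<rho> \<le> ball_profile \<sigma>"
  unfolding ball_profile_def
  by (intro integral_le ball_profile_integrable diff_right_mono)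
    (auto simp: cosh_real_nonneg_le_iff abs_square_le_1 intro!: mult_right_mono)

lemma ball_profile_nonneg: "0 \<le> ball_profile \<rho>"
  unfolding ball_profile_def by (intro integral_nonneg ball_profile_integrable) (simp add: cosh_real_ge_1)

lemma geodesic_ball_volume:
  assumes K: "K \<in> H2R" and \<rho>: "0 \<le> \<rho>"
  shows "measure h2r_vol (geodesic_ball K \<rho>) = 2 * pi * \<rho> * ball_profile \<rho>"
proof (cases "\<rho> = 0")
  case True
  obtain k \<tau> where K': "K = (k, \<tau>)" "k \<in> H2" using K by (auto simp: H2R_def)
  have "geodesic_ball K \<rho> \<subseteq> {K}"
  proof
    fix X assume "X \<in> geodesic_ball K \<rho>"
    then have X: "fst X \<in> H2" "sqrt ((h2_dist k (fst X))\<^sup>2 + (\<tau> - snd X)\<^sup>2) \<le> 0"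
      by (auto simp: geodesic_ball_def True h2r_dist_def K' H2R_def)
    then have "h2_dist k (fst X) = 0" "\<tau> = snd X"
      by (auto simp: sum_power2_le_zero_iff)
    then show "X \<in> {K}" using h2_dist_eq_0_iff[OF K'(2) X(1)] by (auto simp: K' prod_eq_iff)
  qed
  moreover have "K \<in> geodesic_ball K \<rho>"
    using K' h2_dist_eq_0_iff[OF K'(2,2)] by (simp add: geodesic_ball_def True h2r_dist_def H2R_def)
  ultimately have "geodesic_ball K \<rho> = {k} \<times> {\<tau>}" using K' by auto
  moreover have "emeasure h2r_vol ({k} \<times> {\<tau>}) = 0" by (subst emeasure_h2r_vol_Times) auto
  ultimately show ?thesis unfolding measure_def True by simp
next
  case False
  then have \<rho>0: "0 < \<rho>" using \<rho> by simp
  obtain k \<tau> where K': "K = (k, \<tau>)" "k \<in> H2" using K by (auto simp: H2R_def)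
  define R where "R = (\<lambda>t. sqrt (\<rho>\<^sup>2 - (t - \<tau>)\<^sup>2))"
  have Rm [measurable]: "R \<in> borel_measurable borel" unfolding R_def by measurable
  have mem: "(z, t) \<in> geodesic_ball K \<rho> \<longleftrightarrow> z \<in> H2 \<and> \<bar>t - \<tau>\<bar> \<le> \<rho> \<and> h2_dist k z \<le> R t" for z t
  proof (cases "z \<in> H2")
    case True
    have d: "0 \<le> h2_dist k z" by (rule h2_dist_nonneg[OF K'(2) True])
    have "(z, t) \<in> geodesic_ball K \<rho> \<longleftrightarrow> (h2_dist k z)\<^sup>2 + (t - \<tau>)\<^sup>2 \<le> \<rho>\<^sup>2"
      using True real_sqrt_le_iff[of "(h2_dist k z)\<^sup>2 + (\<tau> - t)\<^sup>2" "\<rho>\<^sup>2"] \<rho>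
      by (simp add: geodesic_ball_def h2r_dist_def K' H2R_def power2_commute[of t])
    also have "\<dots> \<longleftrightarrow> (h2_dist k z)\<^sup>2 \<le> \<rho>\<^sup>2 - (t - \<tau>)\<^sup>2" by auto
    also have "\<dots> \<longleftrightarrow> \<bar>t - \<tau>\<bar> \<le> \<rho> \<and> h2_dist k z \<le> R t"
    proof
      assume *: "(h2_dist k z)\<^sup>2 \<le> \<rho>\<^sup>2 - (t - \<tau>)\<^sup>2"
      then have "(t - \<tau>)\<^sup>2 \<le> \<rho>\<^sup>2" using zero_le_power2[of "h2_dist k z"] by linarith
      then have "\<bar>t - \<tau>\<bar> \<le> \<rho>" using \<rho> by (metis abs_le_square_iff abs_of_nonneg)
      moreover have "h2_dist k z \<le> R t" unfolding R_def using * by (rule real_le_rsqrt)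
      ultimately show "\<bar>t - \<tau>\<bar> \<le> \<rho> \<and> h2_dist k z \<le> R t" by blast
    next
      assume *: "\<bar>t - \<tau>\<bar> \<le> \<rho> \<and> h2_dist k z \<le> R t"
      then have "(t - \<tau>)\<^sup>2 \<le> \<rho>\<^sup>2" using \<rho> by (metis abs_le_square_iff abs_of_nonneg)
      then have "(R t)\<^sup>2 = \<rho>\<^sup>2 - (t - \<tau>)\<^sup>2" by (simp add: R_def)
      moreover have "(h2_dist k z)\<^sup>2 \<le> (R t)\<^sup>2" using * d by (intro power_mono) auto
      ultimately show "(h2_dist k z)\<^sup>2 \<le> \<rho>\<^sup>2 - (t - \<tau>)\<^sup>2" by simp
    qed
    finally show ?thesis using True by simp
  qed (auto simp: geodesic_ball_def H2R_def)
  have R0: "0 \<le> R t" if "\<bar>t - \<tau>\<bar> \<le> \<rho>" for t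
    using power_mono[OF that, of 2] by (simp add: R_def)
  have meas: "geodesic_ball K \<rho> \<in> sets borel"
  proof -
    have [measurable]: "(\<lambda>X. mink (lift (fst X)) (lift k)) \<in> borel_measurable (borel \<Otimes>\<^sub>M (borel :: real measure))"
      by (rule measurable_compose[OF measurable_fst mink_lift_measurable])
    have "{X \<in> space (borel \<Otimes>\<^sub>M borel). fst X \<in> H2 \<and> \<bar>snd X - \<tau>\<bar> \<le> \<rho> \<and> - mink (lift (fst X)) (lift k) \<le> cosh (R (snd X))} \<in> sets (borel \<Otimes>\<^sub>M borel)"
      by measurable
    also have "{X \<in> space (borel \<Otimes>\<^sub>M borel). fst X \<in> H2 \<and> \<bar>snd X - \<tau>\<bar> \<le> \<rho> \<and> - mink (lift (fst X)) (lift k) \<le> cosh (R (snd X))} = geodesic_ball K \<rho>"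
      using mem h2_dist_le_cosh[OF K'(2) _ R0] by (auto simp: space_pair_measure)
    finally show ?thesis unfolding borel_prod .
  qed
  define f where "f = (\<lambda>s. if s \<in> {-1..1} then cosh (\<rho> * sqrt (1 - s\<^sup>2)) - 1 else 0)"
  have f0: "0 \<le> f s" for s by (simp add: f_def cosh_real_ge_1)
  have fm [measurable]: "f \<in> borel_measurable borel" unfolding f_def by measurable
  have "emeasure h2r_vol (geodesic_ball K \<rho>) = (\<integral>\<^sup>+t. emeasure h2_area {z. (z, t) \<in> geodesic_ball K \<rho>} \<partial>lborel)"
    by (rule emeasure_h2r_vol[OF meas])
  also have "\<dots> = (\<integral>\<^sup>+t. ennreal (2 * pi * (if \<bar>t - \<tau>\<bar> \<le> \<rho> then cosh (R t) - 1 else 0)) \<partial>lborel)"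
  proof (intro nn_integral_cong)
    fix t
    show "emeasure h2_area {z. (z, t) \<in> geodesic_ball K \<rho>} = ennreal (2 * pi * (if \<bar>t - \<tau>\<bar> \<le> \<rho> then cosh (R t) - 1 else 0))"
    proof (cases "\<bar>t - \<tau>\<bar> \<le> \<rho>")
      case True
      then have "{z. (z, t) \<in> geodesic_ball K \<rho>} = {z \<in> H2. h2_dist k z \<le> R t}" by (auto simp: mem)
      then show ?thesis using h2_disc_area[OF K'(2) R0[OF True]] True by simp
    qed (simp add: mem)
  qed
  \<comment> \<open>The substitution t = \<tau> + \<rho> s degenerates for \<rho> = 0, which is why
    that case stands apart.\<close>
  also have "\<dots> = ennreal \<rho> * (\<integral>\<^sup>+s. ennreal (2 * pi * (if \<bar>(\<tau> + \<rho> * s) - \<tau>\<bar> \<le> \<rho> then cosh (R (\<tau> + \<rho> * s)) - 1 else 0)) \<partial>lborel)"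
    using \<rho>0 by (subst nn_integral_real_affine[where c = \<rho> and t = \<tau>]) auto
  also have "\<dots> = ennreal \<rho> * (\<integral>\<^sup>+s. ennreal (2 * pi * f s) \<partial>lborel)"
  proof -
    have "(if \<bar>(\<tau> + \<rho> * s) - \<tau>\<bar> \<le> \<rho> then cosh (R (\<tau> + \<rho> * s)) - 1 else 0) = f s" for s
    proof -
      have "\<bar>(\<tau> + \<rho> * s) - \<tau>\<bar> \<le> \<rho> \<longleftrightarrow> s \<in> {-1..1}"
        using \<rho>0 by (auto simp: abs_mult abs_le_iff)
      moreover have "R (\<tau> + \<rho> * s) = \<rho> * sqrt (1 - s\<^sup>2)"
      proof -
        have "\<rho>\<^sup>2 - (\<rho> * s)\<^sup>2 = \<rho>\<^sup>2 * (1 - s\<^sup>2)" by (simp add: power_mult_distrib algebra_simps)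
        then show ?thesis using \<rho>0 by (simp add: R_def real_sqrt_mult)
      qed
      ultimately show ?thesis by (simp add: f_def)
    qed
    then show ?thesis by simp
  qed
  also have "(\<integral>\<^sup>+s. ennreal (2 * pi * f s) \<partial>lborel) = ennreal (2 * pi * ball_profile \<rho>)"
  proof (rule nn_integral_has_integral_lborel)
    have "((\<lambda>s. cosh (\<rho> * sqrt (1 - s\<^sup>2)) - 1) has_integral ball_profile \<rho>) {-1..1}"
      unfolding ball_profile_def by (rule integrable_integral[OF ball_profile_integrable])
    then have "(f has_integral ball_profile \<rho>) UNIV"
      unfolding f_def by (simp only: has_integral_restrict_UNIV)
    then show "((\<lambda>s. 2 * pi * f s) has_integral 2 * pi * ball_profile \<rho>) UNIV"
      by (rule has_integral_mult_right)
  qed (auto simp: f0)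
  also have "ennreal \<rho> * ennreal (2 * pi * ball_profile \<rho>) = ennreal (2 * pi * \<rho> * ball_profile \<rho>)"
    using \<rho> ball_profile_nonneg[of \<rho>] by (simp add: ennreal_mult[symmetric] algebra_simps)
  finally show ?thesis
    using \<rho> ball_profile_nonneg[of \<rho>] by (simp add: measure_def)
qed

section \<open>Displacement\<close>

text \<open>
  For a point of the closed chamber, \<open>P\<close>, \<open>Q\<close> and \<open>K = third_wall \<beta> \<gamma> P Q\<close> are the hyperbolic sines of its
  distances to the walls \<open>AB\<close>, \<open>CA\<close> and \<open>BC\<close>. The three terms of \<open>displacement\<close> are \<open>sinh\<^sup>2 (d / 2)\<close> for the
  distances \<open>d\<close> by which the rotations about \<open>A\<close>, \<open>B\<close> and \<open>C\<close> move it, and \<open>radius\<close> inverts \<open>\<rho> \<mapsto> sinh\<^sup>2 \<rho>\<close>.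
\<close>

definition third_wall :: "real \<Rightarrow> real \<Rightarrow> real \<Rightarrow> real \<Rightarrow> real" where
  "third_wall \<beta> \<gamma> P Q = sqrt ((cos \<beta>)\<^sup>2 + (cos \<gamma>)\<^sup>2 - 1) * sqrt (1 + P\<^sup>2 + Q\<^sup>2) - P * cos \<beta> - Q * cos \<gamma>"

definition displacement :: "real \<Rightarrow> real \<Rightarrow> real \<times> real \<Rightarrow> real" where
  "displacement \<beta> \<gamma> = (\<lambda>(P, Q). let K = third_wall \<beta> \<gamma> P Q in
     min (P\<^sup>2 + Q\<^sup>2) (min (K\<^sup>2 + P\<^sup>2 + 2 * K * P * cos \<beta>) (K\<^sup>2 + Q\<^sup>2 + 2 * K * Q * cos \<gamma>)))"

definition feasible :: "real \<Rightarrow> real \<Rightarrow> (real \<times> real) set" where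
  "feasible \<beta> \<gamma> = {(P, Q). 0 \<le> P \<and> 0 \<le> Q \<and> 0 \<le> third_wall \<beta> \<gamma> P Q}"

definition radius :: "real \<Rightarrow> real" where
  "radius S = arcosh (1 + 2 * S) / 2"

lemma arcosh_le_iff: "1 \<le> x \<Longrightarrow> 1 \<le> y \<Longrightarrow> arcosh x \<le> arcosh y \<longleftrightarrow> x \<le> (y::real)"
  by (simp add: not_less[symmetric])

lemma radius_mono: "0 \<le> S \<Longrightarrow> S \<le> T \<Longrightarrow> radius S \<le> radius T"
  by (simp add: radius_def arcosh_le_iff)

lemma radius_pos: "0 < S \<Longrightarrow> 0 < radius S"
  by (simp add: radius_def)

lemma h2_dist_radius:
  assumes "z \<in> H2" "w \<in> H2" "mink (lift z) (lift w) = - 1 - 2 * S"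
  shows "h2_dist z w = 2 * radius S"
  using assms by (simp add: h2_dist_mink radius_def add.commute)

lemma h2_dist_ge_radius:
  assumes "z \<in> H2" "w \<in> H2" "mink (lift z) (lift w) \<le> - 1 - 2 * S" "0 \<le> S"
  shows "2 * radius S \<le> h2_dist z w"
  using assms mink_lift_le[OF assms(1,2)] by (simp add: h2_dist_mink radius_def arcosh_le_iff)

locale acute_pair =
  fixes \<beta> \<gamma> :: real
  assumes acute: "0 < \<beta>" "0 < \<gamma>" "\<beta> + \<gamma> < pi / 2"
begin

text \<open>The trigonometric form of \<beta> + \<gamma> < pi / 2, by comparing sin \<gamma> with
  sin (pi / 2 - \<beta>).\<close>

lemma cos_sq_gt_1: "1 < (cos \<beta>)\<^sup>2 + (cos \<gamma>)\<^sup>2"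
proof -
  have "sin \<gamma> < sin (pi / 2 - \<beta>)" using acute by (intro sin_monotone_2pi) auto
  then have "sin \<gamma> < cos \<beta>" by (simp add: sin_diff)
  moreover have "0 \<le> sin \<gamma>" using acute by (intro sin_ge_zero) auto
  ultimately have "(sin \<gamma>)\<^sup>2 < (cos \<beta>)\<^sup>2" by (intro power_strict_mono) auto
  then show ?thesis by (simp add: sin_squared_eq)
qed

lemma cos_pos: "0 < cos \<beta>" "0 < cos \<gamma>"
  using acute by (auto intro!: cos_gt_zero)

end

sublocale hyp_triangle \<subseteq> acute_pair \<beta> \<gamma>
  by unfold_locales (use angles in auto)

context hyp_triangle
begin

text \<open>The hyperbolic sine of the distance from A to the side BC.\<close>

definition height :: real where
  "height = sqrt ((cos \<beta>)\<^sup>2 + (cos \<gamma>)\<^sup>2 - 1)"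

lemma gram_angles: "mink uA uC = - cos \<beta>" "mink uA uB = - cos \<gamma>"
  using gramAC gramAB by (simp_all add: \<beta>_def \<gamma>_def)

lemma A_expansion: "x = (- mink x (lift A)) *\<^sub>R lift A + mink x uB *\<^sub>R uB + mink x uC *\<^sub>R uC"
  by (rule orthonormal_expansion) (simp_all add: mink_lift_self A unitB unitC gramBC)

lemma mink_A_expansion:
  "mink x y = - mink x (lift A) * mink y (lift A) + mink x uB * mink y uB + mink x uC * mink y uC"
proof -
  have "mink x y = mink ((- mink x (lift A)) *\<^sub>R lift A + mink x uB *\<^sub>R uB + mink x uC *\<^sub>R uC) y"
    using A_expansion[of x] by simp
  also have "\<dots> = - mink x (lift A) * mink (lift A) y + mink x uB * mink uB y + mink x uC * mink uC y"
    by (simp only: mink_add mink_scale)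
  finally show ?thesis by (simp only: mink_sym[of y])
qed

lemma uA_height: "mink uA (lift A) = - height"
proof -
  have "1 = - (mink uA (lift A))\<^sup>2 + (cos \<gamma>)\<^sup>2 + (cos \<beta>)\<^sup>2"
    using mink_A_expansion[of uA uA] by (simp add: unitA gram_angles power2_eq_square)
  then have "(- mink uA (lift A))\<^sup>2 = (cos \<beta>)\<^sup>2 + (cos \<gamma>)\<^sup>2 - 1" by simp
  moreover have "0 \<le> - mink uA (lift A)" using A(2) by (simp add: mink_sym[of uA])
  ultimately have "sqrt ((cos \<beta>)\<^sup>2 + (cos \<gamma>)\<^sup>2 - 1) = - mink uA (lift A)" by (rule real_sqrt_unique)
  then show ?thesis by (simp add: height_def)
qed

text \<open>Because of the right angle, \<open>lift A\<close>, \<open>uB\<close>, \<open>uC\<close>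
  are an orthonormal basis. Two coordinates of a point are P and Q up to sign, and the hyperboloid
  equation makes the third sqrt (1 + P^2 + Q^2).\<close>

lemma third_wall_mink:
  assumes "z \<in> H2"
  shows "- mink (lift z) uA = third_wall \<beta> \<gamma> (- mink (lift z) uC) (- mink (lift z) uB)"
proof -
  define x where "x = lift z"
  have "mink x x = -1" using assms by (simp add: x_def mink_lift_self)
  then have "(- mink x (lift A))\<^sup>2 = 1 + (mink x uC)\<^sup>2 + (mink x uB)\<^sup>2"
    using mink_A_expansion[of x x] by (simp add: power2_eq_square)
  moreover have "0 \<le> - mink x (lift A)" using mink_lift_le[OF assms A(1)] by (simp add: x_def)
  ultimately have "sqrt (1 + (mink x uC)\<^sup>2 + (mink x uB)\<^sup>2) = - mink x (lift A)" by (rule real_sqrt_unique)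
  moreover have "- mink x uA = height * - mink x (lift A) + mink x uB * cos \<gamma> + mink x uC * cos \<beta>"
    using mink_A_expansion[of x uA] by (simp add: uA_height gram_angles)
  ultimately show ?thesis by (simp add: third_wall_def height_def x_def)
qed

lemma realize_coordinates:
  obtains z where "z \<in> H2" "- mink (lift z) uC = P" "- mink (lift z) uB = Q"
proof -
  define k where "k = sqrt (1 + P\<^sup>2 + Q\<^sup>2)"
  have k: "k\<^sup>2 = 1 + P\<^sup>2 + Q\<^sup>2" "k > 0" by (simp_all add: k_def add_pos_nonneg)
  define v where "v = k *\<^sub>R lift A - Q *\<^sub>R uB - P *\<^sub>R uC"
  have a: "mink (lift A) (lift A) = -1" "mink uC uB = 0" "mink uB (lift A) = 0" "mink uC (lift A) = 0"
    using A gramBC by (simp_all add: mink_lift_self mink_sym[of uC uB] mink_sym[of uB "lift A"] mink_sym[of uC "lift A"])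
  have m: "mink v (lift A) = - k" "mink v uB = - Q" "mink v uC = - P"
    using a A gramBC by (simp_all add: v_def mink_simps unitB unitC)
  have vv: "mink v v = -1"
    using mink_A_expansion[of v v] k(1) by (simp add: m power2_eq_square)
  \<comment> \<open>On the lower sheet the product with \<open>lift A\<close> would be nonnegative,
    but it is -k.\<close>
  have "snd v > 0"
  proof (rule ccontr)
    assume n: "\<not> snd v > 0"
    define b where "b = cmod (fst v)"
    have "b\<^sup>2 = Re (fst v * cnj (fst v))"
      using arg_cong[OF complex_norm_square, of Re] by (simp only: b_def Re_complex_of_real)
    then have "b\<^sup>2 = (snd v)\<^sup>2 - 1" using vv by (simp add: mink_def power2_eq_square)
    then have "b\<^sup>2 \<le> (- snd v)\<^sup>2" by simp
    then have "b \<le> - snd v" by (rule power2_le_imp_le) (use n in simp)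
    then have "b * cmod (fst (lift A)) \<le> - snd v * snd (lift A)"
      using norm_fst_lift(2)[OF A(1)] n by (intro mult_mono) auto
    moreover have "- Re (fst v * cnj (fst (lift A))) \<le> b * cmod (fst (lift A))"
      using abs_Re_le_cmod[of "fst v * cnj (fst (lift A))"] by (simp add: norm_mult b_def)
    ultimately have "0 \<le> mink v (lift A)" unfolding mink_def by linarith
    with m(1) k(2) show False by simp
  qed
  from lift_surj[OF vv this] obtain z where "z \<in> H2" "lift z = v" by blast
  then show thesis using that[of z] m by simp
qed

lemma feasible_iff:
  assumes "z \<in> H2"
  shows "z \<in> closed_chamber \<longleftrightarrow> (- mink (lift z) uC, - mink (lift z) uB) \<in> feasible \<beta> \<gamma>"
proof -
  have "(\<forall>i. mink (lift z) (u i) \<le> 0) \<longleftrightarrow> (\<forall>i\<in>UNIV. mink (lift z) (u i) \<le> 0)" by simp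
  also have "\<dots> \<longleftrightarrow> mink (lift z) uA \<le> 0 \<and> mink (lift z) uB \<le> 0 \<and> mink (lift z) uC \<le> 0"
    unfolding UNIV_side by simp
  finally show ?thesis
    using assms by (auto simp: feasible_def third_wall_mink[OF assms, symmetric])
qed

definition disp :: "complex \<Rightarrow> real" where
  "disp z = displacement \<beta> \<gamma> (- mink (lift z) uC, - mink (lift z) uB)"

definition pair_disp :: "complex \<Rightarrow> side \<Rightarrow> side \<Rightarrow> real" where
  "pair_disp z i j = (mink (lift z) (u i))\<^sup>2 + (mink (lift z) (u j))\<^sup>2
     + 2 * mink (lift z) (u i) * mink (lift z) (u j) * cos (pi / real (m i j))"

lemma mink_act_pair:
  assumes "i \<noteq> j" "z \<in> H2"
  shows "mink (lift z) (act [i, j] (lift z)) = - 1 - 2 * pair_disp z i j"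
  using B_act_two[OF assms(1), of "lift z"] assms(2) by (simp add: mink_lift_self pair_disp_def)

lemma disp_pairs:
  assumes "z \<in> H2"
  shows "disp z = min (pair_disp z SB SC) (min (pair_disp z SA SC) (pair_disp z SA SB))"
proof -
  have e: "third_wall \<beta> \<gamma> (- mink (lift z) uC) (- mink (lift z) uB) = - mink (lift z) uA"
    by (rule third_wall_mink[OF assms, symmetric])
  have "pair_disp z SB SC = (mink (lift z) uC)\<^sup>2 + (mink (lift z) uB)\<^sup>2"
    by (simp add: pair_disp_def)
  then show ?thesis
    unfolding disp_def displacement_def split Let_def e
    by (simp add: pair_disp_def \<beta>_def[symmetric] \<gamma>_def[symmetric])
qed

lemma pair_disp_sym: "pair_disp z i j = pair_disp z j i"
  by (simp add: pair_disp_def m_sym[of i j] algebra_simps)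

lemma disp_le_pair: "i \<noteq> j \<Longrightarrow> z \<in> H2 \<Longrightarrow> disp z \<le> pair_disp z i j"
  using pair_disp_sym[of z SC SB] pair_disp_sym[of z SC SA] pair_disp_sym[of z SB SA]
  by (cases i; cases j) (auto simp: disp_pairs)

lemma disp_attained:
  assumes "z \<in> H2"
  obtains i j where "i \<noteq> j" "disp z = pair_disp z i j"
proof -
  have "disp z = pair_disp z SB SC \<or> disp z = pair_disp z SA SC \<or> disp z = pair_disp z SA SB"
    unfolding disp_pairs[OF assms] by linarith
  then show thesis using that[of SB SC] that[of SA SC] that[of SA SB] by blast
qed

lemma pair_disp_nonneg:
  assumes "i \<noteq> j" "z \<in> H2"
  shows "0 \<le> pair_disp z i j"
proof -
  have "act [i, j] (lift z) = lift (dact [i, j] z)" using lift_dact[OF assms(2), of "[i, j]"] by simp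
  then have "mink (lift z) (act [i, j] (lift z)) \<le> - 1"
    using mink_lift_le[OF assms(2) dact_H2[OF assms(2), of "[i, j]"]] by simp
  then show ?thesis unfolding mink_act_pair[OF assms] by simp
qed

lemma disp_nonneg: "z \<in> H2 \<Longrightarrow> 0 \<le> disp z"
  using disp_attained[of z] pair_disp_nonneg by metis

text \<open>A reduced form of a nontrivial even word begins with two different letters, and dropping
  the rest only brings the image nearer.\<close>

lemma act_displacement:
  assumes z: "z \<in> closed_chamber" and w: "even (length w)" "act w \<noteq> id"
  shows "mink (lift z) (act w (lift z)) \<le> - 1 - 2 * disp z"
proof -
  obtain w' where w': "act w' = act w" "reduced w'" using exists_reduced by blast
  have "even (length w')" using act_parity[OF w'(1)] w(1) by simp
  moreover have "w' \<noteq> []" using w'(1) w(2) by (auto simp: id_def)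
  ultimately obtain i j zs where e: "w' = [i, j] @ zs"
    by (cases w'; cases "tl w'") auto
  have ij: "i \<noteq> j" using reduced_no_repeat[of "[]" i zs] w'(2) e by auto
  have z': "z \<in> H2" using z by simp
  have "mink (lift z) (act w (lift z)) \<le> mink (lift z) (act [i, j] (lift z))"
    unfolding w'(1)[symmetric] e by (rule B_act_le_prefix) (use w'(2) e z in auto)
  also have "\<dots> \<le> - 1 - 2 * disp z"
    using mink_act_pair[OF ij z'] disp_le_pair[OF ij z'] by simp
  finally show ?thesis .
qed

lemma interior_disp_pos:
  assumes "z \<in> chamber uA uB uC"
  shows "0 < disp z"
proof -
  have z: "z \<in> H2" "\<And>i. mink (lift z) (u i) < 0" using assms by (auto simp: chamber_iff)
  obtain i j where ij: "i \<noteq> j" "disp z = pair_disp z i j" using disp_attained[OF z(1)] by blast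
  have "pi / real (m i j) \<le> pi / 2" using m_ge_2[OF ij(1)] by (intro divide_left_mono) auto
  moreover have "0 \<le> pi / real (m i j)" by simp
  ultimately have "0 \<le> cos (pi / real (m i j))" using pi_gt_zero by (intro cos_ge_zero) linarith+
  moreover have "0 \<le> mink (lift z) (u i) * mink (lift z) (u j)"
    by (rule mult_nonpos_nonpos) (rule less_imp_le[OF z(2)])+
  ultimately have "0 \<le> (mink (lift z) (u i) * mink (lift z) (u j)) * cos (pi / real (m i j))"
    using mult_nonneg_nonneg by blast
  then have "0 \<le> 2 * mink (lift z) (u i) * mink (lift z) (u j) * cos (pi / real (m i j))" by simp
  moreover have "0 < (mink (lift z) (u i))\<^sup>2" using z(2)[of i] by simp
  ultimately show ?thesis
    unfolding ij(2) pair_disp_def using zero_le_power2[of "mink (lift z) (u j)"] by linarith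
qed

lemma act_pair_neq_id: "i \<noteq> j \<Longrightarrow> act [i, j] \<noteq> id"
proof
  assume ij: "i \<noteq> j" and e: "act [i, j] = id"
  obtain z where z: "z \<in> chamber uA uB uC" using chamber_nonempty by blast
  then have z': "z \<in> H2" by (simp add: chamber_iff)
  have "- 1 - 2 * pair_disp z i j = -1"
    unfolding mink_act_pair[OF ij z', symmetric] e by (simp add: mink_lift_self[OF z'])
  then show False using interior_disp_pos[OF z] disp_le_pair[OF ij z'] by simp
qed

text \<open>Both squared cosines are below 1, so D is less than the square of the smaller cosine.
  The condition on the third wall, linear in P and Q on one side, then bounds P^2 + Q^2.\<close>

lemma bounded_feasible: "bounded (feasible \<beta> \<gamma>)"
proof -
  define c where "c = min (cos \<beta>) (cos \<gamma>)"
  define D where "D = (cos \<beta>)\<^sup>2 + (cos \<gamma>)\<^sup>2 - 1"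
  have c0: "0 < c" using cos_pos by (simp add: c_def)
  have D0: "0 < D" using cos_sq_gt_1 by (simp add: D_def)
  have lt1: "(cos \<beta>)\<^sup>2 < 1" "(cos \<gamma>)\<^sup>2 < 1"
    using sin_gt_zero[of \<beta>] sin_gt_zero[of \<gamma>] angles by (auto simp: cos_squared_eq)
  have cD: "D < c\<^sup>2" using lt1 by (auto simp: c_def D_def min_def)
  have "(P, Q) \<in> feasible \<beta> \<gamma> \<Longrightarrow> norm (P, Q) \<le> sqrt (D / (c\<^sup>2 - D))" for P Q
  proof -
    assume f: "(P, Q) \<in> feasible \<beta> \<gamma>"
    then have PQ: "0 \<le> P" "0 \<le> Q" and t: "P * cos \<beta> + Q * cos \<gamma> \<le> sqrt D * sqrt (1 + P\<^sup>2 + Q\<^sup>2)"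
      by (auto simp: feasible_def third_wall_def D_def)
    have "c * (P + Q) \<le> P * cos \<beta> + Q * cos \<gamma>"
      using PQ mult_left_mono[of c "cos \<beta>" P] mult_left_mono[of c "cos \<gamma>" Q] by (simp add: c_def algebra_simps)
    then have "c * (P + Q) \<le> sqrt (D * (1 + P\<^sup>2 + Q\<^sup>2))" using t by (simp add: real_sqrt_mult)
    then have "(c * (P + Q))\<^sup>2 \<le> D * (1 + P\<^sup>2 + Q\<^sup>2)"
      using c0 PQ D0 by (metis (no_types) add_nonneg_nonneg less_imp_le mult_nonneg_nonneg power_mono real_sqrt_pow2 zero_le_one zero_le_power2)
    moreover have "c\<^sup>2 * (P\<^sup>2 + Q\<^sup>2) \<le> (c * (P + Q))\<^sup>2"
      using PQ mult_left_mono[of "P\<^sup>2 + Q\<^sup>2" "(P + Q)\<^sup>2" "c\<^sup>2"] by (simp add: power_mult_distrib power2_sum)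
    ultimately have "(c\<^sup>2 - D) * (P\<^sup>2 + Q\<^sup>2) \<le> D" by (simp add: algebra_simps)
    then have "P\<^sup>2 + Q\<^sup>2 \<le> D / (c\<^sup>2 - D)" using cD by (simp add: field_simps)
    then show ?thesis by (simp add: norm_Pair)
  qed
  then show ?thesis by (intro boundedI[of _ "sqrt (D / (c\<^sup>2 - D))"]) auto
qed

lemma compact_feasible: "compact (feasible \<beta> \<gamma>)"
proof -
  have "closed {x :: real \<times> real. 0 \<le> fst x \<and> 0 \<le> snd x \<and> 0 \<le> third_wall \<beta> \<gamma> (fst x) (snd x)}"
    unfolding third_wall_def by (intro closed_Collect_conj closed_Collect_le continuous_intros)
  also have "{x :: real \<times> real. 0 \<le> fst x \<and> 0 \<le> snd x \<and> 0 \<le> third_wall \<beta> \<gamma> (fst x) (snd x)} = feasible \<beta> \<gamma>"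
    by (auto simp: feasible_def)
  finally show ?thesis using bounded_feasible by (simp add: compact_eq_bounded_closed)
qed

lemma continuous_displacement: "continuous_on X (displacement \<beta> \<gamma>)"
proof -
  have "displacement \<beta> \<gamma> = (\<lambda>x. min ((fst x)\<^sup>2 + (snd x)\<^sup>2)
     (min ((third_wall \<beta> \<gamma> (fst x) (snd x))\<^sup>2 + (fst x)\<^sup>2 + 2 * third_wall \<beta> \<gamma> (fst x) (snd x) * fst x * cos \<beta>)
       ((third_wall \<beta> \<gamma> (fst x) (snd x))\<^sup>2 + (snd x)\<^sup>2 + 2 * third_wall \<beta> \<gamma> (fst x) (snd x) * snd x * cos \<gamma>)))"
    by (simp add: displacement_def Let_def case_prod_beta')
  then show ?thesis unfolding third_wall_def by (simp only:) (intro continuous_intros)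
qed

lemma max_displacement:
  obtains x where "x \<in> feasible \<beta> \<gamma>" "0 < displacement \<beta> \<gamma> x"
    "\<And>y. y \<in> feasible \<beta> \<gamma> \<Longrightarrow> displacement \<beta> \<gamma> y \<le> displacement \<beta> \<gamma> x"
proof -
  obtain z where z: "z \<in> chamber uA uB uC" using chamber_nonempty by blast
  then have z': "z \<in> H2" "z \<in> closed_chamber" by (auto simp: chamber_iff less_imp_le)
  then have f: "(- mink (lift z) uC, - mink (lift z) uB) \<in> feasible \<beta> \<gamma>" using feasible_iff by blast
  have "\<exists>x\<in>feasible \<beta> \<gamma>. \<forall>y\<in>feasible \<beta> \<gamma>. displacement \<beta> \<gamma> y \<le> displacement \<beta> \<gamma> x"
    using f by (intro continuous_attains_sup compact_feasible continuous_displacement) auto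
  then obtain x where x: "x \<in> feasible \<beta> \<gamma>" "\<And>y. y \<in> feasible \<beta> \<gamma> \<Longrightarrow> displacement \<beta> \<gamma> y \<le> displacement \<beta> \<gamma> x" by blast
  moreover have "0 < displacement \<beta> \<gamma> x"
    using x(2)[OF f] interior_disp_pos[OF z] by (simp add: disp_def)
  ultimately show thesis using that by blast
qed

section \<open>Packing radius, cell and density\<close>

definition el :: "real \<Rightarrow> side list \<Rightarrow> int \<Rightarrow> complex \<times> real \<Rightarrow> complex \<times> real" where
  "el r w n = (\<lambda>X\<in>H2R. (rot w (fst X), snd X + of_int n * r))"

lemma space_group_el: "space_group rotation_group r = {el r w n | w n. even (length w)}"
  by (auto simp: space_group_def rotation_group_def el_def)

lemma el_apply: "k \<in> H2 \<Longrightarrow> el r w n (k, \<tau>) = (dact w k, \<tau> + of_int n * r)"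
  by (simp add: el_def H2R_def rot_def)

lemma one_el: "\<one>\<^bsub>BijGroup H2R\<^esub> = el r [] 0"
  by (auto simp: BijGroup_def el_def H2R_def rot_def fun_eq_iff)

lemma el_eq_one: "act w = id \<Longrightarrow> el r w 0 = \<one>\<^bsub>BijGroup H2R\<^esub>"
proof -
  assume "act w = id"
  then have "dact w z = z" if "z \<in> H2" for z
    using that by (intro lift_inj) (auto simp: dact_H2 lift_dact)
  then show ?thesis unfolding one_el[of r] by (auto simp: el_def H2R_def rot_def fun_eq_iff)
qed

lemma el_neq_one:
  assumes "r > 0" "n \<noteq> 0 \<or> act w \<noteq> id"
  shows "el r w n \<noteq> \<one>\<^bsub>BijGroup H2R\<^esub>"
proof
  assume e: "el r w n = \<one>\<^bsub>BijGroup H2R\<^esub>"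
  have a: "dact w z = z \<and> of_int n * r = 0" if "z \<in> H2" for z
    using fun_cong[OF e[unfolded one_el[of r]], of "(z, 0)"] that by (simp add: el_apply)
  then have "n = 0" using assms(1) A(1) by auto
  moreover have "act w = id" using a by (intro act_eq_id) (metis lift_dact)
  ultimately show False using assms(2) by simp
qed

lemma h2r_dist_el:
  assumes "k \<in> H2"
  shows "h2r_dist (k, \<tau>) (el r w n (k, \<tau>)) = sqrt ((h2_dist k (dact w k))\<^sup>2 + (of_int n * r)\<^sup>2)"
  using assms by (simp add: el_apply h2r_dist_def)

context
  fixes r :: real and k k0 :: complex and \<tau> :: real and w0 :: "side list"
  assumes r: "0 < r" and k: "k \<in> H2" and k0: "k0 = dact w0 k" "k0 \<in> closed_chamber"
begin

text \<open>Conjugation by \<open>w0\<close> transfers displacements to the representative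
  \<open>k0\<close> in the closed chamber.\<close>

lemma conj_dist: "h2_dist k (dact w k) = h2_dist k0 (dact (w0 @ w @ rev w0) k0)"
proof -
  have "h2_dist k (dact w k) = h2_dist (dact w0 k) (dact w0 (dact w k))"
    using k by (intro h2_dist_dact[symmetric]) (auto simp: dact_H2)
  then show ?thesis using k by (simp add: k0 dact_rev)
qed

lemma act_conj_id: "act (w0 @ w @ rev w0) = id \<longleftrightarrow> act w = id"
proof
  assume e: "act (w0 @ w @ rev w0) = id"
  show "act w = id"
  proof
    fix v
    have "act w0 (act w v) = act (w0 @ w @ rev w0) (act w0 v)" by simp
    also have "\<dots> = act w0 v" by (simp only: e id_apply)
    finally show "act w v = id v" by (metis act_rev id_apply)
  qed
next
  assume e: "act w = id"
  show "act (w0 @ w @ rev w0) = id"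
  proof
    fix v
    have "act (w0 @ w @ rev w0) v = act w0 (act w (act (rev w0) v))" by simp
    then show "act (w0 @ w @ rev w0) v = id v" by (simp only: e id_apply act_rev')
  qed
qed

lemma dist_lower:
  assumes "even (length w)" "act w \<noteq> id"
  shows "2 * radius (disp k0) \<le> h2_dist k (dact w k)"
  unfolding conj_dist
proof (rule h2_dist_ge_radius)
  have z: "k0 \<in> H2" using k0 by simp
  then show "k0 \<in> H2" "dact (w0 @ w @ rev w0) k0 \<in> H2" by (auto intro: dact_H2 simp del: foldr_append)
  show "0 \<le> disp k0" by (rule disp_nonneg[OF z])
  show "mink (lift k0) (lift (dact (w0 @ w @ rev w0) k0)) \<le> - 1 - 2 * disp k0"
    unfolding lift_dact[OF z] by (rule act_displacement[OF k0(2)]) (use assms in \<open>simp_all only: act_conj_id, simp_all\<close>)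
qed

lemma dist_attained:
  obtains w where "even (length w)" "act w \<noteq> id" "h2_dist k (dact w k) = 2 * radius (disp k0)"
proof -
  have z: "k0 \<in> H2" using k0 by simp
  obtain i j where ij: "i \<noteq> j" "disp k0 = pair_disp k0 i j" using disp_attained[OF z] by blast
  define w where "w = rev w0 @ [i, j] @ w0"
  have "act (w0 @ w @ rev w0) = act [i, j]" by (rule ext) (simp add: w_def)
  then have "act (w0 @ w @ rev w0) \<noteq> id" using act_pair_neq_id[OF ij(1)] by simp
  then have "act w \<noteq> id" by (simp only: act_conj_id not_False_eq_True)
  moreover have "even (length w)" by (simp add: w_def)
  moreover have "h2_dist k (dact w k) = 2 * radius (disp k0)"
    unfolding conj_dist
  proof (rule h2_dist_radius)
    show "k0 \<in> H2" "dact (w0 @ w @ rev w0) k0 \<in> H2" using z by (auto intro: dact_H2 simp del: foldr_append)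
    show "mink (lift k0) (lift (dact (w0 @ w @ rev w0) k0)) = - 1 - 2 * disp k0"
      unfolding lift_dact[OF z] \<open>act (w0 @ w @ rev w0) = act [i, j]\<close> ij(2) by (rule mink_act_pair[OF ij(1) z])
  qed
  ultimately show thesis using that by blast
qed

text \<open>An element with a vertical part moves every point by at least r; any other nontrivial
  one moves it horizontally, where the chamber estimate applies. Both bounds are attained.\<close>

lemma packing_radius_eq:
  "packing_radius (space_group rotation_group r) (k, \<tau>) = min (radius (disp k0)) (r / 2)"
proof -
  define d where "d = 2 * radius (disp k0)"
  have d0: "0 \<le> d" using dist_attained h2_dist_nonneg k dact_H2 unfolding d_def by metis
  let ?\<Gamma> = "space_group rotation_group r - {\<one>\<^bsub>BijGroup H2R\<^esub>}"
  have lower: "min d r \<le> h2r_dist (k, \<tau>) (g (k, \<tau>))" if gin: "g \<in> ?\<Gamma>" for g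
  proof -
    obtain w n where g: "g = el r w n" "even (length w)" using gin by (auto simp: space_group_el)
    show ?thesis
    proof (cases "n = 0")
      case True
      have "act w \<noteq> id" using gin g True el_eq_one[of w r] by auto
      from dist_lower[OF g(2) this] show ?thesis
        using h2_dist_nonneg[OF k dact_H2[OF k]] by (simp add: g(1) h2r_dist_el[OF k] True d_def)
    next
      case False
      then have "1 \<le> \<bar>real_of_int n\<bar>" by linarith
      then have "r \<le> \<bar>of_int n * r\<bar>" using r by (simp add: abs_mult)
      also have "\<dots> \<le> sqrt ((h2_dist k (dact w k))\<^sup>2 + (of_int n * r)\<^sup>2)"
        by (rule real_le_rsqrt) simp
      finally show ?thesis by (simp add: g(1) h2r_dist_el[OF k])
    qed
  qed
  have "\<exists>g\<in>?\<Gamma>. h2r_dist (k, \<tau>) (g (k, \<tau>)) = min d r"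
  proof (cases "d \<le> r")
    case True
    obtain w where w: "even (length w)" "act w \<noteq> id" "h2_dist k (dact w k) = d"
      using dist_attained unfolding d_def by blast
    have "el r w 0 \<in> ?\<Gamma>" using w el_neq_one[OF r, of 0 w] by (auto simp: space_group_el)
    moreover have "h2r_dist (k, \<tau>) (el r w 0 (k, \<tau>)) = min d r"
      using w(3) d0 True by (simp add: h2r_dist_el[OF k])
    ultimately show ?thesis by blast
  next
    case False
    have "el r [] 1 \<in> ?\<Gamma>" using el_neq_one[OF r, of 1 "[]"] by (auto simp: space_group_el)
    moreover have "h2r_dist (k, \<tau>) (el r [] 1 (k, \<tau>)) = min d r"
      using False r h2_dist_eq_0_iff[OF k k] by (simp add: h2r_dist_el[OF k])
    ultimately show ?thesis by blast
  qed
  then obtain g where g: "g \<in> ?\<Gamma>" "h2r_dist (k, \<tau>) (g (k, \<tau>)) = min d r" by blast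
  have "packing_radius (space_group rotation_group r) (k, \<tau>) = min d r / 2"
    unfolding packing_radius_def
  proof (rule cInf_eq_minimum)
    show "min d r / 2 \<in> (\<lambda>g. h2r_dist (k, \<tau>) (g (k, \<tau>)) / 2) ` ?\<Gamma>" using g by (intro image_eqI[of _ _ g]) auto
    fix x assume "x \<in> (\<lambda>g. h2r_dist (k, \<tau>) (g (k, \<tau>)) / 2) ` ?\<Gamma>"
    then obtain h where "h \<in> ?\<Gamma>" "x = h2r_dist (k, \<tau>) (h (k, \<tau>)) / 2" by blast
    then show "min d r / 2 \<le> x" using lower[of h] by simp
  qed
  also have "\<dots> = min (radius (disp k0)) (r / 2)"
    by (cases "d \<le> r") (simp_all add: d_def min_def)
  finally show ?thesis .
qed

end

lemma trivial_stabilizer_iff: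
  assumes r: "0 < r" and k: "k \<in> H2"
  shows "trivial_stabilizer (space_group rotation_group r) (k, \<tau>) \<longleftrightarrow> (\<forall>f\<in>E. f (lift k) = lift k \<longrightarrow> f = id)"
proof
  assume *: "trivial_stabilizer (space_group rotation_group r) (k, \<tau>)"
  show "\<forall>f\<in>E. f (lift k) = lift k \<longrightarrow> f = id"
  proof (intro ballI impI)
    fix f assume "f \<in> E" and f: "f (lift k) = lift k"
    then obtain w where w: "f = act w" "even (length w)" by (auto simp: E_def)
    have "dact w k = k" by (rule lift_inj[OF dact_H2[OF k] k]) (use f w k in \<open>simp add: lift_dact\<close>)
    then have "el r w 0 (k, \<tau>) = (k, \<tau>)" using k by (simp add: el_apply)
    moreover have "el r w 0 \<in> space_group rotation_group r" using w by (auto simp: space_group_el)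
    ultimately have "el r w 0 = \<one>\<^bsub>BijGroup H2R\<^esub>" using * by (auto simp: trivial_stabilizer_def)
    then show "f = id" using el_neq_one[OF r, of 0 w] w by blast
  qed
next
  assume *: "\<forall>f\<in>E. f (lift k) = lift k \<longrightarrow> f = id"
  show "trivial_stabilizer (space_group rotation_group r) (k, \<tau>)"
    unfolding trivial_stabilizer_def
  proof (intro ballI impI)
    fix g assume "g \<in> space_group rotation_group r" and g: "g (k, \<tau>) = (k, \<tau>)"
    then obtain w n where w: "g = el r w n" "even (length w)" by (auto simp: space_group_el)
    then have "dact w k = k" "of_int n * r = 0" using g k by (auto simp: el_apply)
    then have "act w (lift k) = lift k" "n = 0" using k r by (auto simp flip: lift_dact)
    moreover have "act w = id" using * E_actI[OF w(2)] calculation(1) by blast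
    ultimately show "g = \<one>\<^bsub>BijGroup H2R\<^esub>" using w el_eq_one by simp
  qed
qed

text \<open>Squared distances add over the two factors, and the factors of the group act
  independently; testing \<open>n = 0\<close> and the empty word separates the two
  conditions.\<close>

lemma cell_eq:
  assumes r: "0 < r" and k: "k \<in> H2"
  shows "dirichlet_voronoi_cell (space_group rotation_group r) (k, \<tau>) =
    {z \<in> H2. \<forall>f\<in>E. mink (lift z) (f (lift k)) \<le> mink (lift z) (lift k)} \<times> {\<tau> - r / 2..\<tau> + r / 2}"
proof -
  have h2: "(\<forall>f\<in>E. mink (lift z) (f (lift k)) \<le> mink (lift z) (lift k)) \<longleftrightarrow>
      (\<forall>w. even (length w) \<longrightarrow> h2_dist k z \<le> h2_dist (dact w k) z)" if z: "z \<in> H2" for z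
  proof -
    have "h2_dist k z \<le> h2_dist (dact w k) z \<longleftrightarrow> mink (lift z) (act w (lift k)) \<le> mink (lift z) (lift k)" for w
      using h2_dist_le_iff[OF k z dact_H2[OF k] z, of w] k by (simp add: lift_dact mink_sym[of _ "lift z"])
    then show ?thesis by (auto simp: E_def)
  qed
  have mem: "(z, t) \<in> dirichlet_voronoi_cell (space_group rotation_group r) (k, \<tau>) \<longleftrightarrow>
      z \<in> H2 \<and> (\<forall>w n. even (length w) \<longrightarrow> (h2_dist k z)\<^sup>2 + (\<tau> - t)\<^sup>2 \<le> (h2_dist (dact w k) z)\<^sup>2 + (\<tau> + of_int n * r - t)\<^sup>2)" for z t
  proof -
    have ball: "(\<forall>g\<in>{el r w n | w n. even (length w)}. Q g) \<longleftrightarrow> (\<forall>w n. even (length w) \<longrightarrow> Q (el r w n))" for Q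
      by blast
    show ?thesis
      unfolding dirichlet_voronoi_cell_def space_group_el mem_Collect_eq ball
      by (simp add: H2R_def h2r_dist_def el_apply[OF k])
  qed
  have main: "(z, t) \<in> dirichlet_voronoi_cell (space_group rotation_group r) (k, \<tau>) \<longleftrightarrow>
      z \<in> H2 \<and> (\<forall>w. even (length w) \<longrightarrow> h2_dist k z \<le> h2_dist (dact w k) z) \<and> \<bar>\<tau> - t\<bar> \<le> r / 2" (is "?L \<longleftrightarrow> ?R") for z t
  proof
    assume L: ?L
    then have z: "z \<in> H2" by (simp add: mem)
    have "h2_dist k z \<le> h2_dist (dact w k) z" if "even (length w)" for w
    proof -
      have "(h2_dist k z)\<^sup>2 \<le> (h2_dist (dact w k) z)\<^sup>2"
        using L that mem[of z t] by (metis add_le_cancel_right add.right_neutral mult_zero_left of_int_0)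
      then show ?thesis by (rule power2_le_imp_le) (rule h2_dist_nonneg[OF dact_H2[OF k] z])
    qed
    moreover have "(\<tau> - t)\<^sup>2 \<le> (\<tau> + of_int n * r - t)\<^sup>2" for n
    proof -
      have "(h2_dist k z)\<^sup>2 + (\<tau> - t)\<^sup>2 \<le> (h2_dist (dact [] k) z)\<^sup>2 + (\<tau> + of_int n * r - t)\<^sup>2"
        using L mem[of z t] by (metis even_zero list.size(3))
      then show ?thesis by simp
    qed
    \<comment> \<open>The translates by r and -r bound the height from both sides.\<close>
    from this[of 1] this[of "-1"] have "0 \<le> r * (r + 2 * (\<tau> - t))" "0 \<le> r * (r - 2 * (\<tau> - t))"
      by (simp_all add: power2_eq_square algebra_simps)
    then have "0 \<le> r + 2 * (\<tau> - t)" "0 \<le> r - 2 * (\<tau> - t)" using r by (simp_all add: zero_le_mult_iff)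
    then have "\<tau> - t \<le> r / 2" "- (\<tau> - t) \<le> r / 2" by (simp_all add: field_simps)
    then have "\<bar>\<tau> - t\<bar> \<le> r / 2" by (rule abs_leI)
    ultimately show ?R using z by blast
  next
    assume R: ?R
    have "(\<tau> - t)\<^sup>2 \<le> (\<tau> + of_int n * r - t)\<^sup>2" for n
    proof (cases "n = 0")
      case False
      have "\<bar>\<tau> - t\<bar> \<le> \<bar>\<tau> + of_int n * r - t\<bar>"
      proof -
        have "1 \<le> \<bar>real_of_int n\<bar>" using False by linarith
        then have "r \<le> \<bar>of_int n * r\<bar>" using r by (simp add: abs_mult)
        then show ?thesis using R by linarith
      qed
      then show ?thesis by (simp add: abs_le_square_iff)
    qed simp
    moreover have "(h2_dist k z)\<^sup>2 \<le> (h2_dist (dact w k) z)\<^sup>2" if "even (length w)" for w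
      using R that h2_dist_nonneg[OF k, of z] by (intro power_mono) auto
    ultimately show ?L using R by (auto simp: mem intro: add_mono)
  qed
  show ?thesis
  proof (rule Set.set_eqI)
    fix X :: "complex \<times> real"
    obtain z t where X: "X = (z, t)" by (cases X)
    have "\<bar>\<tau> - t\<bar> \<le> r / 2 \<longleftrightarrow> t \<in> {\<tau> - r / 2..\<tau> + r / 2}"
      unfolding abs_le_iff by auto
    then show "X \<in> dirichlet_voronoi_cell (space_group rotation_group r) (k, \<tau>) \<longleftrightarrow>
        X \<in> {z \<in> H2. \<forall>f\<in>E. mink (lift z) (f (lift k)) \<le> mink (lift z) (lift k)} \<times> {\<tau> - r / 2..\<tau> + r / 2}"
      unfolding X main mem_Sigma_iff mem_Collect_eq using h2[of z] by blast
  qed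
qed

lemma area_pos: "0 < pi - 2 * \<beta> - 2 * \<gamma>"
  using angles by linarith

lemma packing_density_eq:
  assumes r: "0 < r" and k: "k \<in> H2" and k0: "k0 = dact w0 k" "k0 \<in> closed_chamber"
    and stab: "trivial_stabilizer (space_group rotation_group r) (k, \<tau>)"
  defines "\<rho> \<equiv> min (radius (disp k0)) (r / 2)"
  shows "packing_density (space_group rotation_group r) (k, \<tau>) =
    2 * pi * \<rho> * ball_profile \<rho> / (r * (pi - 2 * \<beta> - 2 * \<gamma>))"
proof -
  have "\<rho> \<ge> 0"
    using r disp_nonneg[of k0] k0 radius_mono[of 0 "disp k0"] by (simp add: \<rho>_def radius_def)
  then have V: "measure h2r_vol (geodesic_ball (k, \<tau>) \<rho>) = 2 * pi * \<rho> * ball_profile \<rho>"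
    using k by (intro geodesic_ball_volume) (auto simp: H2R_def)
  have s: "f = id" if "f \<in> E" "f (lift k) = lift k" for f
    using stab that unfolding trivial_stabilizer_iff[OF r k] by blast
  note D = dirichlet_area[OF k s]
  have "emeasure h2r_vol (dirichlet_voronoi_cell (space_group rotation_group r) (k, \<tau>)) = ennreal (r * (pi - 2 * \<beta> - 2 * \<gamma>))"
    unfolding cell_eq[OF r k] using r area_pos
    by (subst emeasure_h2r_vol_Times) (auto simp: D ennreal_mult[symmetric] mult.commute)
  then have "measure h2r_vol (dirichlet_voronoi_cell (space_group rotation_group r) (k, \<tau>)) = r * (pi - 2 * \<beta> - 2 * \<gamma>)"
    unfolding measure_def using r area_pos by simp
  then show ?thesis
    unfolding packing_density_def packing_radius_eq[OF r k k0] \<rho>_def[symmetric] V by simp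
qed

lemma stabilizer_of_disp_pos:
  assumes r: "0 < r" and z: "z \<in> closed_chamber" "0 < disp z"
  shows "trivial_stabilizer (space_group rotation_group r) (z, \<tau>)"
proof -
  have z': "z \<in> H2" using z by simp
  show ?thesis
    unfolding trivial_stabilizer_iff[OF r z']
  proof (intro ballI impI, rule ccontr)
    fix f assume f: "f \<in> E" "f (lift z) = lift z" "f \<noteq> id"
    then obtain w where "f = act w" "even (length w)" by (auto simp: E_def)
    then have "mink (lift z) (f (lift z)) \<le> - 1 - 2 * disp z" using act_displacement[OF z(1)] f by blast
    then show False using f z(2) mink_lift_self[OF z'] by simp
  qed
qed

theorem optimal_density_eq:
  assumes x: "x \<in> feasible \<beta> \<gamma>" "0 < displacement \<beta> \<gamma> x"
    and max: "\<And>y. y \<in> feasible \<beta> \<gamma> \<Longrightarrow> displacement \<beta> \<gamma> y \<le> displacement \<beta> \<gamma> x"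
  defines "\<delta> \<equiv> pi * ball_profile (radius (displacement \<beta> \<gamma> x)) / (pi - 2 * \<beta> - 2 * \<gamma>)"
  shows "\<delta> \<in> packing_densities rotation_group"
    and "\<delta>' \<in> packing_densities rotation_group \<Longrightarrow> \<delta>' \<le> \<delta>"
    and "optimal_density rotation_group = \<delta>"
proof -
  define \<rho> where "\<rho> = radius (displacement \<beta> \<gamma> x)"
  have \<rho>0: "0 < \<rho>" using radius_pos[OF x(2)] by (simp add: \<rho>_def)
  obtain z where z: "z \<in> H2" "- mink (lift z) uC = fst x" "- mink (lift z) uB = snd x"
    by (rule realize_coordinates)
  have zc: "z \<in> closed_chamber" using feasible_iff[OF z(1)] z x(1) by simp
  have dz: "disp z = displacement \<beta> \<gamma> x" using z by (simp add: disp_def)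
  have st: "trivial_stabilizer (space_group rotation_group (2 * \<rho>)) (z, 0)"
    using \<rho>0 zc x(2) dz by (intro stabilizer_of_disp_pos) auto
  have "packing_density (space_group rotation_group (2 * \<rho>)) (z, 0) = \<delta>"
    using packing_density_eq[OF _ z(1) _ zc st, of "[]"] \<rho>0 by (simp add: dz \<rho>_def[symmetric] \<delta>_def)
  then show 1: "\<delta> \<in> packing_densities rotation_group"
    unfolding packing_densities_def using st \<rho>0 z(1)
    by (intro CollectI exI[of _ "2 * \<rho>"] exI[of _ "(z, 0)"]) (simp add: H2R_def)
  show 2: "\<delta>' \<le> \<delta>" if "\<delta>' \<in> packing_densities rotation_group" for \<delta>'
  proof -
    obtain r k \<tau> where r: "0 < r" and k: "k \<in> H2" and st: "trivial_stabilizer (space_group rotation_group r) (k, \<tau>)"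
      and d: "\<delta>' = packing_density (space_group rotation_group r) (k, \<tau>)"
      using \<open>\<delta>' \<in> packing_densities rotation_group\<close> by (auto simp: packing_densities_def H2R_def)
    obtain w0 where w0: "dact w0 k \<in> closed_chamber" using chamber_covers[OF k] by blast
    define k0 where "k0 = dact w0 k"
    define \<sigma> where "\<sigma> = min (radius (disp k0)) (r / 2)"
    have k0: "k0 \<in> closed_chamber" using w0 by (simp add: k0_def)
    then have k0': "k0 \<in> H2" by simp
    have "disp k0 \<le> displacement \<beta> \<gamma> x"
      unfolding disp_def using feasible_iff[OF k0'] k0 by (intro max) blast
    then have "radius (disp k0) \<le> \<rho>" unfolding \<rho>_def using disp_nonneg[OF k0'] by (intro radius_mono)
    then have \<sigma>: "0 \<le> \<sigma>" "\<sigma> \<le> \<rho>" "\<sigma> \<le> r / 2"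
      using r radius_mono[of 0 "disp k0"] disp_nonneg[OF k0'] by (auto simp: \<sigma>_def radius_def)
    \<comment> \<open>The lattice parameter enters only through the factor 2 \<sigma> / r, which is
      at most 1 because \<sigma> is at most r / 2.\<close>
    have "\<delta>' = (2 * \<sigma> / r) * (pi * ball_profile \<sigma>) / (pi - 2 * \<beta> - 2 * \<gamma>)"
      unfolding d packing_density_eq[OF r k k0_def k0 st] \<sigma>_def[symmetric] by simp
    also have "\<dots> \<le> 1 * (pi * ball_profile \<rho>) / (pi - 2 * \<beta> - 2 * \<gamma>)"
      using \<sigma> r area_pos ball_profile_mono[OF \<sigma>(1,2)] ball_profile_nonneg[of \<sigma>]
      by (intro divide_right_mono mult_mono) (auto simp: field_simps)
    finally show ?thesis by (simp add: \<delta>_def \<rho>_def)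
  qed
  show "optimal_density rotation_group = \<delta>"
    unfolding optimal_density_def by (rule Greatest_equality) (use 1 2 in auto)
qed

end

section \<open>Bounds for the density\<close>

text \<open>Averaging the Maclaurin formulas of exp at y and -y cancels the odd terms and averages
  the two remainders.\<close>

lemma cosh_remainder:
  fixes y :: real
  obtains \<epsilon> where "cosh y = 1 + y\<^sup>2 / 2 + y ^ 4 / 24 + y ^ 6 / 720 + \<epsilon> * y ^ 8 / 40320" "0 \<le> \<epsilon>" "\<epsilon> \<le> exp \<bar>y\<bar>"
proof -
  obtain s where s: "\<bar>s\<bar> \<le> \<bar>y\<bar>" "exp y = (\<Sum>m<8. y ^ m / fact m) + exp s / fact 8 * y ^ 8"
    using Maclaurin_exp_le[of y 8] by blast
  obtain t where t: "\<bar>t\<bar> \<le> \<bar>- y\<bar>" "exp (- y) = (\<Sum>m<8. (- y) ^ m / fact m) + exp t / fact 8 * (- y) ^ 8"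
    using Maclaurin_exp_le[of "- y" 8] by blast
  have "cosh y = 1 + y\<^sup>2 / 2 + y ^ 4 / 24 + y ^ 6 / 720 + ((exp s + exp t) / 2) * y ^ 8 / 40320"
    unfolding cosh_def s(2) t(2) by (simp add: lessThan_nat_numeral fact_numeral field_simps)
  moreover have "exp s + exp t \<le> exp \<bar>y\<bar> + exp \<bar>y\<bar>" using s t by (intro add_mono) auto
  then have "(exp s + exp t) / 2 \<le> exp \<bar>y\<bar>" by simp
  moreover have "0 \<le> (exp s + exp t) / 2" by simp
  ultimately show thesis using that by blast
qed

lemma even_powers_sqrt: "0 \<le> x \<Longrightarrow> (sqrt x) ^ 4 = x\<^sup>2 \<and> (sqrt x) ^ 6 = x ^ 3 \<and> (sqrt x) ^ 8 = x ^ 4"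
  using power_mult[of "sqrt x" 2 2] power_mult[of "sqrt x" 2 3] power_mult[of "sqrt x" 2 4] by simp

lemma cosh_sqrt_ge:
  assumes "0 \<le> x"
  shows "1 + x / 2 + x\<^sup>2 / 24 + x ^ 3 / 720 \<le> cosh (sqrt x)"
proof -
  obtain \<epsilon> where "cosh (sqrt x) = 1 + (sqrt x)\<^sup>2 / 2 + sqrt x ^ 4 / 24 + sqrt x ^ 6 / 720 + \<epsilon> * sqrt x ^ 8 / 40320" "0 \<le> \<epsilon>"
    by (rule cosh_remainder)
  then show ?thesis using assms by (simp add: even_powers_sqrt)
qed

lemma cosh_sqrt_le:
  assumes "0 \<le> x" "x \<le> 1"
  shows "cosh (sqrt x) \<le> 1 + x / 2 + x\<^sup>2 / 24 + x ^ 3 / 720 + x ^ 4 / 13440"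
proof -
  obtain \<epsilon> where e: "cosh (sqrt x) = 1 + (sqrt x)\<^sup>2 / 2 + sqrt x ^ 4 / 24 + sqrt x ^ 6 / 720 + \<epsilon> * sqrt x ^ 8 / 40320"
      "\<epsilon> \<le> exp \<bar>sqrt x\<bar>"
    by (rule cosh_remainder)
  have "exp \<bar>sqrt x\<bar> \<le> exp 1" using assms by simp
  \<comment> \<open>The crude bound 3 for e is the origin of the denominator 13440 = 40320 /
    3.\<close>
  then have "\<epsilon> \<le> 3" using e(2) exp_le by linarith
  then have "\<epsilon> * x ^ 4 \<le> 3 * x ^ 4" using assms by (intro mult_right_mono) auto
  then show ?thesis unfolding e(1) using assms by (simp add: even_powers_sqrt)
qed

lemma has_integral_even_powers:
  "((\<lambda>s. a * (1 - s\<^sup>2) + b * (1 - s\<^sup>2)\<^sup>2 + c * (1 - s\<^sup>2) ^ 3 + d * (1 - s\<^sup>2) ^ 4) has_integral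
     4 / 3 * a + 16 / 15 * b + 32 / 35 * c + 256 / 315 * d) {-1..1::real}"
proof -
  define F where "F s = a * (s - s ^ 3 / 3) + b * (s - 2 * s ^ 3 / 3 + s ^ 5 / 5)
    + c * (s - s ^ 3 + 3 * s ^ 5 / 5 - s ^ 7 / 7)
    + d * (s - 4 * s ^ 3 / 3 + 6 * s ^ 5 / 5 - 4 * s ^ 7 / 7 + s ^ 9 / 9)" for s :: real
  have "((\<lambda>s. a * (1 - s\<^sup>2) + b * (1 - s\<^sup>2)\<^sup>2 + c * (1 - s\<^sup>2) ^ 3 + d * (1 - s\<^sup>2) ^ 4) has_integral
      F 1 - F (-1)) {-1..1}"
  proof (rule fundamental_theorem_of_calculus)
    fix s :: real
    have "(F has_real_derivative a * (1 - s\<^sup>2) + b * (1 - s\<^sup>2)\<^sup>2 + c * (1 - s\<^sup>2) ^ 3 + d * (1 - s\<^sup>2) ^ 4) (at s within {-1..1})"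
      unfolding F_def by (auto intro!: derivative_eq_intros) algebra
    then show "(F has_vector_derivative a * (1 - s\<^sup>2) + b * (1 - s\<^sup>2)\<^sup>2 + c * (1 - s\<^sup>2) ^ 3 + d * (1 - s\<^sup>2) ^ 4) (at s within {-1..1})"
      by (simp add: has_real_derivative_iff_has_vector_derivative)
  qed simp
  moreover have "F 1 - F (-1) = 4 / 3 * a + 16 / 15 * b + 32 / 35 * c + 256 / 315 * d"
    by (simp add: F_def field_simps)
  ultimately show ?thesis by simp
qed

text \<open>Radii are written as sqrt r from here on, so that Taylor expansion leaves polynomials in
  r.\<close>

lemma ball_profile_sqrt:
  "ball_profile (sqrt r) = integral {-1..1} (\<lambda>s. cosh (sqrt (r * (1 - s\<^sup>2))) - 1)"
  by (simp add: ball_profile_def real_sqrt_mult)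

lemma ball_profile_sqrt_integrable: "(\<lambda>s. cosh (sqrt (r * (1 - s\<^sup>2))) - 1) integrable_on {-1..1}"
  using ball_profile_integrable[of "sqrt r"] by (simp add: real_sqrt_mult)

lemma one_minus_square_bounds: "s \<in> {-1..1} \<Longrightarrow> 0 \<le> 1 - s\<^sup>2 \<and> 1 - s\<^sup>2 \<le> (1::real)"
  using abs_square_le_1[of s] by (auto simp: abs_le_iff)

lemma ball_profile_ge:
  assumes "0 \<le> r"
  shows "2 * r / 3 + 2 * r\<^sup>2 / 45 + 2 * r ^ 3 / 1575 \<le> ball_profile (sqrt r)"
proof -
  have "(r / 2) * (1 - s\<^sup>2) + (r\<^sup>2 / 24) * (1 - s\<^sup>2)\<^sup>2 + (r ^ 3 / 720) * (1 - s\<^sup>2) ^ 3 + 0 * (1 - s\<^sup>2) ^ 4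
      \<le> cosh (sqrt (r * (1 - s\<^sup>2))) - 1" if s: "s \<in> {-1..1}" for s
    using cosh_sqrt_ge[of "r * (1 - s\<^sup>2)"] one_minus_square_bounds[OF s] assms by (simp add: power_mult_distrib)
  then have "4 / 3 * (r / 2) + 16 / 15 * (r\<^sup>2 / 24) + 32 / 35 * (r ^ 3 / 720) + 256 / 315 * 0
      \<le> integral {-1..1} (\<lambda>s. cosh (sqrt (r * (1 - s\<^sup>2))) - 1)"
    by (intro has_integral_le[OF has_integral_even_powers integrable_integral[OF ball_profile_sqrt_integrable]])
  then show ?thesis by (simp add: ball_profile_sqrt)
qed

lemma ball_profile_le:
  assumes "0 \<le> r" "r \<le> 1"
  shows "ball_profile (sqrt r) \<le> 2 * r / 3 + 2 * r\<^sup>2 / 45 + 2 * r ^ 3 / 1575 + 2 * r ^ 4 / 33075"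
proof -
  have "cosh (sqrt (r * (1 - s\<^sup>2))) - 1 \<le>
      (r / 2) * (1 - s\<^sup>2) + (r\<^sup>2 / 24) * (1 - s\<^sup>2)\<^sup>2 + (r ^ 3 / 720) * (1 - s\<^sup>2) ^ 3 + (r ^ 4 / 13440) * (1 - s\<^sup>2) ^ 4"
    if s: "s \<in> {-1..1}" for s
    using cosh_sqrt_le[of "r * (1 - s\<^sup>2)"] one_minus_square_bounds[OF s] assms
    by (simp add: power_mult_distrib mult_le_one)
  then have "integral {-1..1} (\<lambda>s. cosh (sqrt (r * (1 - s\<^sup>2))) - 1)
      \<le> 4 / 3 * (r / 2) + 16 / 15 * (r\<^sup>2 / 24) + 32 / 35 * (r ^ 3 / 720) + 256 / 315 * (r ^ 4 / 13440)"
    by (intro has_integral_le[OF integrable_integral[OF ball_profile_sqrt_integrable] has_integral_even_powers])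
  then show ?thesis by (simp add: ball_profile_sqrt)
qed

lemma two_sqrt: "2 * sqrt r = sqrt (4 * r)"
  by (simp add: real_sqrt_mult)

text \<open>The polynomial is a Taylor polynomial of sinh^2 (sqrt r) = (cosh (2 sqrt r) - 1) / 2,
  the inverse of \<open>radius\<close> in terms of r.\<close>

lemma radius_le:
  assumes "0 \<le> r" "0 \<le> S" "S \<le> r + r\<^sup>2 / 3 + 2 * r ^ 3 / 45"
  shows "radius S \<le> sqrt r"
proof -
  have "1 + 2 * S \<le> cosh (2 * sqrt r)"
    unfolding two_sqrt using cosh_sqrt_ge[of "4 * r"] assms by (simp add: power_mult_distrib)
  then have "arcosh (1 + 2 * S) \<le> arcosh (cosh (2 * sqrt r))" using assms by (subst arcosh_le_iff) auto
  also have "\<dots> = 2 * sqrt r" using assms by (intro arcosh_cosh_real) simp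
  finally show ?thesis by (simp add: radius_def)
qed

text \<open>The extra term r^4 / 105 is the remainder of \<open>cosh_sqrt_le\<close> at 4 r,
  halved.\<close>

lemma radius_ge:
  assumes "0 \<le> r" "4 * r \<le> 1" "r + r\<^sup>2 / 3 + 2 * r ^ 3 / 45 + r ^ 4 / 105 \<le> S"
  shows "sqrt r \<le> radius S"
proof -
  have "cosh (2 * sqrt r) \<le> 1 + 2 * S"
    unfolding two_sqrt using cosh_sqrt_le[of "4 * r"] assms by (simp add: power_mult_distrib)
  then have "arcosh (cosh (2 * sqrt r)) \<le> arcosh (1 + 2 * S)"
    using cosh_real_ge_1[of "2 * sqrt r"] by (subst arcosh_le_iff) (assumption | linarith)+
  moreover have "arcosh (cosh (2 * sqrt r)) = 2 * sqrt r" using assms by (intro arcosh_cosh_real) simp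
  ultimately show ?thesis by (simp add: radius_def)
qed

text \<open>
  If equality holds in \<open>E\<close>, all three displacement terms equal \<open>S\<close> at the point with coordinates
  \<open>P' / d\<close> and \<open>Q' / d\<close> of the proof. If all three terms at \<open>(P, Q)\<close> exceeded \<open>S\<close>, its product with
  \<open>(k', P' / d, Q' / d)\<close> would violate the reversed Cauchy-Schwarz inequality; the hypothesis \<open>E\<close>
  says that \<open>P'\<^sup>2 + Q'\<^sup>2 \<le> S d\<^sup>2\<close>.
\<close>

lemma displacement_le:
  assumes bc: "0 < b" "b < 1" "0 < c" "c < 1" "1 < b\<^sup>2 + c\<^sup>2" and eb: "b = cos \<beta>" "c = cos \<gamma>"
    and S: "0 \<le> S" and YZ: "0 \<le> Y" "Y\<^sup>2 = 1 + S - b\<^sup>2" "0 \<le> Z" "Z\<^sup>2 = 1 + S - c\<^sup>2"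
    and E: "4 * (1 + S) * (Y * Z - b * c)\<^sup>2 \<le> S\<^sup>2 * (3 + 4 * S)"
    and f: "(P, Q) \<in> feasible \<beta> \<gamma>"
  shows "displacement \<beta> \<gamma> (P, Q) \<le> S"
proof (rule ccontr)
  assume "\<not> displacement \<beta> \<gamma> (P, Q) \<le> S"
  define d where "d = sqrt (b\<^sup>2 + c\<^sup>2 - 1)"
  define k where "k = sqrt (1 + P\<^sup>2 + Q\<^sup>2)"
  define K where "K = d * k - P * b - Q * c"
  have K: "K = third_wall \<beta> \<gamma> P Q" by (simp add: third_wall_def K_def d_def k_def eb)
  have dd: "d\<^sup>2 = b\<^sup>2 + c\<^sup>2 - 1" "0 < d" using bc by (simp_all add: d_def)
  have kk: "k\<^sup>2 = 1 + P\<^sup>2 + Q\<^sup>2" "0 < k" by (simp_all add: k_def add_pos_nonneg)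
  have PQ: "0 \<le> P" "0 \<le> Q" "0 \<le> K" using f by (simp_all add: feasible_def K)
  have gt: "S < P\<^sup>2 + Q\<^sup>2" "S < K\<^sup>2 + P\<^sup>2 + 2 * K * P * b" "S < K\<^sup>2 + Q\<^sup>2 + 2 * K * Q * c"
    using \<open>\<not> displacement \<beta> \<gamma> (P, Q) \<le> S\<close>
    by (simp_all add: displacement_def Let_def K[symmetric] eb[symmetric])
  define k' where "k' = sqrt (1 + S)"
  have k': "k'\<^sup>2 = 1 + S" "0 < k'" using S by (simp_all add: k'_def)
  define Y' where "Y' = k * c - Q * d"
  define Z' where "Z' = k * b - P * d"
  have "d\<^sup>2 < c\<^sup>2" "d\<^sup>2 < b\<^sup>2" using dd bc by (auto simp: abs_square_less_1)
  then have db: "d < c" "d < b" using bc by (auto intro: power2_less_imp_less)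
  have "Q\<^sup>2 < k\<^sup>2" "P\<^sup>2 < k\<^sup>2" using kk(1) zero_le_power2[of P] zero_le_power2[of Q] by linarith+
  then have kP: "Q < k" "P < k" using kk(2) by (auto intro: power2_less_imp_less)
  have Ypos: "0 \<le> Y'" "0 \<le> Z'" unfolding Y'_def Z'_def
    using mult_mono[of Q k d c] mult_mono[of P k d b] PQ kP db bc dd kk by (simp_all add: mult.commute)
  have Y'2: "Y'\<^sup>2 = 1 - b\<^sup>2 + (K\<^sup>2 + P\<^sup>2 + 2 * K * P * b)"
    using dd(1) kk(1) unfolding Y'_def K_def by algebra
  have Z'2: "Z'\<^sup>2 = 1 - c\<^sup>2 + (K\<^sup>2 + Q\<^sup>2 + 2 * K * Q * c)"
    using dd(1) kk(1) unfolding Z'_def K_def by algebra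
  have "Y\<^sup>2 < Y'\<^sup>2" "Z\<^sup>2 < Z'\<^sup>2" "k'\<^sup>2 < k\<^sup>2" using gt YZ Y'2 Z'2 k' kk by linarith+
  then have lt: "Y < Y'" "Z < Z'" "k' < k" using Ypos kk by (auto intro: power2_less_imp_less)
  \<comment> \<open>This relation carries the contradiction: replacing k, Y', Z' by the smaller k',
    Y, Z makes the sum drop below d.\<close>
  have sum: "K * k + Q * Y' + P * Z' = d" using dd(1) kk(1) unfolding K_def Y'_def Z'_def by algebra
  have "K * k' \<le> K * k" "Q * Y \<le> Q * Y'" "P * Z \<le> P * Z'" using lt PQ by (auto intro: mult_left_mono)
  moreover have "K * k' < K * k \<or> Q * Y < Q * Y' \<or> P * Z < P * Z'"
  proof (cases "P = 0 \<and> Q = 0")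
    case True
    then show ?thesis using gt(1) S by simp
  next
    case False
    then show ?thesis using lt PQ by auto
  qed
  ultimately have lt_d: "K * k' + Q * Y + P * Z < d" using sum by linarith
  define P' where "P' = k' * b - Z"
  define Q' where "Q' = k' * c - Y"
  have "d * (k * k') - P * P' - Q * Q' < d"
    using lt_d by (simp add: K_def P'_def Q'_def algebra_simps)
  then have main: "d * (k * k' - 1) < P * P' + Q * Q'" by (simp add: algebra_simps)
  have "b\<^sup>2 * Z\<^sup>2 + c\<^sup>2 * Y\<^sup>2 + 2 * (b * c) * (Y * Z) = (1 + S)\<^sup>2 - (Y * Z - b * c)\<^sup>2"
    using YZ by algebra
  then have sq: "(b * Z + c * Y)\<^sup>2 = (1 + S)\<^sup>2 - (Y * Z - b * c)\<^sup>2" by algebra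
  \<comment> \<open>Equivalent to E, because 4 (1 + S)^3 - (2 + 3 S)^2 = S^2 (3 + 4 S).\<close>
  have "(2 + 3 * S)\<^sup>2 \<le> (2 * k' * (b * Z + c * Y))\<^sup>2"
  proof -
    have "(2 * k' * (b * Z + c * Y))\<^sup>2 = 4 * (1 + S) * ((1 + S)\<^sup>2 - (Y * Z - b * c)\<^sup>2)"
      by (simp only: power_mult_distrib sq k'(1)) simp
    then show ?thesis using E by (simp add: algebra_simps power2_eq_square)
  qed
  then have E': "2 + 3 * S \<le> 2 * k' * (b * Z + c * Y)"
    by (rule power2_le_imp_le) (use k' bc YZ in auto)
  have "P'\<^sup>2 + Q'\<^sup>2 = (1 + S) * (b\<^sup>2 + c\<^sup>2) + Z\<^sup>2 + Y\<^sup>2 - 2 * k' * (b * Z + c * Y)"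
    using k'(1) unfolding P'_def Q'_def by algebra
  also have "\<dots> \<le> S * d\<^sup>2" using E' by (simp add: YZ dd algebra_simps)
  finally have PQ': "P'\<^sup>2 + Q'\<^sup>2 \<le> S * d\<^sup>2" .
  have "(P * P' + Q * Q')\<^sup>2 \<le> (P\<^sup>2 + Q\<^sup>2) * (P'\<^sup>2 + Q'\<^sup>2)"
  proof -
    have "(P\<^sup>2 + Q\<^sup>2) * (P'\<^sup>2 + Q'\<^sup>2) - (P * P' + Q * Q')\<^sup>2 = (P * Q' - Q * P')\<^sup>2" by algebra
    then show ?thesis by (metis diff_ge_0_iff_ge zero_le_power2)
  qed
  also have "\<dots> \<le> (k\<^sup>2 - 1) * ((k'\<^sup>2 - 1) * d\<^sup>2)"
    using PQ' by (intro mult_mono) (auto simp: kk k')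
  also have "\<dots> \<le> (d * (k * k' - 1))\<^sup>2"
  proof -
    have "(d * (k * k' - 1))\<^sup>2 - (k\<^sup>2 - 1) * ((k'\<^sup>2 - 1) * d\<^sup>2) = (d * (k - k'))\<^sup>2" by algebra
    then show ?thesis by (metis diff_ge_0_iff_ge zero_le_power2)
  qed
  finally have "P * P' + Q * Q' \<le> \<bar>d * (k * k' - 1)\<bar>" by (metis power2_abs abs_ge_self order_trans power2_le_imp_le abs_ge_zero)
  moreover have "1 * 1 \<le> k * k'" using kk k' S by (intro mult_mono) (auto simp: k_def k'_def)
  ultimately show False using main dd by simp
qed

text \<open>Expands polynomials into monomials, so that estimates become linear in products such as
  \<open>s * S\<close>.\<close>

lemmas poly_norm = algebra_simps power2_eq_square add_divide_distrib diff_divide_distrib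
  times_divide_eq_left times_divide_eq_right mult_1_left mult_1_right

text \<open>0.5237 is 3.1422 / 6, and the Taylor polynomial of degree 5 with its remainder shows sin
  0.5237 > 1/2 = sin (pi / 6).\<close>

lemma pi_less_31422: "pi < 31422 / 10000"
proof (rule ccontr)
  let ?x = "5237 / 10000 :: real"
  assume "\<not> pi < 31422 / 10000"
  then have "?x \<le> pi / 6" by simp
  then have le: "sin ?x \<le> sin (pi / 6)" by (intro sin_monotone_2pi_le) (use pi_gt_zero in auto)
  have "(\<Sum>m<7. sin_coeff m * ?x ^ m) = ?x - ?x ^ 3 / 6 + ?x ^ 5 / 120"
    by (simp add: lessThan_nat_numeral sin_coeff_def fact_numeral)
  then have "\<bar>sin ?x - (?x - ?x ^ 3 / 6 + ?x ^ 5 / 120)\<bar> \<le> inverse (fact 7) * \<bar>?x\<bar> ^ 7"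
    using Maclaurin_sin_bound[of ?x 7] by (simp only:)
  then have "(?x - ?x ^ 3 / 6 + ?x ^ 5 / 120) - inverse (fact 7) * \<bar>?x\<bar> ^ 7 \<le> sin ?x"
    unfolding abs_le_iff by linarith
  moreover have "1 / 2 < (?x - ?x ^ 3 / 6 + ?x ^ 5 / 120) - inverse (fact 7) * \<bar>?x\<bar> ^ 7"
    by (simp add: fact_numeral power_divide)
  ultimately show False using le by (simp add: sin_30)
qed

text \<open>From 3 < pi < 3.1422 the argument lies between 1.5 a and 1.5711 a. The quintic Taylor
  term is absorbed by a^5 \<le> a^3, and the cubic coefficients are rounded.\<close>

lemma sin_bounds:
  fixes a :: real
  assumes "0 \<le> a" "a \<le> 1"
  shows "sin (a * pi / 2) \<le> 15711 / 10000 * a - 12 / 25 * a ^ 3" "3 / 2 * a - 13 / 20 * a ^ 3 \<le> sin (a * pi / 2)"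
proof -
  define z where "z = a * pi / 2"
  have "a * 3 \<le> a * pi" "a * pi \<le> a * (31422 / 10000)"
    by (rule mult_left_mono[OF less_imp_le[OF pi_gt3] assms(1)] mult_left_mono[OF less_imp_le[OF pi_less_31422] assms(1)])+
  then have z: "3 / 2 * a \<le> z" "z \<le> 15711 / 10000 * a" unfolding z_def by linarith+
  have z0: "0 \<le> z" using assms by (simp add: z_def)
  have e: "(\<Sum>m<5. sin_coeff m * z ^ m) = z - z ^ 3 / 6" "(\<Sum>m<3. sin_coeff m * z ^ m) = z"
    by (simp_all add: lessThan_nat_numeral sin_coeff_def fact_numeral)
  have s: "\<bar>sin z - (z - z ^ 3 / 6)\<bar> \<le> z ^ 5 / 120" "\<bar>sin z - z\<bar> \<le> z ^ 3 / 6"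
    using Maclaurin_sin_bound[of z 5] Maclaurin_sin_bound[of z 3] z0 unfolding e by (simp_all add: fact_numeral)
  have "(3 / 2 * a) ^ 3 \<le> z ^ 3" "z ^ 3 \<le> (15711 / 10000 * a) ^ 3" "z ^ 5 \<le> (15711 / 10000 * a) ^ 5"
    using z z0 assms by (auto intro!: power_mono simp del: power_mult_distrib)
  moreover have "(15711 / 10000) ^ 3 * a ^ 3 \<le> 388 / 100 * a ^ 3" "(15711 / 10000) ^ 5 * a ^ 5 \<le> 96 / 10 * a ^ 5"
    using assms(1) by (auto intro!: mult_right_mono simp: power_divide)
  moreover have "(3 / 2) ^ 3 * a ^ 3 = 27 / 8 * a ^ 3" by (simp add: power_divide)
  ultimately have z3: "27 / 8 * a ^ 3 \<le> z ^ 3" "z ^ 3 \<le> 388 / 100 * a ^ 3" "z ^ 5 \<le> 96 / 10 * a ^ 5"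
    unfolding power_mult_distrib by linarith+
  have "a ^ 5 \<le> a ^ 3" using assms by (intro power_decreasing) auto
  with s(1) z z3 show "sin (a * pi / 2) \<le> 15711 / 10000 * a - 12 / 25 * a ^ 3"
    unfolding z_def[symmetric] abs_le_iff by linarith
  from s(2) z z3 zero_le_power[OF assms(1), of 3] show "3 / 2 * a - 13 / 20 * a ^ 3 \<le> sin (a * pi / 2)"
    unfolding z_def[symmetric] abs_le_iff by linarith
qed

lemma displacement_swap: "displacement \<beta> \<gamma> (P, Q) = displacement \<gamma> \<beta> (Q, P)"
proof -
  have "third_wall \<beta> \<gamma> P Q = third_wall \<gamma> \<beta> Q P" by (simp add: third_wall_def add.commute add.left_commute)
  then show ?thesis by (simp add: displacement_def Let_def add.commute min.commute)
qed

lemma feasible_swap: "(P, Q) \<in> feasible \<beta> \<gamma> \<longleftrightarrow> (Q, P) \<in> feasible \<gamma> \<beta>"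
  by (auto simp: feasible_def third_wall_def add.commute add.left_commute algebra_simps)

text \<open>All powers of a above the first are replaced by M a, so one numerical inequality in q
  settles the density for every a up to M.\<close>

lemma profile_poly_le:
  fixes q a M \<delta> :: real
  assumes "0 \<le> q" "0 \<le> a" "a \<le> M" "M \<le> 1"
    and "2 * q / 3 + (2 * q\<^sup>2 / 45 + 2 * q ^ 3 / 1575 + 2 * q ^ 4 / 33075) * M \<le> \<delta>"
  shows "2 * (q * a) / 3 + 2 * (q * a)\<^sup>2 / 45 + 2 * (q * a) ^ 3 / 1575 + 2 * (q * a) ^ 4 / 33075 \<le> \<delta> * a"
proof -
  have "a ^ 2 \<le> M * a" using assms by (simp add: power2_eq_square mult_right_mono)
  moreover have "a ^ 3 \<le> a ^ 2" "a ^ 4 \<le> a ^ 2" using assms by (auto intro: power_decreasing)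
  ultimately have "(2 * q\<^sup>2 / 45) * a ^ 2 + (2 * q ^ 3 / 1575) * a ^ 3 + (2 * q ^ 4 / 33075) * a ^ 4
      \<le> (2 * q\<^sup>2 / 45) * (M * a) + (2 * q ^ 3 / 1575) * (M * a) + (2 * q ^ 4 / 33075) * (M * a)"
    using assms(1) by (intro add_mono mult_left_mono) auto
  moreover have "(2 * q / 3 + (2 * q\<^sup>2 / 45 + 2 * q ^ 3 / 1575 + 2 * q ^ 4 / 33075) * M) * a \<le> \<delta> * a"
    using assms by (intro mult_right_mono) auto
  ultimately show ?thesis by (simp add: power_mult_distrib algebra_simps)
qed

section \<open>Upper bounds for the displacement\<close>

context acute_pair
begin

text \<open>The area of the Dirichlet cell in units of pi, the parameter in which infinitely many
  pairs are estimated together.\<close>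

definition defect :: real where
  "defect = 1 - 2 * (\<beta> + \<gamma>) / pi"

lemma defect_pos: "0 < defect"
  using acute(3) pi_gt_zero by (simp add: defect_def divide_less_eq)

lemma defect_le_1: "defect \<le> 1"
  using acute by (simp add: defect_def)

lemma defect_angles: "pi - 2 * \<beta> - 2 * \<gamma> = pi * defect"
  by (simp add: defect_def field_simps)

text \<open>The condition on Y Z - b c becomes two polynomial inequalities without square roots, at
  the price of a constant \<theta>. As S tends to 0 the admissible \<theta> reach up to sqrt 3 /
  2.\<close>

lemma displacement_le_of_window:
  assumes S: "0 \<le> S" and \<theta>: "0 \<le> \<theta>" "4 * (1 + S) * \<theta>\<^sup>2 \<le> 3 + 4 * S"
    and L: "(cos \<beta> * cos \<gamma> - \<theta> * S)\<^sup>2 \<le> (1 + S - (cos \<beta>)\<^sup>2) * (1 + S - (cos \<gamma>)\<^sup>2)"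
    and U: "(1 + S - (cos \<beta>)\<^sup>2) * (1 + S - (cos \<gamma>)\<^sup>2) \<le> (cos \<beta> * cos \<gamma> + \<theta> * S)\<^sup>2"
    and x: "x \<in> feasible \<beta> \<gamma>"
  shows "displacement \<beta> \<gamma> x \<le> S"
proof -
  define Y where "Y = sqrt (1 + S - (cos \<beta>)\<^sup>2)"
  define Z where "Z = sqrt (1 + S - (cos \<gamma>)\<^sup>2)"
  have "0 < sin \<beta>" "0 < sin \<gamma>" using acute by (auto intro!: sin_gt_zero)
  then have lt1: "(cos \<beta>)\<^sup>2 < 1" "(cos \<gamma>)\<^sup>2 < 1" by (auto simp: cos_squared_eq)
  then have YZ: "0 \<le> Y" "Y\<^sup>2 = 1 + S - (cos \<beta>)\<^sup>2" "0 \<le> Z" "Z\<^sup>2 = 1 + S - (cos \<gamma>)\<^sup>2"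
    using S by (simp_all add: Y_def Z_def)
  have P: "(1 + S - (cos \<beta>)\<^sup>2) * (1 + S - (cos \<gamma>)\<^sup>2) = (Y * Z)\<^sup>2" by (simp add: YZ power_mult_distrib)
  have "cos \<beta> * cos \<gamma> - \<theta> * S \<le> Y * Z"
    using L YZ unfolding P by (auto intro: power2_le_imp_le)
  moreover have "Y * Z \<le> cos \<beta> * cos \<gamma> + \<theta> * S"
    using U YZ cos_pos \<theta> S unfolding P by (auto intro!: power2_le_imp_le[of "Y * Z"])
  ultimately have "\<bar>Y * Z - cos \<beta> * cos \<gamma>\<bar> \<le> \<theta> * S" by (simp add: abs_le_iff)
  then have "(Y * Z - cos \<beta> * cos \<gamma>)\<^sup>2 \<le> (\<theta> * S)\<^sup>2"
    using power_mono[of "\<bar>Y * Z - cos \<beta> * cos \<gamma>\<bar>" "\<theta> * S" 2] by simp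
  then have "4 * (1 + S) * (Y * Z - cos \<beta> * cos \<gamma>)\<^sup>2 \<le> 4 * (1 + S) * (\<theta> * S)\<^sup>2"
    using S by (intro mult_left_mono) auto
  also have "\<dots> = S\<^sup>2 * (4 * (1 + S) * \<theta>\<^sup>2)" by (simp add: power_mult_distrib)
  also have "\<dots> \<le> S\<^sup>2 * (3 + 4 * S)" using \<theta>(2) by (intro mult_left_mono) auto
  finally have E: "4 * (1 + S) * (Y * Z - cos \<beta> * cos \<gamma>)\<^sup>2 \<le> S\<^sup>2 * (3 + 4 * S)" .
  obtain P Q where PQ: "x = (P, Q)" by (cases x)
  have "cos \<beta> < 1" "cos \<gamma> < 1" using lt1 cos_pos by (auto simp: power2_less_imp_less[of _ "1::real"] intro!: power2_less_imp_less[of _ "1::real"])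
  then show ?thesis
    using displacement_le[OF cos_pos(1) _ cos_pos(2) _ cos_sq_gt_1 refl refl S YZ E, of P Q] x unfolding PQ by blast
qed

lemma angle_sum: "cos (\<beta> + \<gamma>) = sin (defect * pi / 2)"
proof -
  have "\<beta> + \<gamma> = pi / 2 - defect * pi / 2" using defect_angles by (simp add: field_simps)
  then show ?thesis by (simp add: sin_cos_eq)
qed

text \<open>Eliminates the individual cosines in favour of their product and cos (\<beta> +
  \<gamma>), which depends on the defect alone by \<open>angle_sum\<close>.\<close>

lemma shifted_product:
  "(x - (cos \<beta>)\<^sup>2) * (x - (cos \<gamma>)\<^sup>2) = x\<^sup>2 - x * (1 + 2 * (cos \<beta> * cos \<gamma>) * cos (\<beta> + \<gamma>) - (cos (\<beta> + \<gamma>))\<^sup>2) + (cos \<beta> * cos \<gamma>)\<^sup>2"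
proof -
  have "(sin \<beta>)\<^sup>2 = 1 - (cos \<beta>)\<^sup>2" "(sin \<gamma>)\<^sup>2 = 1 - (cos \<gamma>)\<^sup>2" by (simp_all add: sin_squared_eq)
  then show ?thesis unfolding cos_add by algebra
qed

text \<open>The window constant is 0.883, admissible from S = 0.1348 on, and 1.883 is 1 + 0.883.
  Since both angles are at most pi / 4, v = s + cos (\<beta> - \<gamma>) lies between s + 0.7 and s
  + 1.\<close>

lemma displacement_le_of_ge_4:
  assumes p4: "\<beta> \<le> pi / 4" "\<gamma> \<le> pi / 4" and a: "1 / 6 \<le> defect"
    and S: "(76 / 100) * defect \<le> S" "S \<le> (795 / 1000) * defect + (22 / 100) * defect\<^sup>2" "(1348 / 10000) \<le> S"
      "(15711 / 10000) * defect - 12 / 25 * defect ^ 3 \<le> (1883 / 1000) * S"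
    and x: "x \<in> feasible \<beta> \<gamma>"
  shows "displacement \<beta> \<gamma> x \<le> S"
proof -
  define a where "a = defect"
  define s where "s = cos (\<beta> + \<gamma>)"
  define v where "v = 2 * (cos \<beta> * cos \<gamma>)"
  have a1: "1 / 6 \<le> a" "a \<le> 1" using a defect_le_1 unfolding a_def by simp_all
  have s: "s \<le> (15711 / 10000) * a - (48 / 100) * a ^ 3" "(15 / 10) * a - (65 / 100) * a ^ 3 \<le> s"
    using sin_bounds[of a] a1 unfolding s_def angle_sum a_def by auto
  have "a ^ 3 \<le> a ^ 1" using a1 by (intro power_decreasing) auto
  then have s2: "(85 / 100) * a \<le> s" using s(2) by simp
  have v: "v = s + cos (\<beta> - \<gamma>)" by (simp add: v_def s_def cos_add cos_diff)
  then have v1: "v \<le> 1 + s" by simp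
  have "cos (pi / 4) \<le> cos \<bar>\<beta> - \<gamma>\<bar>"
  proof (rule cos_monotone_0_pi_le)
    show "\<bar>\<beta> - \<gamma>\<bar> \<le> pi / 4" using acute(1,2) p4 unfolding abs_le_iff by linarith
  qed (use pi_gt_zero in auto)
  moreover have "(7 / 10) \<le> sqrt 2 / 2" using real_le_rsqrt[of "(14 / 10)" 2] by (simp add: power2_eq_square)
  ultimately have v2: "s + (7 / 10) \<le> v" using v by (simp add: cos_45)
  have S': "(76 / 100) * a \<le> S" "S \<le> (795 / 1000) * a + (22 / 100) * a\<^sup>2" "s \<le> (1883 / 1000) * S" using S s(1) by (simp_all add: a_def)
  have S0: "0 \<le> S" "0 \<le> s" using S(3) s2 a1 by simp_all
  have aS: "(85 / 100) * a * S \<le> s * S" using s2 S0 by (intro mult_right_mono) auto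
  have aa: "(76 / 100) * a\<^sup>2 \<le> a * S" using mult_left_mono[OF S'(1), of a] a1 by (simp add: power2_eq_square)
  have a2: "a\<^sup>2 \<le> a" using a1 by (simp add: power2_eq_square)
  have key: "(883 / 1000) * S \<le> s * (1 + S)" using S'(2) s2 aS aa a1 zero_le_power2[of a]
    by (simp only: poly_norm; linarith)
  show ?thesis
  proof (rule displacement_le_of_window[OF S0(1) _ _ _ _ x])
    show "4 * (1 + S) * ((883 / 1000)::real)\<^sup>2 \<le> 3 + 4 * S" using S(3) by (simp add: power2_eq_square algebra_simps)
    have e: "(1 + S - (cos \<beta>)\<^sup>2) * (1 + S - (cos \<gamma>)\<^sup>2) = (1 + S)\<^sup>2 - (1 + S) * (1 + v * s - s\<^sup>2) + (v / 2)\<^sup>2"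
      unfolding shifted_product by (simp add: v_def s_def)
    have f: "cos \<beta> * cos \<gamma> = v / 2" by (simp add: v_def)
    \<comment> \<open>The difference of the two sides of the goal is affine in v. Its value at v = 1
      + s is this product, where 0.117 = 1 - 0.883; the next product is the change from there to the
      actual v.\<close>
    have "0 \<le> ((1883 / 1000) * S - s) * (1 + (117 / 1000) * S)" using S' S0 by (intro mult_nonneg_nonneg) auto
    moreover have "0 \<le> (1 + s - v) * (s * (1 + S) - (883 / 1000) * S)" using v1 key by (intro mult_nonneg_nonneg) auto
    ultimately show "(cos \<beta> * cos \<gamma> - (883 / 1000) * S)\<^sup>2 \<le> (1 + S - (cos \<beta>)\<^sup>2) * (1 + S - (cos \<gamma>)\<^sup>2)"
      unfolding e f by (simp only: poly_norm; linarith)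
    \<comment> \<open>Again affine in v, now with nonnegative slope, so v may be replaced by its
      lower bound s + 0.7.\<close>
    have "0 \<le> (v - s - (7 / 10)) * (s * (1 + S) + (883 / 1000) * S)" using v2 S0 by (intro mult_nonneg_nonneg) auto
    moreover have "S \<le> (1015 / 1000) * a" using S'(2) a2 by simp
    moreover from this have "S * S \<le> (1015 / 1000) * a * S" using S0 by (intro mult_right_mono) auto
    moreover have "0 \<le> s * S" using S0 by simp
    ultimately show "(1 + S - (cos \<beta>)\<^sup>2) * (1 + S - (cos \<gamma>)\<^sup>2) \<le> (cos \<beta> * cos \<gamma> + (883 / 1000) * S)\<^sup>2"
      unfolding e f using aS s2 a1 by (simp only: poly_norm; linarith)
  qed simp
qed

text \<open>For small defects S is too small for the constant 0.883; 0.87 is admissible from S =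
  0.029 on. In return cos \<beta> = 1/2, and c lies between 0.866 and 0.86603 + s / 2.\<close>

lemma displacement_le_of_3:
  assumes p3: "\<beta> = pi / 3" and a: "1 / 21 \<le> defect"
    and S: "(79 / 100) * defect + (2 / 10) * defect\<^sup>2 \<le> S" "S \<le> (79 / 100) * defect + (22 / 100) * defect\<^sup>2"
    and x: "x \<in> feasible \<beta> \<gamma>"
  shows "displacement \<beta> \<gamma> x \<le> S"
proof -
  define a where "a = defect"
  define s where "s = cos (\<beta> + \<gamma>)"
  define c where "c = cos \<gamma>"
  have b: "cos \<beta> = 1 / 2" by (simp add: p3 cos_60)
  have "a \<le> 1 / 3" using acute(2) unfolding a_def unfolding defect_def unfolding p3
    by (simp add: add_divide_distrib distrib_left)
  then have a1: "1 / 21 \<le> a" "a \<le> 1 / 3" using a by (simp_all add: a_def)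
  have s: "s \<le> (15711 / 10000) * a - (48 / 100) * a ^ 3" "(15 / 10) * a - (65 / 100) * a ^ 3 \<le> s"
    using sin_bounds[of a] a1 unfolding s_def angle_sum a_def by auto
  have "a * a\<^sup>2 \<le> a * (1 / 9)"
    using power_mono[OF a1(2), of 2] a1 by (intro mult_left_mono) (auto simp: power_divide)
  then have "a ^ 3 \<le> a / 9" by (simp add: power3_eq_cube power2_eq_square)
  then have s2: "(1427 / 1000) * a \<le> s" using s(2) a1 by linarith
  have "0 \<le> a ^ 3" using a1 by simp
  then have s1: "s \<le> (15711 / 10000) * a" using s(1) by linarith
  have c1: "(75 / 100) < c\<^sup>2" using cos_sq_gt_1 by (simp add: b c_def power_divide)
  then have "(866 / 1000)\<^sup>2 \<le> c\<^sup>2" by (simp add: power2_eq_square)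
  then have c2: "(866 / 1000) \<le> c" using cos_pos by (auto simp: c_def intro: power2_le_imp_le)
  \<comment> \<open>Both sides are the square of sin \<beta> sin \<gamma>; with cos \<beta> = 1/2
    this is a quadratic equation between c and s.\<close>
  have "(1 - (cos \<beta>)\<^sup>2) * (1 - (cos \<gamma>)\<^sup>2) = (cos \<beta> * cos \<gamma> - s)\<^sup>2"
    unfolding shifted_product[of 1] s_def[symmetric] by (simp add: power2_eq_square algebra_simps)
  then have "(c - s / 2)\<^sup>2 + (75 / 100) * s\<^sup>2 = (75 / 100)" unfolding b c_def[symmetric] by (simp only: poly_norm; linarith)
  then have "(c - s / 2)\<^sup>2 \<le> 75 / 100" using zero_le_power2[of s] by linarith
  also have "\<dots> \<le> (86603 / 100000)\<^sup>2" by (simp add: power2_eq_square)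
  finally have "(c - s / 2)\<^sup>2 \<le> (86603 / 100000)\<^sup>2" .
  then have c3: "c - s / 2 \<le> (86603 / 100000)" by (rule power2_le_imp_le) simp
  have S': "(79 / 100) * a + (2 / 10) * a\<^sup>2 \<le> S" "S \<le> (79 / 100) * a + (22 / 100) * a\<^sup>2" using S by (simp_all add: a_def)
  have a2: "a\<^sup>2 \<le> a / 3" using mult_left_mono[OF a1(2), of a] a1 by (simp add: power2_eq_square)
  have Sa: "S \<le> (864 / 1000) * a" "(79 / 100) * a \<le> S" using S' a2 zero_le_power2[of a] by simp_all
  have S0: "0 \<le> S" "0 \<le> s" using Sa s2 a1 by simp_all
  have sx: "(1427 / 1000) * a * S \<le> s * S" "s * S \<le> (15711 / 10000) * a * S" using mult_right_mono[OF s1 S0(1)] mult_right_mono[OF s2 S0(1)] by simp_all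
  have aS: "0 \<le> a * S" "(79 / 100) * a\<^sup>2 \<le> a * S" using mult_left_mono[OF Sa(2), of a] a1 S0 by (auto simp: power2_eq_square)
  have key: "87 / 100 * S \<le> s * (1 + S)" using s2 Sa sx(1) aS(1) by (simp only: poly_norm; linarith)
  have SS: "S * S \<le> (864 / 1000) * a * S" using Sa S0 by (intro mult_right_mono) auto
  show ?thesis
  proof (rule displacement_le_of_window[OF S0(1) _ _ _ _ x])
    show "4 * (1 + S) * ((87 / 100)::real)\<^sup>2 \<le> 3 + 4 * S" using Sa a1 by (simp add: power2_eq_square algebra_simps)
    have e: "(1 + S - (cos \<beta>)\<^sup>2) * (1 + S - (cos \<gamma>)\<^sup>2) = (1 + S)\<^sup>2 - (1 + S) * (1 + c * s - s\<^sup>2) + (c / 2)\<^sup>2"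
      unfolding shifted_product by (simp add: b s_def c_def)
    have f: "cos \<beta> * cos \<gamma> = c / 2" by (simp add: b c_def)
    have "0 \<le> ((86603 / 100000) + s / 2 - c) * (s * (1 + S) - (87 / 100) * S)"
      using c3 key by (intro mult_nonneg_nonneg) simp_all
    moreover have "(s * (1 + S)) * ((86603 / 100000) - s / 2) \<le> ((15711 / 10000) * a * (1 + S)) * ((86603 / 100000) - (7135 / 10000) * a)"
      using s1 s2 S0 a1 by (intro mult_mono) auto
    moreover have "a * S \<le> 864 / 1000 * a\<^sup>2" using mult_left_mono[OF Sa(1), of a] a1 by (simp add: power2_eq_square)
    moreover have "0 \<le> S * S" "0 \<le> a * (a * S)" using a1 S0 by simp_all
    ultimately show "(cos \<beta> * cos \<gamma> - (87 / 100) * S)\<^sup>2 \<le> (1 + S - (cos \<beta>)\<^sup>2) * (1 + S - (cos \<gamma>)\<^sup>2)"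
      unfolding e f using S'(1) sx aS a1 by (simp only: poly_norm; linarith)
    have "0 \<le> (c - (866 / 1000)) * (s * (1 + S) + (87 / 100) * S)" using c2 S0 by (intro mult_nonneg_nonneg) auto
    moreover have "0 \<le> ((5237 / 10000) - s) * (s * (1 + S))" using s1 a1 S0 by (intro mult_nonneg_nonneg) auto
    ultimately show "(1 + S - (cos \<beta>)\<^sup>2) * (1 + S - (cos \<gamma>)\<^sup>2) \<le> (cos \<beta> * cos \<gamma> + (87 / 100) * S)\<^sup>2"
      unfolding e f using sx(1) s2 Sa SS aS by (simp only: poly_norm; linarith)
  qed simp
qed

end

text \<open>For x = pi / 5 the relation cos 2x = - cos 3x is a cubic in cos x with the root -1;
  comparison with cos (pi / 3) selects the positive one of the other two.\<close>

lemma cos_pi_fifth: "cos (pi / 5) = (1 + sqrt 5) / 4"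
proof -
  define c where "c = cos (pi / 5)"
  have c0: "0 < c" unfolding c_def by (intro cos_gt_zero) (use pi_gt_zero in auto)
  have "2 * (pi / 5) = pi - 3 * (pi / 5)" by simp
  then have "cos (2 * (pi / 5)) = - cos (3 * (pi / 5))" by (simp only: cos_pi_minus)
  then have "2 * c\<^sup>2 - 1 = - (4 * c ^ 3 - 3 * c)" by (simp only: cos_double_cos cos_treble_cos c_def)
  then have "(c + 1) * ((4 * c - 1)\<^sup>2 - 5) = 0" by (simp add: power2_eq_square power3_eq_cube algebra_simps)
  then have e: "(4 * c - 1)\<^sup>2 = 5" using c0 by simp
  have "0 \<le> 4 * c - 1"
  proof -
    have "cos (pi / 3) < c" unfolding c_def by (intro cos_monotone_0_pi) (use pi_gt_zero in auto)
    then show ?thesis by (simp add: cos_60)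
  qed
  with e have "sqrt 5 = 4 * c - 1" by (rule real_sqrt_unique)
  then show ?thesis by (simp add: c_def)
qed

lemma cos_bounds_4_5:
  defines "b \<equiv> cos (pi / 4)" and "c \<equiv> cos (pi / 5)"
  shows "70710678 / 100000000 \<le> b" "b \<le> 70710679 / 100000000" "b\<^sup>2 = 1 / 2"
    "80901699 / 100000000 \<le> c" "c \<le> 80901700 / 100000000" "c\<^sup>2 = (2 * c + 1) / 4"
proof -
  have "141421356 / 100000000 \<le> sqrt 2" "sqrt 2 \<le> 141421358 / 100000000"
    "223606796 / 100000000 \<le> sqrt 5" "sqrt 5 \<le> 223606800 / 100000000"
    by (rule real_le_rsqrt real_le_lsqrt; simp add: power_divide)+
  then show "70710678 / 100000000 \<le> b" "b \<le> 70710679 / 100000000"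
      "80901699 / 100000000 \<le> c" "c \<le> 80901700 / 100000000"
    unfolding b_def c_def cos_45 cos_pi_fifth add_divide_distrib by linarith+
  show "b\<^sup>2 = 1 / 2" by (simp add: b_def cos_45 power_divide)
  show "c\<^sup>2 = (2 * c + 1) / 4" by (simp add: c_def cos_pi_fifth power_divide power2_sum field_simps)
qed

text \<open>
  Numerically the maximal displacement for \<open>{4, 5}\<close> is \<open>0.0827148\<dots>\<close>; the point is a rounding of the
  maximizer.
\<close>

lemma good_point_4_5:
  defines "x \<equiv> (2070724 / 10000000, 1995889 / 10000000)"
  shows "x \<in> feasible (pi / 4) (pi / 5)" "827145 / 10000000 \<le> displacement (pi / 4) (pi / 5) x"
proof -
  define P Q where "P = (2070724 / 10000000 :: real)" and "Q = (1995889 / 10000000 :: real)"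
  define b c where "b = cos (pi / 4)" and "c = cos (pi / 5)"
  note bc = cos_bounds_4_5[folded b_def c_def]
  define K where "K = third_wall (pi / 4) (pi / 5) P Q"
  have d: "39307568 / 100000000 \<le> sqrt (b\<^sup>2 + c\<^sup>2 - 1)"
  proof (rule real_le_rsqrt)
    have "(39307568 / 100000000)\<^sup>2 \<le> (1 / 2 + (2 * (80901699 / 100000000) + 1) / 4 - 1 :: real)" by (simp add: power_divide)
    also have "\<dots> \<le> b\<^sup>2 + c\<^sup>2 - 1" unfolding bc(3,6) using bc(4) by simp
    finally show "(39307568 / 100000000)\<^sup>2 \<le> b\<^sup>2 + c\<^sup>2 - 1" .
  qed
  have k: "104053565 / 100000000 \<le> sqrt (1 + P\<^sup>2 + Q\<^sup>2)"
    by (rule real_le_rsqrt) (simp add: P_def Q_def power_divide)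
  have "(39307568 / 100000000) * (104053565 / 100000000) \<le> sqrt (b\<^sup>2 + c\<^sup>2 - 1) * sqrt (1 + P\<^sup>2 + Q\<^sup>2)"
    by (rule mult_mono[OF d k]) (use d in linarith, simp)
  moreover have "P * b \<le> P * (70710679 / 100000000)" "Q * c \<le> Q * (80901700 / 100000000)"
    using bc by (auto intro!: mult_left_mono simp: P_def Q_def)
  ultimately have K: "1011159 / 10000000 \<le> K"
    unfolding K_def third_wall_def b_def[symmetric] c_def[symmetric] by (simp add: P_def Q_def)
  show "x \<in> feasible (pi / 4) (pi / 5)"
    using K unfolding K_def by (simp add: feasible_def x_def P_def Q_def)
  have K2: "(1011159 / 10000000)\<^sup>2 \<le> K\<^sup>2" using K by (intro power_mono) auto
  have "(1011159 / 10000000) * P * (70710678 / 100000000) \<le> K * P * b"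
    using K bc by (intro mult_mono) (auto simp: P_def)
  then have 1: "827145 / 10000000 \<le> K\<^sup>2 + P\<^sup>2 + 2 * K * P * b"
    using K2 by (simp add: P_def power_divide)
  have "(1011159 / 10000000) * Q * (80901699 / 100000000) \<le> K * Q * c"
    using K bc by (intro mult_mono) (auto simp: Q_def)
  then have 2: "827145 / 10000000 \<le> K\<^sup>2 + Q\<^sup>2 + 2 * K * Q * c"
    using K2 by (simp add: Q_def power_divide)
  have 3: "827145 / 10000000 \<le> P\<^sup>2 + Q\<^sup>2" by (simp add: P_def Q_def power_divide)
  have x: "x = (P, Q)" by (simp add: x_def P_def Q_def)
  show "827145 / 10000000 \<le> displacement (pi / 4) (pi / 5) x"
    unfolding x displacement_def Let_def prod.case K_def[symmetric] b_def[symmetric] c_def[symmetric]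
    using 1 2 3 by simp
qed

context acute_pair
begin

text \<open>\<theta> is sqrt ((3 + 4 S) / (4 (1 + S))) rounded down, so almost nothing is lost in
  the window, and S lies just above the maximal displacement; hence the cosines to eight
  digits.\<close>

lemma displacement_le_4_5:
  assumes e: "\<beta> = pi / 4" "\<gamma> = pi / 5" and x: "x \<in> feasible \<beta> \<gamma>"
  shows "displacement \<beta> \<gamma> x \<le> 827152 / 10000000"
proof -
  let ?S = "827152 / 10000000 :: real" and ?\<theta> = "8769829 / 10000000 :: real"
  define b c where "b = cos \<beta>" and "c = cos \<gamma>"
  note bc = cos_bounds_4_5[folded e, folded b_def c_def]
  have prod: "b * c \<le> (70710679 / 100000000) * (80901700 / 100000000)" "(70710678 / 100000000) * (80901699 / 100000000) \<le> b * c"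
    by (rule mult_mono; use bc in linarith)+
  have c2: "c\<^sup>2 \<le> (2 * (80901700 / 100000000) + 1) / 4" "(2 * (80901699 / 100000000) + 1) / 4 \<le> c\<^sup>2"
    unfolding bc(6) using bc(4,5) by simp_all
  show ?thesis
  proof (rule displacement_le_of_window[where \<theta> = ?\<theta>, OF _ _ _ _ _ x], unfold b_def[symmetric] c_def[symmetric])
    show "4 * (1 + ?S) * ?\<theta>\<^sup>2 \<le> 3 + 4 * ?S" by (simp add: power_divide)
    have "(b * c - ?\<theta> * ?S)\<^sup>2 \<le> ((70710679 / 100000000) * (80901700 / 100000000) - ?\<theta> * ?S)\<^sup>2"
      using prod by (intro power_mono) auto
    also have "\<dots> \<le> (1 + ?S - 1 / 2) * (1 + ?S - (2 * (80901700 / 100000000) + 1) / 4)" by (simp add: power_divide)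
    also have "\<dots> \<le> (1 + ?S - b\<^sup>2) * (1 + ?S - c\<^sup>2)"
      using c2 unfolding bc(3) by (intro mult_left_mono) auto
    finally show "(b * c - ?\<theta> * ?S)\<^sup>2 \<le> (1 + ?S - b\<^sup>2) * (1 + ?S - c\<^sup>2)" .
    have "(1 + ?S - b\<^sup>2) * (1 + ?S - c\<^sup>2) \<le> (1 + ?S - 1 / 2) * (1 + ?S - (2 * (80901699 / 100000000) + 1) / 4)"
      using c2 unfolding bc(3) by (intro mult_left_mono) auto
    also have "\<dots> \<le> ((70710678 / 100000000) * (80901699 / 100000000) + ?\<theta> * ?S)\<^sup>2" by (simp add: power_divide)
    also have "\<dots> \<le> (b * c + ?\<theta> * ?S)\<^sup>2" using prod by (intro power_mono) auto
    finally show "(1 + ?S - b\<^sup>2) * (1 + ?S - c\<^sup>2) \<le> (b * c + ?\<theta> * ?S)\<^sup>2" .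
  qed auto
qed

end

section \<open>Comparison of the densities\<close>

context hyp_triangle
begin

lemma defect_eq: "defect = 1 - 2 / real p1 - 2 / real p2"
  unfolding defect_def unfolding \<beta>_def \<gamma>_def by (simp add: add_divide_distrib distrib_left)

lemma optimal_density_exists:
  "\<exists>\<delta>\<in>packing_densities rotation_group. \<forall>\<delta>'\<in>packing_densities rotation_group. \<delta>' \<le> \<delta>"
proof -
  obtain x where x: "x \<in> feasible \<beta> \<gamma>" "0 < displacement \<beta> \<gamma> x"
    "\<And>y. y \<in> feasible \<beta> \<gamma> \<Longrightarrow> displacement \<beta> \<gamma> y \<le> displacement \<beta> \<gamma> x"
    using max_displacement by blast
  show ?thesis using optimal_density_eq[OF x] by blast
qed

lemma optimal_density_maximizer:
  obtains x where "x \<in> feasible \<beta> \<gamma>" "0 < displacement \<beta> \<gamma> x"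
    "\<And>y. y \<in> feasible \<beta> \<gamma> \<Longrightarrow> displacement \<beta> \<gamma> y \<le> displacement \<beta> \<gamma> x"
    "optimal_density rotation_group = ball_profile (radius (displacement \<beta> \<gamma> x)) / defect"
proof -
  obtain x where x: "x \<in> feasible \<beta> \<gamma>" "0 < displacement \<beta> \<gamma> x"
    "\<And>y. y \<in> feasible \<beta> \<gamma> \<Longrightarrow> displacement \<beta> \<gamma> y \<le> displacement \<beta> \<gamma> x"
    using max_displacement by blast
  have "optimal_density rotation_group = ball_profile (radius (displacement \<beta> \<gamma> x)) / defect"
    using optimal_density_eq(3)[OF x] unfolding defect_angles by simp
  with x show thesis by (rule that)
qed

text \<open>A certificate for an upper bound: S bounds the displacement, r the squared radius and
  \<delta> the density, with only polynomial inequalities between them.\<close>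

lemma optimal_density_le:
  assumes D: "\<And>x. x \<in> feasible \<beta> \<gamma> \<Longrightarrow> displacement \<beta> \<gamma> x \<le> S"
    and r: "0 \<le> r" "r \<le> 1" "S \<le> r + r\<^sup>2 / 3 + 2 * r ^ 3 / 45"
    and \<delta>: "2 * r / 3 + 2 * r\<^sup>2 / 45 + 2 * r ^ 3 / 1575 + 2 * r ^ 4 / 33075 \<le> \<delta> * defect"
  shows "optimal_density rotation_group \<le> \<delta>"
proof -
  obtain x where x: "x \<in> feasible \<beta> \<gamma>" "0 < displacement \<beta> \<gamma> x"
    and e: "optimal_density rotation_group = ball_profile (radius (displacement \<beta> \<gamma> x)) / defect"
    by (rule optimal_density_maximizer)
  have "radius (displacement \<beta> \<gamma> x) \<le> sqrt r" using x D[OF x(1)] r by (intro radius_le) auto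
  then have "ball_profile (radius (displacement \<beta> \<gamma> x)) \<le> ball_profile (sqrt r)"
    using radius_pos[OF x(2)] by (intro ball_profile_mono) auto
  also have "\<dots> \<le> \<delta> * defect" using ball_profile_le[OF r(1,2)] \<delta> by simp
  finally show ?thesis unfolding e using defect_pos by (simp add: divide_le_eq)
qed

lemma optimal_density_ge:
  assumes x: "x \<in> feasible \<beta> \<gamma>"
    and r: "0 \<le> r" "4 * r \<le> 1" "r + r\<^sup>2 / 3 + 2 * r ^ 3 / 45 + r ^ 4 / 105 \<le> displacement \<beta> \<gamma> x"
    and \<delta>: "\<delta> * defect \<le> 2 * r / 3 + 2 * r\<^sup>2 / 45 + 2 * r ^ 3 / 1575"
  shows "\<delta> \<le> optimal_density rotation_group"
proof -
  obtain y where y: "\<And>z. z \<in> feasible \<beta> \<gamma> \<Longrightarrow> displacement \<beta> \<gamma> z \<le> displacement \<beta> \<gamma> y"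
    and e: "optimal_density rotation_group = ball_profile (radius (displacement \<beta> \<gamma> y)) / defect"
    using optimal_density_maximizer by blast
  have "sqrt r \<le> radius (displacement \<beta> \<gamma> y)" using r y[OF x] by (intro radius_ge) auto
  then have "ball_profile (sqrt r) \<le> ball_profile (radius (displacement \<beta> \<gamma> y))"
    using r by (intro ball_profile_mono) auto
  then have "\<delta> * defect \<le> ball_profile (radius (displacement \<beta> \<gamma> y))"
    using ball_profile_ge[OF r(1)] \<delta> by simp
  then show ?thesis unfolding e using defect_pos by (simp add: le_divide_eq)
qed

lemma optimal_density_le_of_ge_4:
  assumes p4: "4 \<le> p1" "4 \<le> p2" and a: "1 / 6 \<le> defect"
  shows "optimal_density rotation_group \<le> 53975 / 100000"
proof -
  define a where "a = defect"
  \<comment> \<open>The density bound is about 2 q / 3 + 2 q^2 a / 45. The value 0.794 keeps it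
    below 0.53975 up to a = 0.34 but not up to a = 1; for the larger a the smaller q already
    dominates the displacement.\<close>
  define q :: real where "q = (if a \<le> 34 / 100 then 794 / 1000 else 76 / 100)"
  define S where "S = (q * a) + (q * a)\<^sup>2 / 3 + 2 * (q * a) ^ 3 / 45"
  have a1: "1 / 6 \<le> a" "a \<le> 1" using a defect_le_1 unfolding a_def by simp_all
  have q: "76 / 100 \<le> q" "q \<le> 794 / 1000" by (simp_all add: q_def)
  have qa: "0 \<le> q * a" "q * a \<le> 1" using q a1 by (auto intro!: mult_le_one)
  have aa: "a / 6 \<le> a\<^sup>2" "0 \<le> a\<^sup>2" "0 \<le> a ^ 3" using a1 mult_right_mono[OF a1(1), of a] by (simp_all add: power2_eq_square)
  have "76 / 100 * a \<le> S \<and> S \<le> 795 / 1000 * a + 22 / 100 * a\<^sup>2 \<and> 1348 / 10000 \<le> S \<and>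
      15711 / 10000 * a - 12 / 25 * a ^ 3 \<le> 1883 / 1000 * S"
  proof (cases "a \<le> 34 / 100")
    case True
    then have S': "S = 794 / 1000 * a + 630436 / 3000000 * a\<^sup>2 + 1001132368 / 45000000000 * a ^ 3"
      by (simp add: S_def q_def power_mult_distrib power_divide)
    have "a\<^sup>2 / 6 \<le> a ^ 3" "a ^ 3 \<le> 34 / 100 * a\<^sup>2"
      using mult_right_mono[OF a1(1), of "a\<^sup>2"] mult_right_mono[OF True, of "a\<^sup>2"]
      by (simp_all add: power2_eq_square power3_eq_cube)
    then show ?thesis unfolding S' using aa a1 by (simp only: distrib_left, intro conjI; simp only: poly_norm; linarith)
  next
    case False
    then have S': "S = 76 / 100 * a + 5776 / 30000 * a\<^sup>2 + 877952 / 45000000 * a ^ 3"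
      by (simp add: S_def q_def power_mult_distrib power_divide)
    have F: "34 / 100 \<le> a" using False by simp
    have "34 / 100 * a \<le> a\<^sup>2" "34 / 100 * a\<^sup>2 \<le> a ^ 3" "a ^ 3 \<le> a\<^sup>2"
      using mult_right_mono[OF F, of "a"] mult_right_mono[OF F, of "a\<^sup>2"] mult_right_mono[OF a1(2), of "a\<^sup>2"] a1
      by (simp_all add: power2_eq_square power3_eq_cube)
    then show ?thesis unfolding S' using aa a1 F by (simp only: distrib_left, intro conjI; linarith)
  qed
  note S = this
  have p4': "\<beta> \<le> pi / 4" "\<gamma> \<le> pi / 4"
    unfolding \<beta>_def \<gamma>_def using p4 by (intro divide_left_mono; simp)+
  show ?thesis
  proof (rule optimal_density_le[OF _ qa])
    show "displacement \<beta> \<gamma> x \<le> S" if "x \<in> feasible \<beta> \<gamma>" for x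
      using S unfolding a_def by (intro displacement_le_of_ge_4[OF p4' a _ _ _ _ that]) blast+
    show "S \<le> q * a + (q * a)\<^sup>2 / 3 + 2 * (q * a) ^ 3 / 45" by (simp add: S_def)
    show "2 * (q * a) / 3 + 2 * (q * a)\<^sup>2 / 45 + 2 * (q * a) ^ 3 / 1575 + 2 * (q * a) ^ 4 / 33075
        \<le> 53975 / 100000 * defect"
      unfolding a_def[symmetric]
    proof (cases "a \<le> 34 / 100")
      case True
      then have e: "q = 794 / 1000" by (simp add: q_def)
      show "2 * (q * a) / 3 + 2 * (q * a)\<^sup>2 / 45 + 2 * (q * a) ^ 3 / 1575 + 2 * (q * a) ^ 4 / 33075 \<le> 53975 / 100000 * a"
        unfolding e using a1 True by (intro profile_poly_le[where M = "34 / 100"]) (auto simp: power_divide)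
    next
      case False
      then have e: "q = 76 / 100" by (simp add: q_def)
      show "2 * (q * a) / 3 + 2 * (q * a)\<^sup>2 / 45 + 2 * (q * a) ^ 3 / 1575 + 2 * (q * a) ^ 4 / 33075 \<le> 53975 / 100000 * a"
        unfolding e using a1 by (intro profile_poly_le[where M = 1]) (auto simp: power_divide)
    qed
  qed
qed

lemma optimal_density_le_of_3:
  assumes p3: "p1 = 3 \<and> 7 \<le> p2 \<or> p2 = 3 \<and> 7 \<le> p1"
  shows "optimal_density rotation_group \<le> 53975 / 100000"
proof -
  define a where "a = defect"
  \<comment> \<open>The same guess with the single value q = 0.79, which suffices because the defect
    is at most 1/3.\<close>
  define r where "r = 79 / 100 * a"
  define S where "S = r + r\<^sup>2 / 3 + 2 * r ^ 3 / 45"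
  obtain q where q: "7 \<le> q" "defect = 1 / 3 - 2 / real q"
  proof -
    from p3 consider "p1 = 3" "7 \<le> p2" | "p2 = 3" "7 \<le> p1" by blast
    then show thesis
    proof cases
      case 1
      show thesis by (rule that[OF 1(2)], unfold defect_eq) (simp add: 1)
    next
      case 2
      show thesis by (rule that[OF 2(2)], unfold defect_eq) (simp add: 2)
    qed
  qed
  have "2 / real q \<le> 2 / 7" by (rule divide_left_mono) (use q(1) in auto)
  moreover have "0 \<le> 2 / real q" by simp
  ultimately have a: "1 / 21 \<le> defect" "defect \<le> 1 / 3" unfolding q(2) by linarith+
  then have a1: "1 / 21 \<le> a" "a \<le> 1 / 3" by (simp_all add: a_def)
  have S': "S = 79 / 100 * a + 6241 / 30000 * a\<^sup>2 + 986078 / 45000000 * a ^ 3"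
    by (simp add: S_def r_def power_mult_distrib power_divide)
  have "a ^ 3 \<le> a\<^sup>2 * (1 / 3)" using mult_left_mono[OF a1(2), of "a\<^sup>2"] by (simp add: power2_eq_square power3_eq_cube)
  moreover have "0 \<le> a ^ 3" "0 \<le> a\<^sup>2" using a1 by simp_all
  ultimately have S: "79 / 100 * a + 2 / 10 * a\<^sup>2 \<le> S" "S \<le> 79 / 100 * a + 22 / 100 * a\<^sup>2"
    unfolding S' by linarith+
  \<comment> \<open>The estimate assumes that the first angle is pi / 3; the other case exchanges
    the two coordinates.\<close>
  interpret swapped: acute_pair \<gamma> \<beta>
    by unfold_locales (use acute in auto)
  have sw: "swapped.defect = defect" by (simp add: swapped.defect_def defect_def add.commute)
  show ?thesis
  proof (rule optimal_density_le)
    show "displacement \<beta> \<gamma> x \<le> S" if x: "x \<in> feasible \<beta> \<gamma>" for x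
      using p3
    proof
      assume "p1 = 3 \<and> 7 \<le> p2"
      then have "\<beta> = pi / 3" unfolding \<beta>_def by simp
      from displacement_le_of_3[OF this a(1) _ _ x] S show ?thesis by (simp add: a_def)
    next
      assume "p2 = 3 \<and> 7 \<le> p1"
      then have "\<gamma> = pi / 3" unfolding \<gamma>_def by simp
      from swapped.displacement_le_of_3[OF this, of S "prod.swap x"] S a(1) x show ?thesis
        by (cases x) (simp add: sw a_def feasible_swap[of _ _ \<beta>] displacement_swap[of \<beta>])
    qed
    show "0 \<le> r" "r \<le> 1" using a1 by (simp_all add: r_def)
    show "S \<le> r + r\<^sup>2 / 3 + 2 * r ^ 3 / 45" by (simp add: S_def)
    show "2 * r / 3 + 2 * r\<^sup>2 / 45 + 2 * r ^ 3 / 1575 + 2 * r ^ 4 / 33075 \<le> 53975 / 100000 * defect"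
      unfolding r_def a_def[symmetric] using a1 by (intro profile_poly_le[where M = "1 / 3"]) (auto simp: power_divide)
  qed
qed

text \<open>A partner of 3 is at least 7. Among the remaining pairs {4, 6} has the smallest defect,
  1/6.\<close>

lemma optimal_density_le_of_not_4_5:
  assumes "(p1, p2) \<noteq> (4, 5)" "(p1, p2) \<noteq> (5, 4)"
  shows "optimal_density rotation_group \<le> 53975 / 100000"
proof (cases "p1 = 3 \<or> p2 = 3")
  case True
  have "7 \<le> q" if "1 / 3 + 1 / real q < 1 / 2" "0 < q" for q
    using that by (simp add: field_simps)
  then show ?thesis using True p by (intro optimal_density_le_of_3) (auto simp: add.commute)
next
  case False
  then have p4: "4 \<le> p1" "4 \<le> p2" using p by auto
  have inv: "1 / real q \<le> 1 / n" if "n \<le> real q" "0 < n" for q n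
    using that by (intro divide_left_mono) auto
  have "5 \<le> p1 \<and> 5 \<le> p2 \<or> 4 \<le> p1 \<and> 6 \<le> p2 \<or> 6 \<le> p1 \<and> 4 \<le> p2"
  proof -
    have "\<not> (p1 = 4 \<and> p2 = 4)" using p(3) by auto
    then show ?thesis using p4 assms by auto
  qed
  then have "1 / real p1 + 1 / real p2 \<le> 5 / 12"
  proof (elim disjE conjE)
    assume "5 \<le> p1" "5 \<le> p2"
    then show ?thesis using add_mono[OF inv[of 5 p1] inv[of 5 p2]] by simp
  next
    assume "4 \<le> p1" "6 \<le> p2"
    then show ?thesis using add_mono[OF inv[of 4 p1] inv[of 6 p2]] by simp
  next
    assume "6 \<le> p1" "4 \<le> p2"
    then show ?thesis using add_mono[OF inv[of 6 p1] inv[of 4 p2]] by simp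
  qed
  then have "1 / 6 \<le> defect" unfolding defect_eq by linarith
  then show ?thesis by (rule optimal_density_le_of_ge_4[OF p4])
qed

lemma optimal_density_bounds_4_5:
  assumes p45: "p1 = 4" "p2 = 5"
  shows "53975 / 100000 \<le> optimal_density rotation_group" "optimal_density rotation_group < 53976 / 100000"
proof -
  have e: "\<beta> = pi / 4" "\<gamma> = pi / 5" unfolding \<beta>_def \<gamma>_def by (simp_all add: p45)
  have d: "defect = 1 / 10" unfolding defect_eq by (simp add: p45)
  \<comment> \<open>This r is slightly below the squared radius at the good point; the lower bound
    it gives exceeds 0.53975 by less than 10^-6.\<close>
  show "53975 / 100000 \<le> optimal_density rotation_group"
    by (rule optimal_density_ge[OF good_point_4_5(1)[folded e], where r = "805292 / 10000000"])
      (use good_point_4_5(2)[folded e] in \<open>simp_all add: d power_divide\<close>)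
  have "optimal_density rotation_group \<le> 539759 / 1000000"
    by (rule optimal_density_le[where r = "805305 / 10000000", OF displacement_le_4_5[OF e]])
      (simp_all add: d power_divide)
  then show "optimal_density rotation_group < 53976 / 100000" by simp
qed

end

text \<open>The groups themselves are not compared: the optimum depends only on the maximal
  displacement and the defect, both symmetric in the two angles.\<close>

lemma optimal_density_swap:
  assumes "hyp_triangle uA uB uC p1 p2 A B" "hyp_triangle vA vB vC p2 p1 A' B'"
  shows "optimal_density (hyp_triangle.rotation_group uA uB uC) = optimal_density (hyp_triangle.rotation_group vA vB vC)"
proof -
  interpret u: hyp_triangle uA uB uC p1 p2 A B by fact
  interpret v: hyp_triangle vA vB vC p2 p1 A' B' by fact
  have e: "v.\<beta> = u.\<gamma>" "v.\<gamma> = u.\<beta>"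
    unfolding u.\<beta>_def u.\<gamma>_def v.\<beta>_def v.\<gamma>_def by simp_all
  obtain x where x: "x \<in> feasible u.\<beta> u.\<gamma>" "\<And>y. y \<in> feasible u.\<beta> u.\<gamma> \<Longrightarrow> displacement u.\<beta> u.\<gamma> y \<le> displacement u.\<beta> u.\<gamma> x"
    "optimal_density u.rotation_group = ball_profile (radius (displacement u.\<beta> u.\<gamma> x)) / u.defect"
    using u.optimal_density_maximizer by blast
  obtain y where y: "y \<in> feasible u.\<gamma> u.\<beta>" "\<And>z. z \<in> feasible u.\<gamma> u.\<beta> \<Longrightarrow> displacement u.\<gamma> u.\<beta> z \<le> displacement u.\<gamma> u.\<beta> y"
    "optimal_density v.rotation_group = ball_profile (radius (displacement u.\<gamma> u.\<beta> y)) / v.defect"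
    using v.optimal_density_maximizer unfolding e by blast
  have swap: "prod.swap z \<in> feasible \<gamma> \<beta>" "displacement \<gamma> \<beta> (prod.swap z) = displacement \<beta> \<gamma> z" if "z \<in> feasible \<beta> \<gamma>" for z \<beta> \<gamma>
    using that feasible_swap[of "fst z" "snd z" \<beta> \<gamma>] displacement_swap[of \<beta> \<gamma> "fst z" "snd z"]
    by (cases z; simp)+
  have "displacement u.\<beta> u.\<gamma> x = displacement u.\<gamma> u.\<beta> y"
    using x(2)[OF swap(1)[OF y(1)]] y(2)[OF swap(1)[OF x(1)]] swap(2)[OF y(1)] swap(2)[OF x(1)] by simp
  moreover have "u.defect = v.defect" unfolding u.defect_eq v.defect_eq by simp
  ultimately show ?thesis unfolding x(3) y(3) by simp
qed

text \<open>The family of groups is an arbitrary choice, one for each pair. The first conjunct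
  provides the maxima, so that every \<open>optimal_density\<close> in the others is an attained
  maximum and not an unspecified value.\<close>

theorem theorem4p6:
  fixes \<Gamma>\<^sub>0 :: "nat \<Rightarrow> nat \<Rightarrow> (complex \<Rightarrow> complex) set"
  assumes "\<And>p1 p2. admissible p1 p2 \<Longrightarrow> triangle_rotation_group p1 p2 (\<Gamma>\<^sub>0 p1 p2)"
  shows "(\<forall>p1 p2. admissible p1 p2 \<longrightarrow>
            (\<exists>\<delta>\<in>packing_densities (\<Gamma>\<^sub>0 p1 p2). \<forall>\<delta>'\<in>packing_densities (\<Gamma>\<^sub>0 p1 p2). \<delta>' \<le> \<delta>)) \<and>
         admissible 5 4 \<and> admissible 4 5 \<and>
         (\<forall>p1 p2. admissible p1 p2 \<longrightarrow>
            optimal_density (\<Gamma>\<^sub>0 p1 p2) \<le> optimal_density (\<Gamma>\<^sub>0 5 4) \<and>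
            optimal_density (\<Gamma>\<^sub>0 p1 p2) \<le> optimal_density (\<Gamma>\<^sub>0 4 5)) \<and>
         0.53975 \<le> optimal_density (\<Gamma>\<^sub>0 5 4) \<and> optimal_density (\<Gamma>\<^sub>0 5 4) < 0.53976"
proof -
  have adm: "admissible 5 4" "admissible 4 5" by (simp_all add: admissible_def)
  have tri: "\<exists>uA uB uC A B. hyp_triangle uA uB uC p1 p2 A B \<and> \<Gamma>\<^sub>0 p1 p2 = hyp_triangle.rotation_group uA uB uC"
    if "admissible p1 p2" for p1 p2
    using triangle_rotation_group_cases[OF that assms[OF that]] by metis
  obtain uA uB uC A B where u: "hyp_triangle uA uB uC 4 5 A B" "\<Gamma>\<^sub>0 4 5 = hyp_triangle.rotation_group uA uB uC"
    using tri[OF adm(2)] by blast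
  obtain vA vB vC A' B' where v: "hyp_triangle vA vB vC 5 4 A' B'" "\<Gamma>\<^sub>0 5 4 = hyp_triangle.rotation_group vA vB vC"
    using tri[OF adm(1)] by blast
  have eq: "optimal_density (\<Gamma>\<^sub>0 4 5) = optimal_density (\<Gamma>\<^sub>0 5 4)"
    unfolding u(2) v(2) by (rule optimal_density_swap[OF u(1) v(1)])
  have bounds: "53975 / 100000 \<le> optimal_density (\<Gamma>\<^sub>0 5 4)" "optimal_density (\<Gamma>\<^sub>0 5 4) < 53976 / 100000"
    unfolding eq[symmetric] u(2) by (rule hyp_triangle.optimal_density_bounds_4_5[OF u(1) refl refl])+
  have le: "optimal_density (\<Gamma>\<^sub>0 p1 p2) \<le> optimal_density (\<Gamma>\<^sub>0 5 4)" if "admissible p1 p2" for p1 p2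
  proof (cases "(p1, p2) = (4, 5) \<or> (p1, p2) = (5, 4)")
    case True
    then show ?thesis using eq by auto
  next
    case False
    obtain wA wB wC C D where w: "hyp_triangle wA wB wC p1 p2 C D" "\<Gamma>\<^sub>0 p1 p2 = hyp_triangle.rotation_group wA wB wC"
      using tri[OF \<open>admissible p1 p2\<close>] by blast
    have "optimal_density (\<Gamma>\<^sub>0 p1 p2) \<le> 53975 / 100000"
      unfolding w(2) using False by (intro hyp_triangle.optimal_density_le_of_not_4_5[OF w(1)]) auto
    then show ?thesis using bounds(1) by linarith
  qed
  have ex: "\<exists>\<delta>\<in>packing_densities (\<Gamma>\<^sub>0 p1 p2). \<forall>\<delta>'\<in>packing_densities (\<Gamma>\<^sub>0 p1 p2). \<delta>' \<le> \<delta>" if ad: "admissible p1 p2" for p1 p2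
    using tri[OF ad] hyp_triangle.optimal_density_exists by metis
  show ?thesis using adm ex le eq bounds by simp
qed

end
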